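(* Let $p_-<0<p_+$ and $\lambda_-,\lambda_+>0$. Let $(X,E)$ be the piecewise deterministic Markov process on $\mathbb{R}\times I$, $I=\{-1,1\}$, obtained by switching between the vector fields $f_{-1}(x)=p_-x-x^3$ and $f_1(x)=p_+x-x^3$, with rate $\lambda_-$ of switching from $f_{-1}$ to $f_1$ and rate $\lambda_+$ of switching from $f_1$ to $f_{-1}$, and let $(\mathsf{P}^t)_{t\ge 0}$ be its Markov semigroup. Let $\delta$ be the product of the Dirac measure at $0\in\mathbb{R}$ and the probability measure on $I$ assigning mass $\frac{\lambda_+}{\lambda_++\lambda_-}$ to $-1$ and mass $\frac{\lambda_-}{\lambda_++\lambda_-}$ to $1$. Then: 1. If $\frac{\lambda_+}{p_+}<-\frac{\lambda_-}{p_-}$, then $(\mathsf{P}^t)$ admits exactly three ergodic invariant probability measures: the measure $\delta$, a measure $\mu$ with $\mu((0,\infty)\times I)=1$, and a measure $\pi$ with $\pi((-\infty,0)\times I)=1$. 2. If $\frac{\lambda_+}{p_+}\ge-\frac{\lambda_-}{p_-}$, then $\delta$ is the unique invariant probability measure of $(\mathsf{P}^t)$.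
   Context: The process $(X,E)$: $E=(E_t)_{t\ge0}$ is the continuous-time Markov chain on $I=\{-1,1\}$ that jumps from $-1$ to $1$ at rate $\lambda_-$ and from $1$ to $-1$ at rate $\lambda_+$ (rates independent of $X$), and $X$ solves $X_t=X_0+\int_0^t f_{E_s}(X_s)\,ds$. The pair $(X,E)$ is a Markov process with semigroup $(\mathsf{P}^t)$. An invariant probability measure (IPM) of $(\mathsf{P}^t)$ is a probability measure $\mu$ on the state space $\mathbb{R}\times I$ with $\mu\mathsf{P}^t=\mu$ for all $t\ge0$. An IPM $\nu$ is ergodic if $\nu(A)\in\{0,1\}$ for every measurable set $A$ of the state space such that for all $t\ge0$, $\mathsf{P}^t_z(A)=1$ for $\nu$-almost every $z\in A$, where $\mathsf{P}^t_z$ is the law of the process at time $t$ started at $z$. *)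

theory Defs
  imports "HOL-Probability.Probability"
begin

definition modes :: "int set" where
  "modes = {-1, 1}"

definition state_space :: "(real \<times> int) measure" where
  "state_space = borel \<Otimes>\<^sub>M count_space modes"

text \<open>
  The chain on \<open>modes\<close> that leaves \<open>j\<close> at rate \<open>r j\<close>, given by its jump chain, which
  alternates deterministically, and its independent exponential holding times: \<open>T n\<close> is the time
  spent in the \<open>n\<close>-th visited state \<open>i * (-1) ^ n\<close>. Since \<open>r\<close> is positive
  on \<open>modes\<close>, the jump times almost surely tend to infinity, so the last clause determines
  \<open>E t\<close> for all \<open>t \<ge> 0\<close> almost surely.
\<close>

definition switching_chain ::
  "(int \<Rightarrow> real) \<Rightarrow> int \<Rightarrow> 'w measure \<Rightarrow> (real \<Rightarrow> 'w \<Rightarrow> int) \<Rightarrow> bool" where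
  "switching_chain r i M E \<longleftrightarrow>
     prob_space M \<and>
     (\<forall>t\<ge>0. E t \<in> measurable M (count_space modes)) \<and>
     (\<exists>T :: nat \<Rightarrow> 'w \<Rightarrow> real.
        prob_space.indep_vars M (\<lambda>_. borel) T UNIV \<and>
        (\<forall>n. distributed M lborel (T n) (exponential_density (r (i * (-1) ^ n)))) \<and>
        (AE \<omega> in M. \<forall>n. \<forall>t\<ge>0.
           (\<Sum>k<n. T k \<omega>) \<le> t \<and> t < (\<Sum>k<Suc n. T k \<omega>) \<longrightarrow> E t \<omega> = i * (-1) ^ n))"

definition pdmp_from ::
  "(int \<Rightarrow> real \<Rightarrow> real) \<Rightarrow> (int \<Rightarrow> real) \<Rightarrow> real \<times> int \<Rightarrow> 'w measure \<Rightarrow>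
   (real \<Rightarrow> 'w \<Rightarrow> real) \<Rightarrow> (real \<Rightarrow> 'w \<Rightarrow> int) \<Rightarrow> bool" where
  "pdmp_from f r z M X E \<longleftrightarrow>
     switching_chain r (snd z) M E \<and>
     (\<forall>t\<ge>0. X t \<in> borel_measurable M) \<and>
     (AE \<omega> in M. X 0 \<omega> = fst z \<and>
        (\<forall>t\<ge>0. ((\<lambda>s. f (E s \<omega>) (X s \<omega>)) has_integral (X t \<omega> - X 0 \<omega>)) {0..t}))"

text \<open>The law of \<open>(X t, E t)\<close> for the process started at \<open>z\<close>, realised on \<open>M z\<close>.\<close>

definition pdmp_semigroup ::
  "(real \<times> int \<Rightarrow> 'w measure) \<Rightarrow> (real \<times> int \<Rightarrow> real \<Rightarrow> 'w \<Rightarrow> real) \<Rightarrow>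
   (real \<times> int \<Rightarrow> real \<Rightarrow> 'w \<Rightarrow> int) \<Rightarrow> real \<Rightarrow> real \<times> int \<Rightarrow> (real \<times> int) measure" where
  "pdmp_semigroup M X E t z = distr (M z) state_space (\<lambda>\<omega>. (X z t \<omega>, E z t \<omega>))"

definition invariant_prob ::
  "(real \<Rightarrow> real \<times> int \<Rightarrow> (real \<times> int) measure) \<Rightarrow> (real \<times> int) measure \<Rightarrow> bool" where
  "invariant_prob P \<mu> \<longleftrightarrow>
     prob_space \<mu> \<and> sets \<mu> = sets state_space \<and>
     (\<forall>t\<ge>0. \<forall>A\<in>sets state_space. (\<integral>\<^sup>+z. emeasure (P t z) A \<partial>\<mu>) = emeasure \<mu> A)"

definition ergodic_prob ::
  "(real \<Rightarrow> real \<times> int \<Rightarrow> (real \<times> int) measure) \<Rightarrow> (real \<times> int) measure \<Rightarrow> bool" where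
  "ergodic_prob P \<nu> \<longleftrightarrow>
     invariant_prob P \<nu> \<and>
     (\<forall>A\<in>sets state_space.
        (\<forall>t\<ge>0. AE z in \<nu>. z \<in> A \<longrightarrow> emeasure (P t z) A = 1) \<longrightarrow> emeasure \<nu> A \<in> {0, 1})"

definition cubic_field :: "real \<Rightarrow> real \<Rightarrow> int \<Rightarrow> real \<Rightarrow> real" where
  "cubic_field pm pp i x = (if i = -1 then pm * x - x ^ 3 else pp * x - x ^ 3)"

definition switch_rate :: "real \<Rightarrow> real \<Rightarrow> int \<Rightarrow> real" where
  "switch_rate lm lp i = (if i = -1 then lm else lp)"

definition delta_measure :: "real \<Rightarrow> real \<Rightarrow> (real \<times> int) measure" where
  "delta_measure lm lp =
     return borel 0 \<Otimes>\<^sub>M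
     point_measure modes (\<lambda>i. ennreal (if i = -1 then lp / (lp + lm) else lm / (lp + lm)))"

end

theory Submission
  imports Defs
begin

text \<open>
  In the coordinate \<open>y = 1 / x\<^sup>2\<close> both flows are affine, so started from the same mode and driven by
  the same switching path, two solutions of the same sign satisfy
  \<open>\<bar>y\<^sub>t - y'\<^sub>t\<bar> = exp (- 2 A\<^sub>t) * \<bar>y\<^sub>0 - y'\<^sub>0\<bar>\<close> with \<open>A\<^sub>t\<close> the time integral of the growth rate.
  If the stationary mean growth rate is positive, \<open>E (exp (- 2 \<theta> A\<^sub>t))\<close> decays
  exponentially for small \<open>\<theta> > 0\<close>; together with the uniqueness of the mode marginal this gives
  uniqueness of the invariant measure on each half line, and it exists because the stationary
  density can be written down and normalised. An invariant measure that is unique on an invariant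
  region is ergodic, since it cannot be conditioned on a nontrivial invariant set.

  If the mean growth rate is at most zero, integrating the generator applied to
  \<open>R powr \<theta> * (1 + \<theta> * \<gamma>\<^sub>i)\<close>, where \<open>R\<close> is a bounded version of \<open>x\<^sup>2\<close>, against an invariant
  measure and letting \<open>\<theta>\<close> tend to zero forces that measure to sit at the origin; this covers the
  critical case as well.

  The law of the process at a fixed time is expanded over the number of jumps. The expansion is the
  least nonnegative solution of the first-jump equation, so it is bounded above by supersolutions.
\<close>

text \<open>Invariance and ergodicity are stated through \<open>P t\<close> for each single
  \<open>t\<close>, so every argument fixes \<open>t\<close> and works with the expansion of
  \<open>P t\<close>. Comparison with supersolutions yields upper bounds only. Three devices turn
  them into equalities: two probability measures of which one is below the other on all sets
  coincide; the generator inequality can be applied to a function and to its negative; and the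
  partial sums for the constant 1 have an explicit error term, which rules out infinitely many jumps
  in finite time. Both flows preserve the sign of the position, so the state space splits into two
  half lines and the origin, each of which is treated on its own. In the critical case the linear
  growth gives no decay: the terms of first order in \<open>\<theta>\<close> cancel. What decides is
  the cubic damping, which is of order \<open>\<theta>\<close> while the remaining growth term is of
  order \<open>\<theta>\<close> squared.\<close>

section \<open>Integrals of derivatives and of exponential densities\<close>

lemma nn_integral_FTC_open:
  fixes k k' :: "real \<Rightarrow> real"
  assumes ab: "a \<le> b" and cont: "continuous_on {a..b} k"
    and deriv: "\<And>x. a < x \<Longrightarrow> x < b \<Longrightarrow> (k has_real_derivative k' x) (at x)"
    and nonpos: "\<And>x. a < x \<Longrightarrow> x < b \<Longrightarrow> k' x \<le> 0"
  shows "(\<integral>\<^sup>+x. ennreal (- k' x) * indicator {a<..<b} x \<partial>lborel) = ennreal (k a - k b)"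
    and "k b \<le> k a"
proof -
  define f where "f = (\<lambda>x. if x \<in> {a<..<b} then - k' x else 0)"
  \<comment> \<open>The interior form of the fundamental theorem: \<open>k\<close> may fail to be
    differentiable at an endpoint, as happens at the edge of the support of the stationary
    density.\<close>
  have "((\<lambda>x. - k' x) has_integral (- k b - - k a)) {a..b}"
    using ab cont deriv
    by (intro fundamental_theorem_of_calculus_interior)
      (auto intro!: continuous_intros derivative_eq_intros
        simp flip: has_real_derivative_iff_has_vector_derivative)
  then have "((\<lambda>x. - k' x) has_integral (k a - k b)) {a..b}" by simp
  then have I: "(f has_integral (k a - k b)) {a..b}"
    by (rule has_integral_spike_finite[of "{a, b}", rotated 2]) (auto simp: f_def)
  have f: "0 \<le> f x" for x
    using nonpos by (simp add: f_def)
  have "(\<integral>\<^sup>+x. ennreal (- k' x) * indicator {a<..<b} x \<partial>lborel) =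
      (\<integral>\<^sup>+x. ennreal (indicator {a..b} x * f x) \<partial>lborel)"
    by (intro nn_integral_cong) (auto simp: f_def indicator_def)
  also have "\<dots> = ennreal (k a - k b)"
    by (rule nn_integral_has_integral_lebesgue[OF f I])
  finally show "(\<integral>\<^sup>+x. ennreal (- k' x) * indicator {a<..<b} x \<partial>lborel) = ennreal (k a - k b)" .
  show "k b \<le> k a" using has_integral_nonneg[OF I f] by simp
qed

lemma measurable_exponential_density' [measurable]:
  assumes [measurable]: "l \<in> borel_measurable N" "x \<in> borel_measurable N"
  shows "(\<lambda>w. exponential_density (l w) (x w)) \<in> borel_measurable N"
  unfolding exponential_density_def by measurable

lemma nn_integral_exponential_tail:
  assumes "0 < l" "0 \<le> a"
  shows "(\<integral>\<^sup>+\<tau>. ennreal (exponential_density l \<tau>) * indicator {a<..} \<tau> \<partial>lborel) = ennreal (exp (- l * a))"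
    and "(\<integral>\<^sup>+\<tau>. ennreal (exponential_density l \<tau>) * indicator {..a} \<tau> \<partial>lborel) =
      ennreal (1 - exp (- l * a))"
proof -
  interpret D: prob_space "density lborel (exponential_density l)"
    by (rule prob_space_exponential_density[OF assms(1)])
  have D: "distributed (density lborel (exponential_density l)) lborel (\<lambda>x. x) (exponential_density l)"
    by (simp add: distributed_def distr_id2)
  have "emeasure (density lborel (exponential_density l)) {..a} = ennreal (1 - exp (- l * a))"
    using D.exponential_distributedD_le[OF D assms(2,1)]
    by (simp add: D.emeasure_eq_measure atMost_def mult.commute)
  then show "(\<integral>\<^sup>+\<tau>. ennreal (exponential_density l \<tau>) * indicator {..a} \<tau> \<partial>lborel) =
      ennreal (1 - exp (- l * a))"
    by (simp add: emeasure_density)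
  have "emeasure (density lborel (exponential_density l)) {a<..} = ennreal (exp (- l * a))"
    using D.exponential_distributedD_gt[OF D assms(2,1)]
    by (simp add: D.emeasure_eq_measure greaterThan_def mult.commute)
  then show "(\<integral>\<^sup>+\<tau>. ennreal (exponential_density l \<tau>) * indicator {a<..} \<tau> \<partial>lborel) =
      ennreal (exp (- l * a))"
    by (simp add: emeasure_density)
qed

lemma nn_integral_exponential_Icc:
  assumes "0 < l" "0 \<le> t" "0 \<le> v"
  shows "(\<integral>\<^sup>+s. indicator {0..t} s * ennreal (v * exp (- (l * s))) \<partial>lborel) = ennreal (v / l * (1 - exp (- (l * t))))"
proof -
  have "(\<integral>\<^sup>+s. indicator {0..t} s * ennreal (v * exp (- (l * s))) \<partial>lborel) =
      (\<integral>\<^sup>+s. ennreal (v / l) * (ennreal (exponential_density l s) * indicator {..t} s) \<partial>lborel)"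
    using assms by (intro nn_integral_cong)
      (auto simp: indicator_def exponential_density_def mult.commute simp flip: ennreal_mult)
  also have "\<dots> = ennreal (v / l) * ennreal (1 - exp (- (l * t)))"
    using assms by (subst nn_integral_cmult) (auto simp: nn_integral_exponential_tail)
  also have "\<dots> = ennreal (v / l * (1 - exp (- (l * t))))"
    using assms by (intro ennreal_mult[symmetric]) auto
  finally show ?thesis .
qed

lemma suminf_indicator_intervals:
  fixes S :: "nat \<Rightarrow> real"
  assumes "incseq S"
  shows "(\<Sum>n. indicator {n. S n \<le> t \<and> t < S (Suc n)} n :: ennreal) =
    (if \<exists>n. S n \<le> t \<and> t < S (Suc n) then 1 else 0)"
proof (cases "\<exists>n. S n \<le> t \<and> t < S (Suc n)")
  case True
  then obtain n where n: "S n \<le> t" "t < S (Suc n)" by auto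
  have "m = n" if "S m \<le> t" "t < S (Suc m)" for m
  proof (rule ccontr)
    assume "m \<noteq> n"
    then consider "Suc m \<le> n" | "Suc n \<le> m" by linarith
    then show False
      using n that incseqD[OF assms] by (metis leD order_trans)
  qed
  then have eq: "{n. S n \<le> t \<and> t < S (Suc n)} = {n}" using n by blast
  have "(\<Sum>m. indicator {n} m :: ennreal) = (\<Sum>m\<in>{n}. indicator {n} m)"
    by (rule suminf_finite) auto
  then have "(\<Sum>m. indicator {n} m :: ennreal) = 1" by simp
  then show ?thesis unfolding eq using True by (simp only: if_True)
next
  case False
  then have eq: "{n. S n \<le> t \<and> t < S (Suc n)} = {}" by blast
  show ?thesis unfolding eq using False by simp
qed

section \<open>Measurability on the state space and with a clock\<close>

text \<open>The first coordinate is the time already elapsed. With it in the state, one step of the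
  jump expansion is a single operator that can be iterated towards a fixed horizon.\<close>

definition space_time :: "(real \<times> real \<times> int) measure" where
  "space_time = borel \<Otimes>\<^sub>M state_space"

lemma space_state_space: "space state_space = UNIV \<times> modes"
  by (simp add: state_space_def space_pair_measure)

lemma modes_uminus [simp]: "- i \<in> modes \<longleftrightarrow> i \<in> modes"
  by (auto simp: modes_def)

lemma modes_alternate [simp]: "i * (-1) ^ n \<in> modes \<longleftrightarrow> i \<in> modes"
  by (cases "even n") (auto simp: modes_def)

lemma measurable_mode_uminus [measurable]:
  "uminus \<in> measurable (count_space modes) (count_space modes)"
  by simp

lemma measurable_state [measurable]:
  assumes "x \<in> borel_measurable N" "i \<in> measurable N (count_space modes)"
  shows "(\<lambda>w. (x w, i w)) \<in> measurable N state_space"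
  using assms unfolding state_space_def by measurable

lemma measurable_space_time [measurable]:
  assumes "s \<in> borel_measurable N" "x \<in> borel_measurable N" "i \<in> measurable N (count_space modes)"
  shows "(\<lambda>w. (s w, x w, i w)) \<in> measurable N space_time"
  using assms unfolding space_time_def by measurable

lemma measurable_state_projections [measurable]:
  "fst \<in> borel_measurable state_space"
  "snd \<in> measurable state_space (count_space modes)"
  "fst \<in> borel_measurable space_time"
  "(\<lambda>w. fst (snd w)) \<in> borel_measurable space_time"
  "(\<lambda>w. snd (snd w)) \<in> measurable space_time (count_space modes)"
  unfolding space_time_def state_space_def by measurable

lemma measurable_on_state [measurable (raw)]:
  assumes "g \<in> borel_measurable state_space"
    "x \<in> borel_measurable N" "i \<in> measurable N (count_space modes)"
  shows "(\<lambda>w. g (x w, i w)) \<in> borel_measurable N"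
  using measurable_compose[OF measurable_state[OF assms(2,3)] assms(1)] .

lemma measurable_on_space_time [measurable (raw)]:
  assumes "g \<in> borel_measurable space_time"
    "s \<in> borel_measurable N" "x \<in> borel_measurable N" "i \<in> measurable N (count_space modes)"
  shows "(\<lambda>w. g (s w, x w, i w)) \<in> borel_measurable N"
  using measurable_compose[OF measurable_space_time[OF assms(2,3,4)] assms(1)] .

section \<open>The switched flow\<close>

locale cubic_switching =
  fixes pm pp lm lp :: real
  assumes pm_neg: "pm < 0" and pp_pos: "0 < pp" and lm_pos: "0 < lm" and lp_pos: "0 < lp"
begin

abbreviation rate :: "int \<Rightarrow> real" where
  "rate \<equiv> switch_rate lm lp"

definition growth :: "int \<Rightarrow> real" where
  "growth i = (if i = -1 then pm else pp)"

lemma rate_pos [simp]: "0 < rate i"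
  using lm_pos lp_pos by (simp add: switch_rate_def)

lemma rate_nonneg [simp]: "0 \<le> rate i"
  by (rule less_imp_le[OF rate_pos])

lemma growth_nz [simp]: "growth i \<noteq> 0"
  using pm_neg pp_pos by (simp add: growth_def)

lemma cubic_field_eq: "cubic_field pm pp i x = growth i * x - x ^ 3"
  by (simp add: cubic_field_def growth_def)

text \<open>For \<open>x \<noteq> 0\<close> the substitution \<open>y = 1 / x\<^sup>2\<close> turns \<open>x' = p x - x ^ 3\<close> into the affine
  equation \<open>y' = 2 - 2 p y\<close>, which gives the flow in closed form.\<close>

definition flow :: "int \<Rightarrow> real \<Rightarrow> real \<Rightarrow> real" where
  "flow i s x =
     x * exp (growth i * s) / sqrt (1 + x\<^sup>2 * ((exp (2 * growth i * s) - 1) / growth i))"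

lemma flow_denom_pos:
  assumes "0 \<le> s"
  shows "0 < 1 + x\<^sup>2 * ((exp (2 * growth i * s) - 1) / growth i)"
proof -
  have "0 \<le> (exp (2 * growth i * s) - 1) / growth i"
  proof (cases "growth i > 0")
    case True
    then show ?thesis using assms by simp
  next
    case False
    then have "growth i < 0" using growth_nz[of i] by linarith
    then show ?thesis using assms by (simp add: divide_nonpos_neg mult_nonpos_nonneg)
  qed
  then have "0 \<le> x\<^sup>2 * ((exp (2 * growth i * s) - 1) / growth i)"
    by (intro mult_nonneg_nonneg) auto
  then show ?thesis by linarith
qed

lemma flow_0 [simp]: "flow i 0 x = x"
  by (simp add: flow_def)

lemma flow_zero [simp]: "flow i s 0 = 0"
  by (simp add: flow_def)

lemma sgn_flow: "0 \<le> s \<Longrightarrow> sgn (flow i s x) = sgn x"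
  using flow_denom_pos[of s x i] by (simp add: flow_def sgn_mult sgn_divide)

lemma flow_eq_0_iff: "0 \<le> s \<Longrightarrow> flow i s x = 0 \<longleftrightarrow> x = 0"
  using sgn_flow[of s i x] by (metis sgn_0_0)

lemma inverse_square_flow:
  assumes "0 \<le> s" "x \<noteq> 0"
  shows "1 / (flow i s x)\<^sup>2 =
    1 / growth i + exp (- 2 * growth i * s) * (1 / x\<^sup>2 - 1 / growth i)"
proof -
  let ?p = "growth i"
  let ?D = "1 + x\<^sup>2 * ((exp (2 * ?p * s) - 1) / ?p)"
  have D: "0 < ?D" by (rule flow_denom_pos[OF assms(1)])
  have e: "exp (- 2 * ?p * s) = 1 / (exp (?p * s))\<^sup>2"
    by (simp add: exp_minus field_simps power2_eq_square flip: exp_add)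
  have e2: "exp (2 * ?p * s) = (exp (?p * s))\<^sup>2"
    by (simp add: power2_eq_square mult.assoc flip: exp_add)
  have "(flow i s x)\<^sup>2 = x\<^sup>2 * (exp (?p * s))\<^sup>2 / ?D"
    using D by (simp add: flow_def power_mult_distrib power_divide)
  then have "1 / (flow i s x)\<^sup>2 = ?D / (x\<^sup>2 * (exp (?p * s))\<^sup>2)"
    by simp
  also have "\<dots> = 1 / ?p + exp (- 2 * ?p * s) * (1 / x\<^sup>2 - 1 / ?p)"
    unfolding e e2 using assms(2) growth_nz[of i] by (simp add: field_simps)
  finally show ?thesis .
qed

lemma flow_deriv:
  assumes "0 \<le> s"
  shows "((\<lambda>s. flow i s x) has_real_derivative growth i * flow i s x - flow i s x ^ 3) (at s)"
proof -
  let ?p = "growth i"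
  let ?D = "\<lambda>s. 1 + x\<^sup>2 * ((exp (2 * ?p * s) - 1) / ?p)"
  have D: "0 < ?D s" by (rule flow_denom_pos[OF assms])
  have "((\<lambda>s. x * exp (?p * s) / sqrt (?D s)) has_real_derivative
      (x * (exp (?p * s) * ?p) * sqrt (?D s) -
        x * exp (?p * s) * (inverse (sqrt (?D s)) / 2 * (x\<^sup>2 * (exp (2 * ?p * s) * (2 * ?p) / ?p))))
       / (sqrt (?D s) * sqrt (?D s))) (at s)"
    using D by (auto intro!: derivative_eq_intros)
  moreover have "(x * (exp (?p * s) * ?p) * sqrt (?D s) -
        x * exp (?p * s) * (inverse (sqrt (?D s)) / 2 * (x\<^sup>2 * (exp (2 * ?p * s) * (2 * ?p) / ?p))))
       / (sqrt (?D s) * sqrt (?D s)) = ?p * flow i s x - flow i s x ^ 3"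
  proof -
    define r where "r = sqrt (?D s)"
    have r: "r > 0" using D by (simp add: r_def)
    have e2: "exp (2 * ?p * s) = (exp (?p * s))\<^sup>2"
      by (simp add: power2_eq_square mult.assoc flip: exp_add)
    have "(x * (exp (?p * s) * ?p) * r -
        x * exp (?p * s) * (inverse r / 2 * (x\<^sup>2 * ((exp (?p * s))\<^sup>2 * (2 * ?p) / ?p))))
       / (r * r) = ?p * (x * exp (?p * s) / r) - (x * exp (?p * s) / r) ^ 3"
      using r growth_nz[of i] by (simp add: field_simps power2_eq_square power3_eq_cube)
    then show ?thesis unfolding flow_def e2[symmetric] r_def .
  qed
  ultimately show ?thesis by (simp add: flow_def)
qed

text \<open>Uniqueness for the integral equation on one holding interval. The cubic term is
  monotone, so the squared difference of two solutions, discounted by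
  \<open>exp (- 2 * ?p * t)\<close> to cancel the linear term, cannot increase. The mode is
  prescribed on the half-open interval only, as between jump times; continuity carries the
  conclusion to \<open>b\<close>.\<close>

lemma integral_solution_eq_flow:
  assumes "a \<le> b"
    and sol: "\<And>t. t \<in> {a..b} \<Longrightarrow>
      ((\<lambda>s. cubic_field pm pp (e s) (u s)) has_integral (u t - u a)) {a..t}"
    and e: "\<And>s. a \<le> s \<Longrightarrow> s < b \<Longrightarrow> e s = i"
  shows "u b = flow i (b - a) (u a)"
proof -
  let ?p = "growth i"
  let ?f = "\<lambda>s. cubic_field pm pp (e s) (u s)"
  define v where "v = (\<lambda>t. flow i (t - a) (u a))"
  have u_eq: "u t = u a + integral {a..t} ?f" if "t \<in> {a..b}" for t
    using integral_unique[OF sol[OF that]] by simp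
  \<comment> \<open>Continuity of \<open>u\<close> is not an assumption; it comes from the equation,
    whose right side is an indefinite integral.\<close>
  have "continuous_on {a..b} (\<lambda>t. u a + integral {a..t} ?f)"
    using sol[of b] assms(1)
    by (intro continuous_on_add continuous_on_const indefinite_integral_continuous_1) auto
  then have cu: "continuous_on {a..b} u"
    by (subst continuous_on_cong[OF refl u_eq]) auto
  then have cg: "continuous_on {a..b} (\<lambda>s. ?p * u s - u s ^ 3)"
    by (intro continuous_intros)
  have du: "(u has_real_derivative ?p * u t - u t ^ 3) (at t)" if t: "t \<in> {a<..<b}" for t
  proof -
    have "((\<lambda>t. integral {a..t} (\<lambda>s. ?p * u s - u s ^ 3)) has_real_derivative
        ?p * u t - u t ^ 3) (at t within {a..b})"
      using cg t by (intro integral_has_real_derivative) auto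
    then have "((\<lambda>t. u a + integral {a..t} (\<lambda>s. ?p * u s - u s ^ 3)) has_real_derivative
        ?p * u t - u t ^ 3) (at t within {a..b})"
      by (auto intro!: derivative_eq_intros)
    then have "((\<lambda>t. u a + integral {a..t} (\<lambda>s. ?p * u s - u s ^ 3)) has_real_derivative
        ?p * u t - u t ^ 3) (at t within {a<..<b})"
      by (rule DERIV_subset) auto
    then have *: "((\<lambda>t. u a + integral {a..t} (\<lambda>s. ?p * u s - u s ^ 3)) has_real_derivative
        ?p * u t - u t ^ 3) (at t)"
      using t by (simp add: at_within_open[of t "{a<..<b}"])
    have "u a + integral {a..r} (\<lambda>s. ?p * u s - u s ^ 3) = u r" if r: "r \<in> {a<..<b}" for r
      using r e by (subst u_eq) (auto intro!: integral_cong simp: cubic_field_eq)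
    then show ?thesis
      using t by (intro has_field_derivative_transform_within_open[OF *, of "{a<..<b}"]) auto
  qed
  have dv: "(v has_real_derivative ?p * v t - v t ^ 3) (at t)" if "a \<le> t" for t
  proof -
    have "((\<lambda>s. flow i s (u a)) has_real_derivative ?p * v t - v t ^ 3) (at (t - a))"
      using flow_deriv[of "t - a" i "u a"] that by (simp add: v_def)
    moreover have "((\<lambda>t. t - a) has_real_derivative 1) (at t)"
      by (auto intro!: derivative_eq_intros)
    ultimately show ?thesis
      using DERIV_chain2[where f = "\<lambda>s. flow i s (u a)" and g = "\<lambda>t. t - a"]
      unfolding v_def by fastforce
  qed
  have cv: "continuous_on {a..b} v"
    by (rule DERIV_continuous_on[OF DERIV_subset[OF dv]]) auto
  define w where "w = (\<lambda>t. (u t - v t)\<^sup>2 * exp (- 2 * ?p * t))"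
  have cw: "continuous_on {a..b} w"
    unfolding w_def by (intro continuous_intros cu cv)
  have dw: "(w has_real_derivative
      - 2 * (u t - v t)\<^sup>2 * ((u t)\<^sup>2 + u t * v t + (v t)\<^sup>2) * exp (- 2 * ?p * t)) (at t)"
    if "t \<in> {a<..<b}" for t
    unfolding w_def using that
    by (auto intro!: derivative_eq_intros du dv)
      (simp add: algebra_simps power2_eq_square power3_eq_cube)
  have nonpos: "- 2 * (u t - v t)\<^sup>2 * ((u t)\<^sup>2 + u t * v t + (v t)\<^sup>2) * exp (- 2 * ?p * t) \<le> 0" for t
  proof -
    have "0 \<le> (u t)\<^sup>2 + u t * v t + (v t)\<^sup>2"
      using zero_le_power2[of "u t + v t"] zero_le_power2[of "u t"] zero_le_power2[of "v t"]
      unfolding power2_sum by linarith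
    then show ?thesis
      by (simp add: mult_nonneg_nonneg)
  qed
  have "w b \<le> w a"
  proof (cases "a = b")
    case False
    then have "a < b" using assms(1) by simp
    show ?thesis
    proof (rule DERIV_nonpos_imp_decreasing_open[OF less_imp_le[OF \<open>a < b\<close>] _ cw])
      fix t assume "a < t" "t < b"
      then have "t \<in> {a<..<b}" by simp
      from dw[OF this] nonpos[of t]
      show "\<exists>y. (w has_real_derivative y) (at t) \<and> y \<le> 0" by blast
    qed
  qed simp
  moreover have "w a = 0" by (simp add: w_def v_def)
  ultimately have "w b \<le> 0" by simp
  then have "u b = v b" by (simp add: w_def mult_le_0_iff)
  then show ?thesis by (simp add: v_def)
qed

primrec jump_pos :: "int \<Rightarrow> real \<Rightarrow> (nat \<Rightarrow> real) \<Rightarrow> nat \<Rightarrow> real" where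
  "jump_pos i x \<tau> 0 = x"
| "jump_pos i x \<tau> (Suc n) = flow (i * (-1) ^ n) (\<tau> n) (jump_pos i x \<tau> n)"

text \<open>The equation restarts at every jump: subtracting its instances at two times gives the
  same equation on a later interval, where the mode is constant up to the next jump.\<close>

lemma solution_eq_flow_jump_pos:
  assumes tau: "\<And>k. 0 \<le> \<tau> k"
    and sol: "\<And>t. 0 \<le> t \<Longrightarrow>
      ((\<lambda>s. cubic_field pm pp (e s) (u s)) has_integral (u t - u 0)) {0..t}"
    and e: "\<And>n s. (\<Sum>k<n. \<tau> k) \<le> s \<Longrightarrow> s < (\<Sum>k<Suc n. \<tau> k) \<Longrightarrow> e s = i * (-1) ^ n"
    and t: "(\<Sum>k<n. \<tau> k) \<le> t" "t < (\<Sum>k<Suc n. \<tau> k)"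
  shows "u t = flow (i * (-1) ^ n) (t - (\<Sum>k<n. \<tau> k)) (jump_pos i (u 0) \<tau> n)"
proof -
  let ?f = "\<lambda>s. cubic_field pm pp (e s) (u s)"
  have S: "0 \<le> (\<Sum>k<n. \<tau> k)" for n by (intro sum_nonneg tau)
  have sol': "(?f has_integral (u t - u a)) {a..t}" if "0 \<le> a" "a \<le> t" for a t
  proof -
    have "integral {0..a} ?f + integral {a..t} ?f = integral {0..t} ?f"
      using that
      by (intro Henstock_Kurzweil_Integration.integral_combine has_integral_integrable[OF sol]) auto
    moreover have "?f integrable_on {a..t}"
      by (rule integrable_on_subinterval[OF has_integral_integrable[OF sol[of t]]]) (use that in auto)
    ultimately show ?thesis
      using integral_unique[OF sol[of a]] integral_unique[OF sol[of t]] that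
      by (simp add: has_integral_iff)
  qed
  have step: "u b = flow (i * (-1) ^ n) (b - (\<Sum>k<n. \<tau> k)) (u (\<Sum>k<n. \<tau> k))"
    if "(\<Sum>k<n. \<tau> k) \<le> b" "b \<le> (\<Sum>k<Suc n. \<tau> k)" for n b
    using that S[of n]
    by (intro integral_solution_eq_flow[where e = e] sol' e[of n]) auto
  have "u (\<Sum>k<n. \<tau> k) = jump_pos i (u 0) \<tau> n" for n
  proof (induction n)
    case (Suc n)
    show ?case
      using step[of n "\<Sum>k<Suc n. \<tau> k"] tau[of n] Suc by simp
  qed simp
  then show ?thesis using step[of n t] t by simp
qed


lemma measurable_growth [measurable]: "growth \<in> borel_measurable (count_space modes)"
  by simp

lemma measurable_rate [measurable]: "rate \<in> borel_measurable (count_space modes)"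
  by simp

lemma measurable_flow [measurable]:
  assumes [measurable]: "i \<in> measurable N (count_space modes)" "s \<in> borel_measurable N"
    "x \<in> borel_measurable N"
  shows "(\<lambda>w. flow (i w) (s w) (x w)) \<in> borel_measurable N"
  unfolding flow_def by measurable

section \<open>The jump expansion\<close>

text \<open>\<open>jump_op h\<close> is the expectation of \<open>h\<close> at the next jump, as a function of the current time
  and state; \<open>no_jump t g\<close> is the expectation of \<open>g\<close> at time \<open>t\<close> on the event that no jump
  occurs before \<open>t\<close>.\<close>

definition jump_op :: "(real \<times> real \<times> int \<Rightarrow> ennreal) \<Rightarrow> real \<times> real \<times> int \<Rightarrow> ennreal" where
  "jump_op h = (\<lambda>(s, x, i).
     \<integral>\<^sup>+\<tau>. ennreal (exponential_density (rate i) \<tau>) * h (s + \<tau>, flow i \<tau> x, - i) \<partial>lborel)"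

definition no_jump :: "real \<Rightarrow> (real \<times> int \<Rightarrow> ennreal) \<Rightarrow> real \<times> real \<times> int \<Rightarrow> ennreal" where
  "no_jump t g = (\<lambda>(s, x, i).
     if s \<le> t then ennreal (exp (- rate i * (t - s))) * g (flow i (t - s) x, i) else 0)"

text \<open>The Dyson series of the semigroup with respect to its jump part. The \<open>n\<close>-th
  term is the contribution of the paths with exactly \<open>n\<close> jumps up to time
  \<open>t\<close>: \<open>no_jump t g\<close> vanishes at clock values beyond \<open>t\<close> and
  contains the probability that no further jump occurs.\<close>

definition transition :: "real \<Rightarrow> (real \<times> int \<Rightarrow> ennreal) \<Rightarrow> real \<times> int \<Rightarrow> ennreal" where
  "transition t g z = (\<Sum>n. (jump_op ^^ n) (no_jump t g) (0, z))"

lemma measurable_jump_op [measurable]: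
  assumes [measurable]: "h \<in> borel_measurable space_time"
  shows "jump_op h \<in> borel_measurable space_time"
  unfolding jump_op_def case_prod_beta by measurable

lemma measurable_no_jump [measurable]:
  assumes [measurable]: "g \<in> borel_measurable state_space"
  shows "no_jump t g \<in> borel_measurable space_time"
  unfolding no_jump_def case_prod_beta by measurable

lemma measurable_jump_op_funpow [measurable]:
  "h \<in> borel_measurable space_time \<Longrightarrow> (jump_op ^^ n) h \<in> borel_measurable space_time"
  by (induction n) auto

lemma measurable_transition [measurable]:
  assumes [measurable]: "g \<in> borel_measurable state_space"
  shows "transition t g \<in> borel_measurable state_space"
proof -
  have "(\<lambda>z. (jump_op ^^ n) (no_jump t g) (0, fst z, snd z)) \<in> borel_measurable state_space" for n
    by measurable
  then show ?thesis unfolding transition_def by simp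
qed

lemma jump_op_mono:
  assumes "\<And>\<tau> y. 0 \<le> \<tau> \<Longrightarrow> h (s + \<tau>, y, - i) \<le> k (s + \<tau>, y, - i)"
  shows "jump_op h (s, x, i) \<le> jump_op k (s, x, i)"
  unfolding jump_op_def prod.case
proof (rule nn_integral_mono)
  fix \<tau> show "ennreal (exponential_density (rate i) \<tau>) * h (s + \<tau>, flow i \<tau> x, - i)
      \<le> ennreal (exponential_density (rate i) \<tau>) * k (s + \<tau>, flow i \<tau> x, - i)"
    by (cases "\<tau> < 0") (auto simp: exponential_density_def intro!: mult_left_mono assms)
qed

lemma jump_op_add:
  assumes [measurable]: "h \<in> borel_measurable space_time" "k \<in> borel_measurable space_time"
    and i[simp]: "i \<in> modes"
  shows "jump_op (\<lambda>w. h w + k w) (s, x, i) = jump_op h (s, x, i) + jump_op k (s, x, i)"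
  unfolding jump_op_def
  by (simp add: distrib_left flip: nn_integral_add)

lemma jump_op_sum:
  assumes [measurable]: "\<And>n. h n \<in> borel_measurable space_time"
    and i: "i \<in> modes"
  shows "jump_op (\<lambda>w. \<Sum>n<(N::nat). h n w) (s, x, i) = (\<Sum>n<N. jump_op (h n) (s, x, i))"
proof (induction N)
  case 0
  then show ?case by (simp add: jump_op_def)
next
  case (Suc N)
  then show ?case by (simp add: jump_op_add i)
qed

text \<open>First-jump decomposition; the inductions that bound partial sums of the expansion all
  take their step here.\<close>

lemma partial_sum_Suc:
  assumes [measurable]: "h \<in> borel_measurable space_time" and "i \<in> modes"
  shows "(\<Sum>n<Suc N. (jump_op ^^ n) h (s, x, i)) =
    h (s, x, i) + jump_op (\<lambda>w. \<Sum>n<N. (jump_op ^^ n) h w) (s, x, i)"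
proof -
  have "(\<Sum>n<Suc N. (jump_op ^^ n) h (s, x, i)) =
      h (s, x, i) + (\<Sum>n<N. (jump_op ^^ Suc n) h (s, x, i))"
    by (simp only: sum.lessThan_Suc_shift) simp
  then show ?thesis by (simp add: jump_op_sum assms(2))
qed

lemma transition_le_partial:
  assumes "\<And>N. (\<Sum>n<N. (jump_op ^^ n) (no_jump t g) (0, z)) \<le> c"
  shows "transition t g z \<le> c"
  unfolding transition_def suminf_eq_SUP using assms by (auto intro: SUP_least)

lemma partial_sum_le_transition:
  "(\<Sum>n<N. (jump_op ^^ n) (no_jump t g) (0, z)) \<le> transition t g z"
  unfolding transition_def suminf_eq_SUP by (rule SUP_upper) auto

lemma transition_le_supersolution:
  assumes [measurable]: "g \<in> borel_measurable state_space"
    and V: "\<And>s x i. 0 \<le> s \<Longrightarrow> i \<in> modes \<Longrightarrow> no_jump t g (s, x, i) + jump_op V (s, x, i) \<le> V (s, x, i)"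
    and z: "z \<in> space state_space"
  shows "transition t g z \<le> V (0, z)"
proof -
  have "(\<Sum>n<N. (jump_op ^^ n) (no_jump t g) (s, x, i)) \<le> V (s, x, i)"
    if "0 \<le> s" "i \<in> modes" for N s x i
    using that
  proof (induction N arbitrary: s x i)
    case (Suc N)
    have "(\<Sum>n<Suc N. (jump_op ^^ n) (no_jump t g) (s, x, i)) =
        no_jump t g (s, x, i) + jump_op (\<lambda>w. \<Sum>n<N. (jump_op ^^ n) (no_jump t g) w) (s, x, i)"
      by (rule partial_sum_Suc) (use Suc in auto)
    also have "\<dots> \<le> no_jump t g (s, x, i) + jump_op V (s, x, i)"
      using Suc by (intro add_left_mono jump_op_mono) auto
    also have "\<dots> \<le> V (s, x, i)" using Suc.prems by (rule V)
    finally show ?case .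
  qed simp
  then show ?thesis
    using z by (intro transition_le_partial) (auto simp: space_state_space)
qed

text \<open>To verify a supersolution, take for \<open>k \<tau>\<close> its value along the flow times
  \<open>exp (- rate i * \<tau>)\<close>, and for \<open>V \<tau>\<close> its value after a jump at time \<open>\<tau>\<close>.\<close>

lemma exponential_integral_le_FTC:
  fixes k V :: "real \<Rightarrow> real"
  assumes r: "0 \<le> r" and cont: "continuous_on {0..r} k"
    and deriv: "\<And>\<tau>. 0 < \<tau> \<Longrightarrow> \<tau> < r \<Longrightarrow> (k has_real_derivative k' \<tau>) (at \<tau>)"
    and le: "\<And>\<tau>. 0 < \<tau> \<Longrightarrow> \<tau> < r \<Longrightarrow> rate i * exp (- rate i * \<tau>) * V \<tau> \<le> - k' \<tau>"
    and V: "\<And>\<tau>. 0 < \<tau> \<Longrightarrow> \<tau> < r \<Longrightarrow> 0 \<le> V \<tau>"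
    and f: "\<And>\<tau>. 0 \<le> \<tau> \<Longrightarrow> \<tau> \<le> r \<Longrightarrow> f \<tau> = ennreal (V \<tau>)" "\<And>\<tau>. \<tau> > r \<Longrightarrow> f \<tau> = 0"
    and kr: "0 \<le> k r"
  shows "ennreal (k r) + (\<integral>\<^sup>+\<tau>. ennreal (exponential_density (rate i) \<tau>) * f \<tau> \<partial>lborel) \<le> ennreal (k 0)"
proof -
  have nonpos: "k' \<tau> \<le> 0" if "0 < \<tau>" "\<tau> < r" for \<tau>
  proof -
    have "0 \<le> rate i * exp (- rate i * \<tau>) * V \<tau>"
      using V[OF that] by (intro mult_nonneg_nonneg) auto
    then show ?thesis using le[OF that] by linarith
  qed
  have FTC: "(\<integral>\<^sup>+\<tau>. ennreal (- k' \<tau>) * indicator {0<..<r} \<tau> \<partial>lborel) = ennreal (k 0 - k r)" "k r \<le> k 0"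
    using nn_integral_FTC_open[of 0 r k k'] r cont deriv nonpos by auto
  have "(\<integral>\<^sup>+\<tau>. ennreal (exponential_density (rate i) \<tau>) * f \<tau> \<partial>lborel) \<le> (\<integral>\<^sup>+\<tau>. ennreal (- k' \<tau>) * indicator {0<..<r} \<tau> \<partial>lborel)"
  proof (rule nn_integral_mono_AE)
    have "AE \<tau> in lborel. \<tau> \<noteq> 0 \<and> \<tau> \<noteq> r"
      using AE_lborel_singleton[of "0::real"] AE_lborel_singleton[of r] by eventually_elim auto
    then show "AE \<tau> in lborel. ennreal (exponential_density (rate i) \<tau>) * f \<tau>
        \<le> ennreal (- k' \<tau>) * indicator {0<..<r} \<tau>"
    proof eventually_elim
      case (elim \<tau>)
      consider "\<tau> < 0" | "r < \<tau>" | "0 < \<tau>" "\<tau> < r" using elim by linarith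
      then show ?case
      proof cases
        case 3
        then have "ennreal (exponential_density (rate i) \<tau>) * f \<tau>
          = ennreal (rate i * exp (- rate i * \<tau>) * V \<tau>)"
          using V[of \<tau>] by (simp add: f exponential_density_def ennreal_mult mult.commute)
        also have "\<dots> \<le> ennreal (- k' \<tau>)"
          using 3 le by (intro ennreal_leI) auto
        finally show ?thesis using 3 by simp
      qed (auto simp: f exponential_density_def)
    qed
  qed
  then have "ennreal (k r) + (\<integral>\<^sup>+\<tau>. ennreal (exponential_density (rate i) \<tau>) * f \<tau> \<partial>lborel) \<le> ennreal (k r) + ennreal (k 0 - k r)"
    unfolding FTC(1) by (rule add_left_mono)
  also have "\<dots> = ennreal (k 0)"
    using FTC(2) kr by (simp flip: ennreal_plus)
  finally show ?thesis .
qed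

lemma jump_op_le_FTC:
  fixes k V :: "real \<Rightarrow> real"
  assumes r: "0 \<le> r"
    and cont: "continuous_on {0..r} k"
    and deriv: "\<And>\<tau>. 0 < \<tau> \<Longrightarrow> \<tau> < r \<Longrightarrow> (k has_real_derivative k' \<tau>) (at \<tau>)"
    and le: "\<And>\<tau>. 0 < \<tau> \<Longrightarrow> \<tau> < r \<Longrightarrow> rate i * exp (- rate i * \<tau>) * V \<tau> \<le> - k' \<tau>"
    and V: "\<And>\<tau>. 0 < \<tau> \<Longrightarrow> \<tau> < r \<Longrightarrow> 0 \<le> V \<tau>"
    and h: "\<And>\<tau>. 0 \<le> \<tau> \<Longrightarrow> \<tau> \<le> r \<Longrightarrow> h (s + \<tau>, flow i \<tau> x, - i) = ennreal (V \<tau>)"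
      "\<And>\<tau>. \<tau> > r \<Longrightarrow> h (s + \<tau>, flow i \<tau> x, - i) = 0"
    and kr: "0 \<le> k r"
  shows "ennreal (k r) + jump_op h (s, x, i) \<le> ennreal (k 0)"
  unfolding jump_op_def prod.case
  by (rule exponential_integral_le_FTC[OF r cont deriv le V h kr])

text \<open>Non-explosion in quantitative form. What the partial sum misses is the probability that
  \<open>N\<close> jumps occur before \<open>t\<close>. By Markov's inequality for the exponential
  of minus the jump time, it is at most \<open>exp (t - s)\<close> times the product of the Laplace
  transforms \<open>rate i / (1 + rate i)\<close> of the holding times.\<close>

lemma one_le_partial_sum_plus_exp:
  fixes \<rho> :: real
  assumes rho: "\<And>i. rate i / (1 + rate i) \<le> \<rho>" and i: "i \<in> modes" and "s \<le> t"
  shows "1 \<le> (\<Sum>n<N. (jump_op ^^ n) (no_jump t (\<lambda>_. 1)) (s, x, i)) + ennreal (\<rho> ^ N * exp (t - s))"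
  using i \<open>s \<le> t\<close>
proof (induction N arbitrary: s x i)
  case 0
  then show ?case by simp
next
  case (Suc N)
  have rho0: "0 \<le> \<rho>" using rho[of 1] rate_pos[of 1]
    by (meson add_nonneg_nonneg divide_nonneg_nonneg le_less_trans less_imp_le not_le zero_le_one)
  let ?W = "\<lambda>w. \<Sum>n<N. (jump_op ^^ n) (no_jump t (\<lambda>_. 1)) w"
  let ?e = "\<lambda>(s, x, i). ennreal (if s \<le> t then \<rho> ^ N * exp (t - s) else 0)"
  let ?I = "\<lambda>(s, x, i). indicator {..t} s :: ennreal"
  have [measurable]: "?e \<in> borel_measurable space_time" unfolding case_prod_beta by measurable
  have e: "jump_op ?e (s, x, i) \<le> ennreal (\<rho> ^ Suc N * exp (t - s))"
  proof -
    \<comment> \<open>Minus a primitive of the integrand; its value at 0 carries the factor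
      \<open>rate i / (1 + rate i)\<close>, which becomes the additional power of
      \<open>\<rho>\<close>.\<close>
    let ?k = "\<lambda>\<tau>. rate i / (1 + rate i) * \<rho> ^ N * exp (t - s) * exp (- (1 + rate i) * \<tau>)"
    have 1: "1 + rate i \<noteq> 0" using rate_pos[of i] by linarith
    have exp_deriv: "((\<lambda>\<tau>. a / c * d * exp (- c * \<tau>)) has_real_derivative - (a * d * exp (- c * \<tau>))) (at \<tau>)"
      if "c \<noteq> 0" for a c d \<tau> :: real
      using that by (auto intro!: derivative_eq_intros)
    have "ennreal (?k (t - s)) + jump_op ?e (s, x, i) \<le> ennreal (?k 0)"
    proof (rule jump_op_le_FTC[where V = "\<lambda>\<tau>. \<rho> ^ N * exp (t - s - \<tau>)"
          and k' = "\<lambda>\<tau>. - (rate i * \<rho> ^ N * exp (t - s) * exp (- (1 + rate i) * \<tau>))"])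
      show "(?k has_real_derivative - (rate i * \<rho> ^ N * exp (t - s) * exp (- (1 + rate i) * \<tau>))) (at \<tau>)" for \<tau>
        using exp_deriv[OF 1, of "rate i" "\<rho> ^ N * exp (t - s)" \<tau>] by (simp add: mult.assoc)
      show "0 \<le> ?k (t - s)"
        using rho0 rate_pos[of i] by (intro mult_nonneg_nonneg divide_nonneg_nonneg) auto
      show "continuous_on {0..t - s} ?k" by (intro continuous_intros)
      show "rate i * exp (- rate i * \<tau>) * (\<rho> ^ N * exp (t - s - \<tau>))
          \<le> - (- (rate i * \<rho> ^ N * exp (t - s) * exp (- (1 + rate i) * \<tau>)))" for \<tau>
        by (simp add: algebra_simps flip: exp_add)
    qed (use Suc.prems rho0 in \<open>auto simp: diff_diff_eq\<close>)
    then have "jump_op ?e (s, x, i) \<le> ennreal (?k 0)"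
      by (rule order_trans[OF add_increasing[OF zero_le order_refl]])
    also have "\<dots> \<le> ennreal (\<rho> ^ Suc N * exp (t - s))"
      using mult_right_mono[OF rho[of i], of "\<rho> ^ N * exp (t - s)"] rho0
      by (intro ennreal_leI) (simp add: mult.assoc)
    finally show ?thesis .
  qed
  have I: "no_jump t (\<lambda>_. 1) (s, x, i) + jump_op ?I (s, x, i) = 1"
  proof -
    have "jump_op ?I (s, x, i) =
        (\<integral>\<^sup>+\<tau>. ennreal (exponential_density (rate i) \<tau>) * indicator {..t - s} \<tau> \<partial>lborel)"
      unfolding jump_op_def prod.case by (intro nn_integral_cong) (auto simp: indicator_def)
    also have "\<dots> = ennreal (1 - exp (- rate i * (t - s)))"
      using Suc.prems by (intro nn_integral_exponential_tail) auto
    finally show ?thesis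
      using Suc.prems by (simp add: no_jump_def mult_nonneg_nonneg flip: ennreal_plus)
  qed
  have "jump_op ?I (s, x, i) \<le> jump_op (\<lambda>w. ?W w + ?e w) (s, x, i)"
  proof (rule jump_op_mono)
    show "?I (s + \<tau>, x', - i) \<le> ?W (s + \<tau>, x', - i) + ?e (s + \<tau>, x', - i)" for \<tau> x'
      using Suc.IH[of "-i" "s + \<tau>" x'] Suc.prems by (auto simp: indicator_def)
  qed
  also have "\<dots> = jump_op ?W (s, x, i) + jump_op ?e (s, x, i)"
    by (rule jump_op_add) (use Suc.prems in auto)
  also have "\<dots> \<le> jump_op ?W (s, x, i) + ennreal (\<rho> ^ Suc N * exp (t - s))"
    using e by (rule add_left_mono)
  finally have "1 \<le> no_jump t (\<lambda>_. 1) (s, x, i) + (jump_op ?W (s, x, i) + ennreal (\<rho> ^ Suc N * exp (t - s)))"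
    by (rule ord_eq_le_trans[OF I[symmetric] add_left_mono])
  then show ?case
    using partial_sum_Suc[where h = "no_jump t (\<lambda>_. 1)" and i = i and N = N and s = s and x = x] Suc.prems by (simp add: add.assoc)
qed

text \<open>The error term vanishes as \<open>N\<close> grows because \<open>\<rho> < 1\<close>. The
  reverse inequality comes later from the probability space, where the intervals between jumps are
  disjoint.\<close>

lemma one_le_transition:
  assumes "0 \<le> t" "z \<in> space state_space"
  shows "1 \<le> transition t (\<lambda>_. 1) z"
proof -
  define \<rho> where "\<rho> = max (lm / (1 + lm)) (lp / (1 + lp))"
  have rho: "rate i / (1 + rate i) \<le> \<rho>" for i
    by (auto simp: \<rho>_def switch_rate_def)
  have "\<bar>\<rho>\<bar> < 1" using lm_pos lp_pos by (auto simp: \<rho>_def max_def abs_if field_simps)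
  then have "(\<lambda>N. \<rho> ^ N * exp t) \<longlonglongrightarrow> 0 * exp t"
    by (intro tendsto_intros LIMSEQ_power_zero) auto
  then have lim: "(\<lambda>N. transition t (\<lambda>_. 1) z + ennreal (\<rho> ^ N * exp t)) \<longlonglongrightarrow> transition t (\<lambda>_. 1) z + 0"
    by (intro tendsto_add tendsto_const) (auto intro: tendsto_ennrealI simp flip: ennreal_0)
  have "1 \<le> transition t (\<lambda>_. 1) z + ennreal (\<rho> ^ N * exp t)" for N
  proof -
    obtain x i where z: "z = (x, i)" "i \<in> modes" using assms(2) by (auto simp: space_state_space)
    have "1 \<le> (\<Sum>n<N. (jump_op ^^ n) (no_jump t (\<lambda>_. 1)) (0, x, i)) + ennreal (\<rho> ^ N * exp (t - 0))"
      by (rule one_le_partial_sum_plus_exp[OF rho z(2) assms(1)])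
    also have "\<dots> \<le> transition t (\<lambda>_. 1) z + ennreal (\<rho> ^ N * exp (t - 0))"
      unfolding z(1) by (intro add_right_mono partial_sum_le_transition)
    finally show ?thesis by simp
  qed
  then have "1 \<le> transition t (\<lambda>_. 1) z + 0"
    by (intro LIMSEQ_le_const[OF lim]) auto
  then show ?thesis by simp
qed

section \<open>The law of the process\<close>

lemma jump_pos_cong: "(\<And>k. k < n \<Longrightarrow> \<tau> k = \<tau>' k) \<Longrightarrow> jump_pos i x \<tau> n = jump_pos i x \<tau>' n"
  by (induction n) auto

lemma measurable_jump_pos:
  assumes "i \<in> modes" and "\<And>k. k < n \<Longrightarrow> (\<lambda>w. T w k) \<in> borel_measurable N"
  shows "(\<lambda>w. jump_pos i x (T w) n) \<in> borel_measurable N"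
  using assms(2)
proof (induction n)
  case (Suc n)
  then have [measurable]: "(\<lambda>w. T w n) \<in> borel_measurable N"
    "(\<lambda>w. jump_pos i x (T w) n) \<in> borel_measurable N" by auto
  show ?case using assms(1) by simp
qed simp

text \<open>The earlier holding times determine both the \<open>n\<close>-th jump time and the
  position there, and \<open>T n\<close> is independent of them; so the joint law is a product and
  \<open>T n\<close> can be integrated out first.\<close>

lemma nn_integral_jump:
  fixes T :: "nat \<Rightarrow> 'w \<Rightarrow> real"
  assumes "prob_space M" and ind: "prob_space.indep_vars M (\<lambda>_. borel) T UNIV"
    and dist: "distributed M lborel (T n) (exponential_density l)"
    and i: "i \<in> modes"
    and q[measurable]: "q \<in> borel_measurable (borel \<Otimes>\<^sub>M borel \<Otimes>\<^sub>M borel)"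
  shows "(\<integral>\<^sup>+\<omega>. q (T n \<omega>, \<Sum>k<n. T k \<omega>, jump_pos i x (\<lambda>k. T k \<omega>) n) \<partial>M) =
    (\<integral>\<^sup>+\<omega>. (\<integral>\<^sup>+\<tau>. ennreal (exponential_density l \<tau>) *
      q (\<tau>, \<Sum>k<n. T k \<omega>, jump_pos i x (\<lambda>k. T k \<omega>) n) \<partial>lborel) \<partial>M)"
proof -
  interpret prob_space M by fact
  have T[measurable]: "T k \<in> borel_measurable M" for k
    using ind by (auto simp: indep_vars_def)
  let ?A = "Pi\<^sub>M {..<n} (\<lambda>_. borel :: real measure)"
  let ?B = "Pi\<^sub>M {n} (\<lambda>_. borel :: real measure)"
  let ?X = "\<lambda>\<omega>. restrict (\<lambda>k. T k \<omega>) {..<n}" and ?Y = "\<lambda>\<omega>. restrict (\<lambda>k. T k \<omega>) {n}"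
  have "indep_var ?A ?X ?B ?Y"
    by (rule indep_var_restrict[OF ind]) auto
  then have X[measurable]: "?X \<in> measurable M ?A" and Y[measurable]: "?Y \<in> measurable M ?B"
    and eq: "distr M ?A ?X \<Otimes>\<^sub>M distr M ?B ?Y = distr M (?A \<Otimes>\<^sub>M ?B) (\<lambda>\<omega>. (?X \<omega>, ?Y \<omega>))"
    by (auto simp: indep_var_distribution_eq)
  interpret DY: prob_space "distr M ?B ?Y" by (rule prob_space_distr) fact
  have m1: "(\<lambda>a. jump_pos i x a n) \<in> borel_measurable ?A"
    by (rule measurable_jump_pos[OF i]) simp
  have m2: "(\<lambda>a. \<Sum>k<n. a k) \<in> borel_measurable ?A"
    by (rule borel_measurable_sum) simp
  let ?Q = "\<lambda>(a, b). q (b n, \<Sum>k<n. a k, jump_pos i x a n)"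
  note [measurable] = measurable_compose[OF measurable_fst m1] measurable_compose[OF measurable_fst m2]
  have Q[measurable]: "?Q \<in> borel_measurable (?A \<Otimes>\<^sub>M ?B)"
    unfolding case_prod_beta by measurable
  have jX: "jump_pos i x (?X \<omega>) n = jump_pos i x (\<lambda>k. T k \<omega>) n" for \<omega>
    by (rule jump_pos_cong) simp
  have sX: "(\<Sum>k<n. if k < n then T k \<omega> else undefined) = (\<Sum>k<n. T k \<omega>)" for \<omega>
    by (rule sum.cong) auto
  have "(\<integral>\<^sup>+\<omega>. q (T n \<omega>, \<Sum>k<n. T k \<omega>, jump_pos i x (\<lambda>k. T k \<omega>) n) \<partial>M) =
      (\<integral>\<^sup>+w. ?Q w \<partial>distr M (?A \<Otimes>\<^sub>M ?B) (\<lambda>\<omega>. (?X \<omega>, ?Y \<omega>)))"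
    by (subst nn_integral_distr) (auto simp: jX sX)
  also have "\<dots> = (\<integral>\<^sup>+a. \<integral>\<^sup>+b. ?Q (a, b) \<partial>distr M ?B ?Y \<partial>distr M ?A ?X)"
    unfolding eq[symmetric]
    by (subst DY.nn_integral_fst[symmetric])
      (simp_all add: measurable_distr_eq1 cong: measurable_cong_sets sets_pair_measure_cong)
  also have "\<dots> = (\<integral>\<^sup>+\<omega>. \<integral>\<^sup>+b. ?Q (?X \<omega>, b) \<partial>distr M ?B ?Y \<partial>M)"
    by (subst nn_integral_distr)
      (auto intro!: DY.borel_measurable_nn_integral simp: cong: measurable_cong_sets sets_pair_measure_cong)
  also have "\<dots> = (\<integral>\<^sup>+\<omega>. (\<integral>\<^sup>+\<tau>. ennreal (exponential_density l \<tau>) *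
      q (\<tau>, \<Sum>k<n. T k \<omega>, jump_pos i x (\<lambda>k. T k \<omega>) n) \<partial>lborel) \<partial>M)"
  proof (rule nn_integral_cong)
    fix \<omega> assume "\<omega> \<in> space M"
    then have a[measurable]: "?X \<omega> \<in> space ?A" by (auto simp: space_PiM)
    have "(\<integral>\<^sup>+b. ?Q (?X \<omega>, b) \<partial>distr M ?B ?Y) = (\<integral>\<^sup>+\<omega>'. ?Q (?X \<omega>, ?Y \<omega>') \<partial>M)"
      by (subst nn_integral_distr) auto
    also have "\<dots> = (\<integral>\<^sup>+\<omega>'. q (T n \<omega>', \<Sum>k<n. T k \<omega>, jump_pos i x (\<lambda>k. T k \<omega>) n) \<partial>M)"
      by (simp add: jX sX)
    also have "\<dots> = (\<integral>\<^sup>+\<tau>. q (\<tau>, \<Sum>k<n. T k \<omega>, jump_pos i x (\<lambda>k. T k \<omega>) n) \<partial>distr M lborel (T n))"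
      by (subst nn_integral_distr) auto
    also have "\<dots> = (\<integral>\<^sup>+\<tau>. ennreal (exponential_density l \<tau>) *
      q (\<tau>, \<Sum>k<n. T k \<omega>, jump_pos i x (\<lambda>k. T k \<omega>) n) \<partial>lborel)"
      using dist by (simp add: distributed_def nn_integral_density)
    finally show "(\<integral>\<^sup>+b. ?Q (?X \<omega>, b) \<partial>distr M ?B ?Y) = (\<integral>\<^sup>+\<tau>. ennreal (exponential_density l \<tau>) *
      q (\<tau>, \<Sum>k<n. T k \<omega>, jump_pos i x (\<lambda>k. T k \<omega>) n) \<partial>lborel)" .
  qed
  finally show ?thesis .
qed

lemma measurable_jump_integrand:
  assumes [measurable]: "h \<in> borel_measurable space_time" and [simp]: "j \<in> modes"
  shows "(\<lambda>(\<tau>, s, y). h (s + \<tau>, flow j \<tau> y, - j)) \<in> borel_measurable (borel \<Otimes>\<^sub>M borel \<Otimes>\<^sub>M borel)"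
  unfolding case_prod_beta by measurable

text \<open>The induction conditions on the last of the \<open>n\<close> jumps. The new operator
  therefore acts on \<open>h\<close> first, which is why \<open>h\<close> is generalised.\<close>

lemma nn_integral_at_jump:
  fixes T :: "nat \<Rightarrow> 'w \<Rightarrow> real"
  assumes M: "prob_space M" and ind: "prob_space.indep_vars M (\<lambda>_. borel) T UNIV"
    and dist: "\<And>n. distributed M lborel (T n) (exponential_density (rate (i * (-1) ^ n)))"
    and i: "i \<in> modes"
    and h: "h \<in> borel_measurable space_time"
  shows "(\<integral>\<^sup>+\<omega>. h (\<Sum>k<n. T k \<omega>, jump_pos i x (\<lambda>k. T k \<omega>) n, i * (-1) ^ n) \<partial>M) =
    (jump_op ^^ n) h (0, x, i)"
  using h
proof (induction n arbitrary: h)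
  case 0
  interpret prob_space M by fact
  show ?case by (simp add: emeasure_space_1)
next
  case (Suc n)
  note [measurable] = Suc.prems
  let ?j = "i * (-1) ^ n"
  have "(\<integral>\<^sup>+\<omega>. h (\<Sum>k<Suc n. T k \<omega>, jump_pos i x (\<lambda>k. T k \<omega>) (Suc n), i * (-1) ^ Suc n) \<partial>M) =
      (\<integral>\<^sup>+\<omega>. (\<lambda>(\<tau>, s, y). h (s + \<tau>, flow ?j \<tau> y, - ?j))
        (T n \<omega>, \<Sum>k<n. T k \<omega>, jump_pos i x (\<lambda>k. T k \<omega>) n) \<partial>M)"
    by simp
  also have "\<dots> = (\<integral>\<^sup>+\<omega>. jump_op h (\<Sum>k<n. T k \<omega>, jump_pos i x (\<lambda>k. T k \<omega>) n, ?j) \<partial>M)"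
    using i by (subst nn_integral_jump[OF M ind dist i measurable_jump_integrand])
      (simp_all add: jump_op_def Suc.prems)
  also have "\<dots> = (jump_op ^^ n) (jump_op h) (0, x, i)"
    by (rule Suc.IH) simp
  finally show ?case by (simp add: funpow_swap1)
qed

text \<open>The holding time \<open>T n\<close> enters only through the condition that it outlasts
  the remaining time. Integrating it out leaves the survival factor of \<open>no_jump\<close>, a
  function of the state at the \<open>n\<close>-th jump.\<close>

lemma nn_integral_between_jumps:
  fixes T :: "nat \<Rightarrow> 'w \<Rightarrow> real"
  assumes M: "prob_space M" and ind: "prob_space.indep_vars M (\<lambda>_. borel) T UNIV"
    and dist: "\<And>n. distributed M lborel (T n) (exponential_density (rate (i * (-1) ^ n)))"
    and i: "i \<in> modes"
    and g[measurable]: "g \<in> borel_measurable state_space"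
  shows "(\<integral>\<^sup>+\<omega>. indicator {\<omega>. (\<Sum>k<n. T k \<omega>) \<le> t \<and> t < (\<Sum>k<Suc n. T k \<omega>)} \<omega> *
      g (flow (i * (-1) ^ n) (t - (\<Sum>k<n. T k \<omega>)) (jump_pos i x (\<lambda>k. T k \<omega>) n), i * (-1) ^ n) \<partial>M) =
    (jump_op ^^ n) (no_jump t g) (0, x, i)"
proof -
  let ?j = "i * (-1) ^ n"
  define q where "q = (\<lambda>(\<tau>, s, y). if s \<le> t \<and> t < s + \<tau> then g (flow ?j (t - s) y, ?j) else 0)"
  have q: "q \<in> borel_measurable (borel \<Otimes>\<^sub>M borel \<Otimes>\<^sub>M borel)"
  proof -
    have [simp]: "i \<in> modes" by fact
    show ?thesis unfolding q_def case_prod_beta by measurable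
  qed
  have "(\<integral>\<^sup>+\<omega>. indicator {\<omega>. (\<Sum>k<n. T k \<omega>) \<le> t \<and> t < (\<Sum>k<Suc n. T k \<omega>)} \<omega> *
      g (flow ?j (t - (\<Sum>k<n. T k \<omega>)) (jump_pos i x (\<lambda>k. T k \<omega>) n), ?j) \<partial>M) =
      (\<integral>\<^sup>+\<omega>. q (T n \<omega>, \<Sum>k<n. T k \<omega>, jump_pos i x (\<lambda>k. T k \<omega>) n) \<partial>M)"
    by (intro nn_integral_cong) (auto simp: q_def indicator_def)
  also have "\<dots> = (\<integral>\<^sup>+\<omega>. no_jump t g (\<Sum>k<n. T k \<omega>, jump_pos i x (\<lambda>k. T k \<omega>) n, ?j) \<partial>M)"
  proof (subst nn_integral_jump[OF M ind dist i q], rule nn_integral_cong)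
    fix \<omega>
    let ?s = "\<Sum>k<n. T k \<omega>" and ?y = "jump_pos i x (\<lambda>k. T k \<omega>) n"
    have "(\<integral>\<^sup>+\<tau>. ennreal (exponential_density (rate ?j) \<tau>) * q (\<tau>, ?s, ?y) \<partial>lborel) =
        (\<integral>\<^sup>+\<tau>. (if ?s \<le> t then g (flow ?j (t - ?s) ?y, ?j) else 0) *
           (ennreal (exponential_density (rate ?j) \<tau>) * indicator {t - ?s<..} \<tau>) \<partial>lborel)"
      by (intro nn_integral_cong) (auto simp: q_def indicator_def mult.commute)
    also have "\<dots> = (if ?s \<le> t then g (flow ?j (t - ?s) ?y, ?j) else 0) *
        (\<integral>\<^sup>+\<tau>. ennreal (exponential_density (rate ?j) \<tau>) * indicator {t - ?s<..} \<tau> \<partial>lborel)"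
      by (rule nn_integral_cmult) measurable
    also have "\<dots> = no_jump t g (?s, ?y, ?j)"
    proof (cases "?s \<le> t")
      case True
      then have "(\<integral>\<^sup>+\<tau>. ennreal (exponential_density (rate ?j) \<tau>) * indicator {t - ?s<..} \<tau> \<partial>lborel) =
          ennreal (exp (- rate ?j * (t - ?s)))"
        by (intro nn_integral_exponential_tail) auto
      then show ?thesis using True unfolding no_jump_def prod.case by (simp only: if_True mult.commute)
    qed (simp add: no_jump_def)
    finally show "(\<integral>\<^sup>+\<tau>. ennreal (exponential_density (rate ?j) \<tau>) * q (\<tau>, ?s, ?y) \<partial>lborel) =
      no_jump t g (?s, ?y, ?j)" .
  qed
  also have "\<dots> = (jump_op ^^ n) (no_jump t g) (0, x, i)"
    by (rule nn_integral_at_jump[OF M ind dist i]) measurable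
  finally show ?thesis .
qed

text \<open>Splitting over the number of jumps before \<open>t\<close> gives the terms of the
  expansion. The defining clause for \<open>E t\<close> is silent where no interval between
  consecutive jumps contains \<open>t\<close>, so these intervals must also be shown to cover
  \<open>t\<close> almost surely.\<close>

theorem nn_integral_process:
  assumes z: "z \<in> space state_space"
    and pdmp: "pdmp_from (cubic_field pm pp) rate z M X E"
    and t: "0 \<le> t"
    and g[measurable]: "g \<in> borel_measurable state_space"
  shows "(\<integral>\<^sup>+\<omega>. g (X t \<omega>, E t \<omega>) \<partial>M) = transition t g z"
proof -
  obtain x i where zi: "z = (x, i)" and i: "i \<in> modes"
    using z by (auto simp: space_state_space)
  from pdmp have M: "prob_space M"
    and [measurable]: "X t \<in> borel_measurable M" "E t \<in> measurable M (count_space modes)"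
    and X0: "AE \<omega> in M. X 0 \<omega> = x"
    and sol: "AE \<omega> in M. \<forall>t\<ge>0. ((\<lambda>s. cubic_field pm pp (E s \<omega>) (X s \<omega>)) has_integral (X t \<omega> - X 0 \<omega>)) {0..t}"
    using t by (auto simp: pdmp_from_def switching_chain_def zi)
  interpret prob_space M by fact
  from pdmp obtain T :: "nat \<Rightarrow> 'a \<Rightarrow> real" where ind: "indep_vars (\<lambda>_. borel) T UNIV"
    and dist: "\<And>n. distributed M lborel (T n) (exponential_density (rate (i * (-1) ^ n)))"
    and E: "AE \<omega> in M. \<forall>n. \<forall>t\<ge>0.
           (\<Sum>k<n. T k \<omega>) \<le> t \<and> t < (\<Sum>k<Suc n. T k \<omega>) \<longrightarrow> E t \<omega> = i * (-1) ^ n"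
    by (auto simp: pdmp_from_def switching_chain_def zi)
  have T[measurable]: "T k \<in> borel_measurable M" for k
    using ind by (auto simp: indep_vars_def)
  have "AE \<omega> in M. 0 \<le> T k \<omega>" for k
  proof -
    have "AE \<tau> in density lborel (exponential_density (rate (i * (-1) ^ k))). 0 \<le> \<tau>"
      by (subst AE_density) (auto simp: exponential_density_def)
    moreover have "distr M lborel (T k) = density lborel (exponential_density (rate (i * (-1) ^ k)))"
      using dist[of k] by (simp add: distributed_def)
    ultimately have "AE \<tau> in distr M lborel (T k). 0 \<le> \<tau>"
      by (simp only:)
    then show ?thesis by (subst (asm) AE_distr_iff) auto
  qed
  then have T0: "AE \<omega> in M. \<forall>k. 0 \<le> T k \<omega>" by (simp add: AE_all_countable)
  define B where "B n = {\<omega>. (\<Sum>k<n. T k \<omega>) \<le> t \<and> t < (\<Sum>k<Suc n. T k \<omega>)}" for n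
  have [measurable]: "Measurable.pred M (\<lambda>\<omega>. \<omega> \<in> B n)" for n
    unfolding B_def mem_Collect_eq by measurable
  have [measurable]: "(\<lambda>\<omega>. indicator (B n) \<omega> :: ennreal) \<in> borel_measurable M" for n
  proof -
    have "(\<lambda>\<omega>. indicator (B n) \<omega> :: ennreal) = (\<lambda>\<omega>. if \<omega> \<in> B n then 1 else 0)"
      by (auto simp: indicator_def)
    then show ?thesis by simp
  qed
  have B: "(\<integral>\<^sup>+\<omega>. indicator (B n) \<omega> * f (X t \<omega>, E t \<omega>) \<partial>M) =
      (jump_op ^^ n) (no_jump t f) (0, x, i)"
    if [measurable]: "f \<in> borel_measurable state_space" for f n
  proof -
    have "AE \<omega> in M. indicator (B n) \<omega> * f (X t \<omega>, E t \<omega>) = indicator (B n) \<omega> *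
      f (flow (i * (-1) ^ n) (t - (\<Sum>k<n. T k \<omega>)) (jump_pos i x (\<lambda>k. T k \<omega>) n), i * (-1) ^ n)"
      using T0 X0 sol E
    proof eventually_elim
      case (elim \<omega>)
      show ?case
      proof (cases "\<omega> \<in> B n")
        case True
        then have b: "(\<Sum>k<n. T k \<omega>) \<le> t" "t < (\<Sum>k<Suc n. T k \<omega>)" by (auto simp: B_def)
        have "E t \<omega> = i * (-1) ^ n" by (rule elim(4)[rule_format, OF t conjI[OF b]])
        moreover have "X t \<omega> = flow (i * (-1) ^ n) (t - (\<Sum>k<n. T k \<omega>)) (jump_pos i (X 0 \<omega>) (\<lambda>k. T k \<omega>) n)"
        proof (rule solution_eq_flow_jump_pos[where e = "\<lambda>s. E s \<omega>"])
          fix m s assume s: "(\<Sum>k<m. T k \<omega>) \<le> s" "s < (\<Sum>k<Suc m. T k \<omega>)"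
          have "0 \<le> (\<Sum>k<m. T k \<omega>)" using elim(1) by (intro sum_nonneg) auto
          with s(1) have "0 \<le> s" by linarith
          then show "E s \<omega> = i * (-1) ^ m" by (rule elim(4)[rule_format, OF _ conjI[OF s]])
        next
          show "0 \<le> T k \<omega>" for k using elim(1) by blast
        qed (use elim(3) b in blast)+
        ultimately show ?thesis using elim(2) by simp
      qed (simp add: indicator_def)
    qed
    then have "(\<integral>\<^sup>+\<omega>. indicator (B n) \<omega> * f (X t \<omega>, E t \<omega>) \<partial>M) =
      (\<integral>\<^sup>+\<omega>. indicator (B n) \<omega> *
      f (flow (i * (-1) ^ n) (t - (\<Sum>k<n. T k \<omega>)) (jump_pos i x (\<lambda>k. T k \<omega>) n), i * (-1) ^ n) \<partial>M)"
      by (rule nn_integral_cong_AE)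
    also have "\<dots> = (jump_op ^^ n) (no_jump t f) (0, x, i)"
      unfolding B_def using nn_integral_between_jumps[OF M ind dist i that] by simp
    finally show ?thesis .
  qed
  have le1: "AE \<omega> in M. (\<Sum>n. indicator (B n) \<omega> :: ennreal) \<le> 1"
    using T0
  proof eventually_elim
    case (elim \<omega>)
    have "incseq (\<lambda>n. \<Sum>k<n. T k \<omega>)"
      using elim by (intro incseq_SucI) auto
    from suminf_indicator_intervals[OF this, of t] show ?case
      by (simp add: B_def indicator_def del: sum.lessThan_Suc split: if_splits)
  qed
  have "(\<integral>\<^sup>+\<omega>. (\<Sum>n. indicator (B n) \<omega>) \<partial>M) = transition t (\<lambda>_. 1) z"
    using B[of "\<lambda>_. 1"] by (subst nn_integral_suminf) (auto simp: transition_def zi)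
  then have ge: "1 \<le> (\<integral>\<^sup>+\<omega>. (\<Sum>n. indicator (B n) \<omega>) \<partial>M)"
    using one_le_transition[OF t z] by simp
  \<comment> \<open>A function that is at most 1 and has integral at least 1 on a probability space
    equals 1 almost surely.\<close>
  have eq1: "AE \<omega> in M. (\<Sum>n. indicator (B n) \<omega> :: ennreal) = 1"
  proof -
    let ?f = "\<lambda>\<omega>. \<Sum>n. indicator (B n) \<omega> :: ennreal"
    have "(\<integral>\<^sup>+\<omega>. 1 - ?f \<omega> \<partial>M) = (\<integral>\<^sup>+\<omega>. 1 \<partial>M) - (\<integral>\<^sup>+\<omega>. ?f \<omega> \<partial>M)"
    proof (rule nn_integral_diff)
      have "(\<integral>\<^sup>+\<omega>. ?f \<omega> \<partial>M) \<le> (\<integral>\<^sup>+\<omega>. 1 \<partial>M)" by (rule nn_integral_mono_AE[OF le1])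
      then show "(\<integral>\<^sup>+\<omega>. ?f \<omega> \<partial>M) \<noteq> \<infinity>"
        by (auto simp: emeasure_space_1 top_unique)
    qed (use le1 in auto)
    also have "\<dots> = 0" using ge by (simp add: emeasure_space_1 diff_eq_0_iff_ennreal less_top)
    finally have "AE \<omega> in M. 1 - ?f \<omega> = 0" by (subst (asm) nn_integral_0_iff_AE) auto
    with le1 show ?thesis
      by eventually_elim (auto dest: ennreal_minus_eq_0 intro: antisym)
  qed
  have "(\<integral>\<^sup>+\<omega>. g (X t \<omega>, E t \<omega>) \<partial>M) = (\<integral>\<^sup>+\<omega>. (\<Sum>n. indicator (B n) \<omega> * g (X t \<omega>, E t \<omega>)) \<partial>M)"
    using eq1 by (intro nn_integral_cong_AE) (auto simp: ennreal_suminf_multc)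
  also have "\<dots> = transition t g z"
    by (subst nn_integral_suminf) (auto simp: transition_def zi B)
  finally show ?thesis .
qed

end

section \<open>Invariant measures and ergodicity\<close>

text \<open>The interface between the process and the analysis: until the final theorem,
  \<open>P\<close> is known only through these properties, and the underlying probability spaces and
  paths do not appear.\<close>

locale cubic_semigroup = cubic_switching +
  fixes P :: "real \<Rightarrow> real \<times> int \<Rightarrow> (real \<times> int) measure"
  assumes prob_space_P: "0 \<le> t \<Longrightarrow> z \<in> space state_space \<Longrightarrow> prob_space (P t z)"
    and sets_P: "0 \<le> t \<Longrightarrow> z \<in> space state_space \<Longrightarrow> sets (P t z) = sets state_space"
    and nn_integral_P: "0 \<le> t \<Longrightarrow> z \<in> space state_space \<Longrightarrow> g \<in> borel_measurable state_space \<Longrightarrow>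
      (\<integral>\<^sup>+w. g w \<partial>P t z) = transition t g z"
begin

lemma emeasure_P:
  assumes "0 \<le> t" "z \<in> space state_space" "A \<in> sets state_space"
  shows "emeasure (P t z) A = transition t (indicator A) z"
  using nn_integral_P[OF assms(1,2), of "indicator A"] assms by (simp add: sets_P)

lemma invariant_prob_space: "invariant_prob P \<nu> \<Longrightarrow> prob_space \<nu>"
  and invariant_sets: "invariant_prob P \<nu> \<Longrightarrow> sets \<nu> = sets state_space"
  by (auto simp: invariant_prob_def)

lemma invariant_space: "invariant_prob P \<nu> \<Longrightarrow> space \<nu> = UNIV \<times> modes"
  using invariant_sets[THEN sets_eq_imp_space_eq] by (simp add: space_state_space)

lemma measurable_P [measurable]:
  assumes "0 \<le> t"
  shows "P t \<in> measurable state_space (subprob_algebra state_space)"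
proof (rule measurable_subprob_algebra)
  fix A assume A[measurable]: "A \<in> sets state_space"
  have "transition t (indicator A) \<in> borel_measurable state_space" by measurable
  then show "(\<lambda>z. emeasure (P t z) A) \<in> borel_measurable state_space"
    by (rule measurable_cong[THEN iffD1, rotated]) (simp add: emeasure_P assms A)
qed (use assms in \<open>auto simp: sets_P intro!: prob_space_imp_subprob_space prob_space_P\<close>)

lemma invariant_nn_integral:
  assumes inv: "invariant_prob P \<nu>" and t: "0 \<le> t" and g: "g \<in> borel_measurable state_space"
  shows "(\<integral>\<^sup>+z. transition t g z \<partial>\<nu>) = (\<integral>\<^sup>+z. g z \<partial>\<nu>)"
proof -
  interpret prob_space \<nu> by (rule invariant_prob_space[OF inv])
  have s: "sets \<nu> = sets state_space" "space \<nu> = space state_space"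
    using invariant_sets[OF inv] by (auto dest: sets_eq_imp_space_eq)
  have P: "P t \<in> measurable \<nu> (subprob_algebra state_space)"
    using measurable_P[OF t] by (simp cong: measurable_cong_sets add: s)
  have "\<nu> \<bind> P t = \<nu>"
  proof (rule measure_eqI)
    show "sets (\<nu> \<bind> P t) = sets \<nu>"
      using P not_empty by (simp add: sets_bind_measurable s)
    then show "emeasure (\<nu> \<bind> P t) A = emeasure \<nu> A" if "A \<in> sets (\<nu> \<bind> P t)" for A
      using that inv t by (subst emeasure_bind[OF not_empty P]) (auto simp: s invariant_prob_def)
  qed
  then have "(\<integral>\<^sup>+z. g z \<partial>\<nu>) = (\<integral>\<^sup>+z. g z \<partial>(\<nu> \<bind> P t))" by simp
  also have "\<dots> = (\<integral>\<^sup>+z. \<integral>\<^sup>+w. g w \<partial>P t z \<partial>\<nu>)"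
    by (rule nn_integral_bind[OF g P])
  also have "\<dots> = (\<integral>\<^sup>+z. transition t g z \<partial>\<nu>)"
    by (intro nn_integral_cong nn_integral_P t g) (simp add: s)
  finally show ?thesis ..
qed

text \<open>One inequality is enough. It says that the image of \<open>\<mu>\<close> under
  \<open>P t\<close> gives no set more mass than \<open>\<mu>\<close> does; for a set and its
  complement together, with both total masses equal to 1, this leaves only equality.\<close>

lemma invariant_probI:
  assumes "prob_space \<mu>" and s: "sets \<mu> = sets state_space"
    and le: "\<And>t g. 0 \<le> t \<Longrightarrow> g \<in> borel_measurable state_space \<Longrightarrow>
      (\<integral>\<^sup>+z. transition t g z \<partial>\<mu>) \<le> (\<integral>\<^sup>+z. g z \<partial>\<mu>)"
  shows "invariant_prob P \<mu>"
  unfolding invariant_prob_def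
proof (intro conjI allI impI ballI)
  interpret prob_space \<mu> by fact
  have sp: "space \<mu> = space state_space" using s by (rule sets_eq_imp_space_eq)
  fix t :: real and A assume t: "0 \<le> t" and A: "A \<in> sets state_space"
  have P: "P t \<in> measurable \<mu> (subprob_algebra state_space)"
    using measurable_P[OF t] by (simp cong: measurable_cong_sets add: s)
  have le: "(\<integral>\<^sup>+z. emeasure (P t z) B \<partial>\<mu>) \<le> emeasure \<mu> B" if B: "B \<in> sets state_space" for B
  proof -
    have "(\<integral>\<^sup>+z. emeasure (P t z) B \<partial>\<mu>) = (\<integral>\<^sup>+z. transition t (indicator B) z \<partial>\<mu>)"
      by (intro nn_integral_cong emeasure_P t B) (simp add: sp)
    also have "\<dots> \<le> (\<integral>\<^sup>+z. indicator B z \<partial>\<mu>)"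
      using B by (intro le t) auto
    also have "\<dots> = emeasure \<mu> B" using B s by simp
    finally show ?thesis .
  qed
  let ?B = "space state_space - A"
  interpret B: prob_space "\<mu> \<bind> P t"
    by (rule prob_space_bind[OF _ P]) (use prob_space_P[OF t] in \<open>auto simp: sp\<close>)
  have spB: "space (\<mu> \<bind> P t) = space state_space" and sB: "sets (\<mu> \<bind> P t) = sets state_space"
    using P not_empty by (auto simp: space_bind_measurable sets_bind_measurable)
  have "emeasure (\<mu> \<bind> P t) A \<le> emeasure \<mu> A" "emeasure (\<mu> \<bind> P t) ?B \<le> emeasure \<mu> ?B"
    using le A by (auto simp: emeasure_bind[OF not_empty P])
  then have "measure (\<mu> \<bind> P t) A \<le> measure \<mu> A" "measure (\<mu> \<bind> P t) ?B \<le> measure \<mu> ?B"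
    by (auto simp: B.emeasure_eq_measure emeasure_eq_measure)
  moreover have "measure (\<mu> \<bind> P t) ?B = 1 - measure (\<mu> \<bind> P t) A" "measure \<mu> ?B = 1 - measure \<mu> A"
    using B.prob_compl[of A] prob_compl[of A] A by (auto simp: sB spB s sp)
  ultimately have "emeasure (\<mu> \<bind> P t) A = emeasure \<mu> A"
    by (simp add: B.emeasure_eq_measure emeasure_eq_measure)
  then show "(\<integral>\<^sup>+z. emeasure (P t z) A \<partial>\<mu>) = emeasure \<mu> A"
    by (simp add: emeasure_bind[OF not_empty P A])
qed (use assms in auto)

text \<open>Easy half of Echeverria's criterion: invariance forces the integral of \<open>L F\<close> to be
  nonnegative (and hence zero, applying this to \<open>- F\<close>), where \<open>L\<close> is the generator. The
  supersolution \<open>F + (t - s) L F + C (t - s)\<^sup>2\<close> replaces the semigroup's Taylor expansion.\<close>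

lemma invariant_generator_nonneg:
  fixes F DF DH H :: "real \<times> int \<Rightarrow> real"
  assumes inv: "invariant_prob P \<nu>"
    and [measurable]: "F \<in> borel_measurable state_space" "H \<in> borel_measurable state_space"
    and F: "\<And>x i. i \<in> modes \<Longrightarrow> \<bar>F (x, i)\<bar> \<le> C"
    and H: "\<And>x i. i \<in> modes \<Longrightarrow> \<bar>H (x, i)\<bar> \<le> C"
    and DH: "\<And>x i. i \<in> modes \<Longrightarrow> \<bar>DH (x, i)\<bar> \<le> C"
    and derF: "\<And>x i \<tau>. i \<in> modes \<Longrightarrow> 0 \<le> \<tau> \<Longrightarrow>
      ((\<lambda>\<tau>. F (flow i \<tau> x, i)) has_real_derivative DF (flow i \<tau> x, i)) (at \<tau>)"
    and derH: "\<And>x i \<tau>. i \<in> modes \<Longrightarrow> 0 \<le> \<tau> \<Longrightarrow>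
      ((\<lambda>\<tau>. H (flow i \<tau> x, i)) has_real_derivative DH (flow i \<tau> x, i)) (at \<tau>)"
    and gen: "\<And>x i. i \<in> modes \<Longrightarrow> H (x, i) = DF (x, i) + rate i * (F (x, - i) - F (x, i))"
  shows "0 \<le> (\<integral>z. H z \<partial>\<nu>)"
proof -
  interpret prob_space \<nu> by (rule invariant_prob_space[OF inv])
  have s: "sets \<nu> = sets state_space" "space \<nu> = UNIV \<times> modes"
    using invariant_sets[OF inv] invariant_space[OF inv] by auto
  have m[measurable]: "F \<in> borel_measurable \<nu>" "H \<in> borel_measurable \<nu>"
    by (simp_all cong: measurable_cong_sets add: s)
  have one: "1 \<in> modes" by (simp add: modes_def)
  have C0: "0 \<le> C" using F[OF one, of 0] by linarith
  \<comment> \<open>\<open>2 * D\<close> has to dominate the generator applied to \<open>H\<close>,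
    whose derivative part is at most \<open>C\<close> and whose jump part is at most
    \<open>2 * rate i * C\<close>.\<close>
  define D where "D = C * (lm + lp + 1)"
  have D0: "0 \<le> D" using C0 lm_pos lp_pos by (simp add: D_def)
  have DC: "2 * rate i * C + C \<le> 2 * D" for i
    using C0 lm_pos lp_pos by (simp add: D_def switch_rate_def algebra_simps)
  have intF: "integrable \<nu> F" and intH: "integrable \<nu> H"
    using F H by (auto intro!: integrable_const_bound[where B = C] simp: s)
  have main: "0 \<le> (\<integral>z. H z \<partial>\<nu>) + D * t" if t: "0 < t" "t \<le> 1" for t
  proof -
    \<comment> \<open>The shift by \<open>2 * C\<close> makes \<open>v\<close> nonnegative for
      \<open>r\<close> up to 1, as a supersolution with values in \<open>ennreal\<close> must be; it
      cancels when the integrals of \<open>v 0\<close> and \<open>v t\<close> are compared.\<close>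
    define v where "v = (\<lambda>r z. F z + 2 * C + r * H z + D * r\<^sup>2)"
    define V where "V = (\<lambda>(s, z). ennreal (if s \<le> t then v (t - s) z else 0))"
    have v0: "0 \<le> v r (x, i)" if "i \<in> modes" "0 \<le> r" "r \<le> 1" for r x i
    proof -
      have "\<bar>r * H (x, i)\<bar> \<le> 1 * C"
        unfolding abs_mult using that H[of i x] by (intro mult_mono) auto
      moreover have "0 \<le> D * r\<^sup>2" using D0 by simp
      ultimately show ?thesis using F[of i x] that(1) unfolding v_def by (simp add: abs_le_iff)
    qed
    have le: "transition t (\<lambda>z. ennreal (v 0 z)) z \<le> V (0, z)" if z: "z \<in> space state_space" for z
    proof (rule transition_le_supersolution[OF _ _ z])
      show "(\<lambda>z. ennreal (v 0 z)) \<in> borel_measurable state_space"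
        unfolding v_def by measurable
      fix s x :: real and i assume s: "0 \<le> s" and i: "i \<in> modes"
      show "no_jump t (\<lambda>z. ennreal (v 0 z)) (s, x, i) + jump_op V (s, x, i) \<le> V (s, x, i)"
      proof (cases "s \<le> t")
        case False
        then have "jump_op V (s, x, i) \<le> jump_op (\<lambda>_. 0) (s, x, i)"
          by (intro jump_op_mono) (auto simp: V_def)
        then show ?thesis using False by (simp add: no_jump_def jump_op_def)
      next
        case True
        define r where "r = t - s"
        have r: "0 \<le> r" "r \<le> 1" using True s t by (auto simp: r_def)
        define k where "k = (\<lambda>\<tau>. exp (- rate i * \<tau>) * v (r - \<tau>) (flow i \<tau> x, i))"
        define k' where "k' = (\<lambda>\<tau>. - rate i * exp (- rate i * \<tau>) * v (r - \<tau>) (flow i \<tau> x, i) +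
          exp (- rate i * \<tau>) * (DF (flow i \<tau> x, i) - H (flow i \<tau> x, i) + (r - \<tau>) * DH (flow i \<tau> x, i)
            - 2 * D * (r - \<tau>)))"
        have dk: "(k has_real_derivative k' \<tau>) (at \<tau>)" if "0 \<le> \<tau>" for \<tau>
          unfolding k_def k'_def v_def
          by (rule derivative_eq_intros derF[OF i that] derH[OF i that] refl)+
            (simp add: algebra_simps power2_eq_square)
        have "ennreal (k r) + jump_op V (s, x, i) \<le> ennreal (k 0)"
        proof (rule jump_op_le_FTC[where V = "\<lambda>\<tau>. v (r - \<tau>) (flow i \<tau> x, - i)" and k' = k'])
          show "continuous_on {0..r} k"
            by (intro DERIV_continuous_on[where D = k'] DERIV_subset[OF dk]) auto
          show "0 \<le> k r" unfolding k_def using v0[OF i] r by auto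
          show "0 \<le> v (r - \<tau>) (flow i \<tau> x, - i)" if "0 < \<tau>" "\<tau> < r" for \<tau>
            using i r that by (intro v0) auto
          show "rate i * exp (- rate i * \<tau>) * v (r - \<tau>) (flow i \<tau> x, - i) \<le> - k' \<tau>"
            if "0 < \<tau>" "\<tau> < r" for \<tau>
          proof -
            let ?y = "flow i \<tau> x"
            have "rate i * (H (?y, - i) - H (?y, i)) + DH (?y, i) \<le> rate i * (2 * C) + C"
            proof (intro add_mono mult_left_mono)
              show "H (?y, - i) - H (?y, i) \<le> 2 * C"
                using H[of "- i" ?y] H[of i ?y] i by simp
              show "DH (?y, i) \<le> C" using DH[of i ?y] i by simp
            qed simp
            also have "\<dots> \<le> 2 * D" using DC[of i] by simp
            finally have "(r - \<tau>) * (rate i * (H (?y, - i) - H (?y, i)) + DH (?y, i)) \<le> (r - \<tau>) * (2 * D)"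
              using that by (intro mult_left_mono) auto
            moreover have g: "DF (?y, i) = H (?y, i) - rate i * (F (?y, - i) - F (?y, i))"
              using gen[OF i, of ?y] by simp
            ultimately have "rate i * v (r - \<tau>) (?y, - i) \<le> rate i * v (r - \<tau>) (?y, i) -
                (DF (?y, i) - H (?y, i) + (r - \<tau>) * DH (?y, i) - 2 * D * (r - \<tau>))"
              unfolding g v_def by (simp add: algebra_simps)
            then have "exp (- rate i * \<tau>) * (rate i * v (r - \<tau>) (?y, - i)) \<le> exp (- rate i * \<tau>) * (rate i * v (r - \<tau>) (?y, i) -
                (DF (?y, i) - H (?y, i) + (r - \<tau>) * DH (?y, i) - 2 * D * (r - \<tau>)))"
              by (intro mult_left_mono) auto
            then show ?thesis by (simp add: k'_def algebra_simps)
          qed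
        qed (use r i dk in \<open>auto simp: V_def r_def diff_diff_eq\<close>)
        then show ?thesis
          using True v0[OF i, of 0] r
          by (simp add: no_jump_def V_def k_def r_def ennreal_mult)
      qed
    qed
    have bd: "AE z in \<nu>. \<bar>v r z\<bar> \<le> C + 2 * C + \<bar>r\<bar> * C + D * r\<^sup>2" for r
    proof (rule AE_I2)
      fix z assume "z \<in> space \<nu>"
      then obtain x i where z: "z = (x, i)" "i \<in> modes" by (auto simp: s)
      have "\<bar>r * H z\<bar> \<le> \<bar>r\<bar> * C" unfolding abs_mult z using H[OF z(2)] by (intro mult_left_mono) auto
      moreover have "\<bar>F z\<bar> \<le> C" unfolding z by (rule F[OF z(2)])
      moreover have "0 \<le> D * r\<^sup>2" using D0 by simp
      ultimately show "\<bar>v r z\<bar> \<le> C + 2 * C + \<bar>r\<bar> * C + D * r\<^sup>2"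
        using C0 unfolding v_def by linarith
    qed
    have int: "integrable \<nu> (v r)" for r
      unfolding v_def using intF intH by (intro Bochner_Integration.integrable_add integrable_mult_right) auto
    have "(\<integral>\<^sup>+z. ennreal (v 0 z) \<partial>\<nu>) = (\<integral>\<^sup>+z. transition t (\<lambda>z. ennreal (v 0 z)) z \<partial>\<nu>)"
      using t by (intro invariant_nn_integral[OF inv, symmetric]) (auto simp: v_def)
    also have "\<dots> \<le> (\<integral>\<^sup>+z. ennreal (v t z) \<partial>\<nu>)"
      using le t by (intro nn_integral_mono) (auto simp: s space_state_space V_def)
    finally have "ennreal (\<integral>z. v 0 z \<partial>\<nu>) \<le> ennreal (\<integral>z. v t z \<partial>\<nu>)"
      using v0 t by (subst (asm) (1 2) nn_integral_eq_integral) (auto simp: int s intro!: AE_I2)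
    then have "(\<integral>z. v 0 z \<partial>\<nu>) \<le> (\<integral>z. v t z \<partial>\<nu>)"
      using v0 t by (subst (asm) ennreal_le_iff) (auto simp: s intro!: integral_nonneg_AE AE_I2)
    also have "(\<integral>z. v t z \<partial>\<nu>) = (\<integral>z. v 0 z + (t * H z + D * t\<^sup>2) \<partial>\<nu>)"
      by (simp add: v_def algebra_simps)
    also have "\<dots> = (\<integral>z. v 0 z \<partial>\<nu>) + (t * (\<integral>z. H z \<partial>\<nu>) + D * t\<^sup>2)"
      using intH int[of 0] by (simp add: prob_space)
    finally have "0 \<le> t * ((\<integral>z. H z \<partial>\<nu>) + D * t)"
      by (simp add: algebra_simps power2_eq_square)
    then show ?thesis using t by (simp add: zero_le_mult_iff)
  qed
  show ?thesis
  proof (rule field_le_epsilon)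
    fix e :: real assume e: "0 < e"
    define t where "t = min 1 (e / (D + 1))"
    have t: "0 < t" "t \<le> 1" using e D0 by (auto simp: t_def)
    have "D * t \<le> (D + 1) * (e / (D + 1))"
      using D0 t e by (intro mult_mono) (auto simp: t_def)
    then have "D * t \<le> e" using D0 by simp
    then show "0 \<le> (\<integral>z. H z \<partial>\<nu>) + e" using main[OF t] by linarith
  qed
qed

section \<open>Invariant regions, conditioning and ergodicity\<close>

definition region :: "real \<Rightarrow> (real \<times> int) set" where
  "region \<sigma> = {z. sgn (fst z) = \<sigma> \<and> snd z \<in> modes}"

lemma region_eq: "region \<sigma> = {z \<in> space state_space. sgn (fst z) = \<sigma>}"
  by (auto simp: region_def space_state_space)

lemma region_simps:
  "region 1 = {0<..} \<times> modes" "region (- 1) = {..<0} \<times> modes" "region 0 = {0} \<times> modes"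
  by (auto simp: region_def sgn_real_def split: if_splits)

lemma sets_region [measurable]: "region \<sigma> \<in> sets state_space"
  unfolding region_eq by measurable

text \<open>The flow preserves the sign and a jump leaves the position alone, so the indicator of
  the complement is constant along paths. Cut off at time \<open>t\<close>, it is a supersolution
  that vanishes on the region.\<close>

lemma transition_outside_region:
  assumes z: "z \<in> region \<sigma>"
  shows "transition t (indicator (space state_space - region \<sigma>)) z = 0"
proof -
  define c :: "real \<Rightarrow> real" where "c x = (if sgn x = \<sigma> then 0 else 1)" for x
  define V where "V = (\<lambda>(s, x, i :: int). ennreal (if s \<le> t then c x else 0))"
  have "transition t (indicator (space state_space - region \<sigma>)) z \<le> V (0, z)"
  proof (rule transition_le_supersolution)
    fix s x :: real and i assume i: "i \<in> modes"
    show "no_jump t (indicator (space state_space - region \<sigma>)) (s, x, i) + jump_op V (s, x, i) \<le> V (s, x, i)"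
    proof (cases "s \<le> t")
      case False
      then have "jump_op V (s, x, i) \<le> jump_op (\<lambda>_. 0) (s, x, i)"
        by (intro jump_op_mono) (auto simp: V_def)
      then show ?thesis using False by (simp add: no_jump_def jump_op_def)
    next
      case True
      have c: "c (flow i \<tau> x) = c x" if "0 \<le> \<tau>" for \<tau>
        by (simp add: c_def sgn_flow that)
      have "ennreal (exp (- rate i * (t - s)) * c x) + jump_op V (s, x, i) \<le> ennreal (exp (- rate i * 0) * c x)"
        by (rule jump_op_le_FTC[where V = "\<lambda>_. c x" and k' = "\<lambda>\<tau>. - rate i * exp (- rate i * \<tau>) * c x"
            and k = "\<lambda>\<tau>. exp (- rate i * \<tau>) * c x"])
          (use True i in \<open>auto simp: V_def c intro!: continuous_intros derivative_eq_intros, auto simp: c_def\<close>)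
      moreover have "indicator (space state_space - region \<sigma>) (flow i (t - s) x, i) = ennreal (c x)"
        using True i by (auto simp: c_def region_def sgn_flow space_state_space indicator_def)
      ultimately show ?thesis
        using True by (simp add: V_def no_jump_def ennreal_mult c_def)
    qed
  qed (use z in \<open>auto simp: region_eq\<close>)
  then show ?thesis using z by (auto simp: V_def c_def region_def split: prod.splits if_splits)
qed

lemma emeasure_P_region:
  assumes t: "0 \<le> t" and z: "z \<in> region \<sigma>"
  shows "emeasure (P t z) (region \<sigma>) = 1"
proof -
  have zs: "z \<in> space state_space" using z by (auto simp: region_eq)
  interpret prob_space "P t z" by (rule prob_space_P[OF t zs])
  have s: "sets (P t z) = sets state_space" "space (P t z) = space state_space"
    using sets_P[OF t zs] by (auto dest: sets_eq_imp_space_eq)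
  have "emeasure (P t z) (space state_space - region \<sigma>) = 0"
    using transition_outside_region[OF z] by (subst emeasure_P[OF t zs]) auto
  then show ?thesis
    using prob_compl[of "region \<sigma>"] by (simp add: s emeasure_eq_measure)
qed

text \<open>Each of the three regions is invariant and so has measure 0 or 1; since they cover the
  state space, not all of them can be null.\<close>

lemma ergodic_region:
  assumes "ergodic_prob P \<nu>"
  obtains \<sigma> where "\<sigma> \<in> {- 1, 0, 1}" "emeasure \<nu> (region \<sigma>) = 1"
proof -
  from assms have inv: "invariant_prob P \<nu>" by (simp add: ergodic_prob_def)
  interpret prob_space \<nu> by (rule invariant_prob_space[OF inv])
  have s: "sets \<nu> = sets state_space" "space \<nu> = UNIV \<times> modes"
    using invariant_sets[OF inv] invariant_space[OF inv] by auto
  have or: "emeasure \<nu> (region \<sigma>) \<in> {0, 1}" for \<sigma>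
    using assms emeasure_P_region by (auto simp: ergodic_prob_def)
  have "space \<nu> = (\<Union>\<sigma>\<in>{- 1, 0, 1}. region \<sigma>)"
    by (auto simp: s region_def sgn_real_def)
  then have "1 \<le> (\<Sum>\<sigma>\<in>{- 1, 0, 1}. emeasure \<nu> (region \<sigma>))"
    using emeasure_subadditive_finite[of "{- 1, 0, 1}" region \<nu>] emeasure_space_1 s by auto
  then have "\<exists>\<sigma>\<in>{- 1, 0, 1}. emeasure \<nu> (region \<sigma>) \<noteq> 0"
    by (metis not_one_le_zero sum.neutral)
  then show ?thesis using or that by blast
qed

text \<open>If no mass leaves \<open>A\<close>, then by stationarity none enters: the mass starting
  in \<open>A\<close> already accounts for all of \<open>emeasure \<nu> A\<close>, so
  \<open>A\<close> is not reached from almost any point outside. The part of \<open>\<nu>\<close> on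
  \<open>A\<close> is thus preserved by itself.\<close>

lemma invariant_uniform_measure:
  assumes inv: "invariant_prob P \<nu>" and A: "A \<in> sets state_space"
    and closed: "\<And>t. 0 \<le> t \<Longrightarrow> AE z in \<nu>. z \<in> A \<longrightarrow> emeasure (P t z) A = 1"
    and pos: "emeasure \<nu> A \<noteq> 0"
  shows "invariant_prob P (uniform_measure \<nu> A)"
  unfolding invariant_prob_def
proof (intro conjI allI impI ballI)
  interpret prob_space \<nu> by (rule invariant_prob_space[OF inv])
  have s: "sets \<nu> = sets state_space" "space \<nu> = space state_space"
    using invariant_sets[OF inv] by (auto dest: sets_eq_imp_space_eq)
  show "prob_space (uniform_measure \<nu> A)"
    using pos by (intro prob_space_uniform_measure) auto
  show "sets (uniform_measure \<nu> A) = sets state_space" by (simp add: s)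
  fix t :: real and B assume t: "0 \<le> t" and B: "B \<in> sets state_space"
  have m[measurable]: "(\<lambda>z. emeasure (P t z) D) \<in> borel_measurable \<nu>" if "D \<in> sets state_space" for D
  proof -
    have "P t \<in> measurable \<nu> (subprob_algebra state_space)"
      using measurable_P[OF t] by (simp cong: measurable_cong_sets add: s)
    then show ?thesis using that by (rule measurable_emeasure_kernel)
  qed
  have [measurable]: "A \<in> sets \<nu>" "B \<in> sets \<nu>" using A B by (simp_all add: s)
  have AB: "A \<inter> B \<in> sets state_space" using A B by auto
  let ?P = "\<lambda>D z. emeasure (P t z) D"
  have invD: "(\<integral>\<^sup>+z. ?P D z \<partial>\<nu>) = emeasure \<nu> D" if "D \<in> sets state_space" for D
    using inv t that by (auto simp: invariant_prob_def)
  have split: "(\<integral>\<^sup>+z. ?P D z \<partial>\<nu>) = (\<integral>\<^sup>+z. ?P D z * indicator A z \<partial>\<nu>) + (\<integral>\<^sup>+z. ?P D z * indicator (space \<nu> - A) z \<partial>\<nu>)"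
    if "D \<in> sets state_space" for D
    using that by (subst nn_integral_add[symmetric])
      (auto intro!: nn_integral_cong simp: indicator_def)
  have inA: "(\<integral>\<^sup>+z. ?P A z * indicator A z \<partial>\<nu>) = emeasure \<nu> A"
  proof -
    have "(\<integral>\<^sup>+z. ?P A z * indicator A z \<partial>\<nu>) = (\<integral>\<^sup>+z. indicator A z \<partial>\<nu>)"
      using closed[OF t] by (intro nn_integral_cong_AE) (auto simp: indicator_def)
    then show ?thesis by simp
  qed
  have "emeasure \<nu> A = emeasure \<nu> A + (\<integral>\<^sup>+z. ?P A z * indicator (space \<nu> - A) z \<partial>\<nu>)"
    using split[OF A] unfolding invD[OF A] inA .
  then have "emeasure \<nu> A + 0 = emeasure \<nu> A + (\<integral>\<^sup>+z. ?P A z * indicator (space \<nu> - A) z \<partial>\<nu>)" by simp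
  then have "(\<integral>\<^sup>+z. ?P A z * indicator (space \<nu> - A) z \<partial>\<nu>) = 0"
    unfolding ennreal_add_left_cancel by auto
  moreover have "(\<integral>\<^sup>+z. ?P (A \<inter> B) z * indicator (space \<nu> - A) z \<partial>\<nu>)
      \<le> (\<integral>\<^sup>+z. ?P A z * indicator (space \<nu> - A) z \<partial>\<nu>)"
    using sets_P[OF t] A by (intro nn_integral_mono mult_right_mono emeasure_mono) (auto simp: s)
  ultimately have out: "(\<integral>\<^sup>+z. ?P (A \<inter> B) z * indicator (space \<nu> - A) z \<partial>\<nu>) = 0" by simp
  have "(\<integral>\<^sup>+z. ?P B z * indicator A z \<partial>\<nu>) = (\<integral>\<^sup>+z. ?P (A \<inter> B) z * indicator A z \<partial>\<nu>)"
  proof (rule nn_integral_cong_AE)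
    show "AE z in \<nu>. ?P B z * indicator A z = ?P (A \<inter> B) z * indicator A z"
      using closed[OF t] AE_space
    proof eventually_elim
      case (elim z)
      show ?case
      proof (cases "z \<in> A")
        case True
        have zs: "z \<in> space state_space" using elim s by simp
        interpret Q: prob_space "P t z" by (rule prob_space_P[OF t zs])
        have sP: "sets (P t z) = sets state_space" by (rule sets_P[OF t zs])
        have "AE w in P t z. w \<in> A"
          using True elim A sP by (intro Q.AE_prob_1) (simp add: Q.emeasure_eq_measure)
        then have "?P B z = ?P (A \<inter> B) z"
          using A B AB sP by (intro emeasure_eq_AE) auto
        then show ?thesis by simp
      qed simp
    qed
  qed
  also have "\<dots> = emeasure \<nu> (A \<inter> B)"
    using split[OF AB] unfolding out invD[OF AB] by simp
  finally have "(\<integral>\<^sup>+z. ?P B z * indicator A z \<partial>\<nu>) = emeasure \<nu> (A \<inter> B)" .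
  then show "(\<integral>\<^sup>+z. ?P B z \<partial>uniform_measure \<nu> A) = emeasure (uniform_measure \<nu> A) B"
    using B by (simp add: nn_integral_uniform_measure m emeasure_uniform_measure)
qed

lemma ergodic_of_unique_on_region:
  assumes inv: "invariant_prob P \<nu>" and R: "R \<in> sets state_space" "emeasure \<nu> R = 1"
    and uniq: "\<And>\<nu>'. invariant_prob P \<nu>' \<Longrightarrow> emeasure \<nu>' R = 1 \<Longrightarrow> \<nu>' = \<nu>"
  shows "ergodic_prob P \<nu>"
  unfolding ergodic_prob_def
proof (intro conjI ballI impI inv)
  interpret prob_space \<nu> by (rule invariant_prob_space[OF inv])
  have div: "emeasure \<nu> B / emeasure \<nu> B = 1" if "emeasure \<nu> B \<noteq> 0" for B
    using that by (intro ennreal_divide_self) (auto simp: less_top[symmetric])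
  have s: "sets \<nu> = sets state_space" by (rule invariant_sets[OF inv])
  fix A assume A: "A \<in> sets state_space"
    and closed: "\<forall>t\<ge>0. AE z in \<nu>. z \<in> A \<longrightarrow> emeasure (P t z) A = 1"
  show "emeasure \<nu> A \<in> {0, 1}"
  proof (cases "emeasure \<nu> A = 0")
    case False
    have AE: "AE z in \<nu>. z \<in> R" using R s by (intro AE_prob_1) (simp add: emeasure_eq_measure)
    have inv': "invariant_prob P (uniform_measure \<nu> A)"
      using closed by (intro invariant_uniform_measure[OF inv A _ False]) auto
    have "emeasure \<nu> (A \<inter> R) = emeasure \<nu> A"
      using AE A R s by (intro emeasure_eq_AE) auto
    then have "emeasure (uniform_measure \<nu> A) R = 1"
      using A R s False by (simp add: emeasure_uniform_measure div)
    from uniq[OF inv' this] have "emeasure \<nu> A = emeasure (uniform_measure \<nu> A) A" by simp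
    also have "\<dots> = 1" using A s False by (simp add: emeasure_uniform_measure div)
    finally show ?thesis by simp
  qed simp
qed

section \<open>Mode marginal and invariant measures at the origin\<close>

text \<open>A test function of the mode alone is constant along the flows. Used with
  \<open>a = 1\<close> and \<open>a = - 1\<close>, the generator inequality becomes equality of the
  two switching rates in equilibrium, and the total mass fixes the weights.\<close>

lemma invariant_mode_weights:
  assumes inv: "invariant_prob P \<nu>"
  shows "emeasure \<nu> (UNIV \<times> {1}) = ennreal (lm / (lp + lm))"
    and "emeasure \<nu> (UNIV \<times> {- 1}) = ennreal (lp / (lp + lm))"
proof -
  interpret prob_space \<nu> by (rule invariant_prob_space[OF inv])
  have s: "sets \<nu> = sets state_space" "space \<nu> = UNIV \<times> modes"
    using invariant_sets[OF inv] invariant_space[OF inv] by auto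
  have U[measurable]: "UNIV \<times> {i} \<in> sets state_space" if "i \<in> modes" for i
    using that unfolding state_space_def by (intro pair_measureI) auto
  let ?F = "\<lambda>a (x :: real, i :: int). if i = 1 then a else (0 :: real)"
  let ?H = "\<lambda>a (x :: real, i :: int). if i = 1 then - lp * a else lm * a"
  have nonneg: "0 \<le> (\<integral>z. ?H a z \<partial>\<nu>)" if a: "\<bar>a\<bar> = 1" for a
  proof (rule invariant_generator_nonneg[OF inv, where F = "?F a" and DF = "\<lambda>_. 0" and DH = "\<lambda>_. 0" and C = "1 + lm + lp"])
    show "?F a \<in> borel_measurable state_space" "?H a \<in> borel_measurable state_space"
      unfolding case_prod_beta by measurable
  qed (use lm_pos lp_pos a in \<open>auto simp: modes_def abs_mult switch_rate_def\<close>)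
  have H: "(\<integral>z. ?H a z \<partial>\<nu>) = a * (lm * measure \<nu> (UNIV \<times> {- 1}) - lp * measure \<nu> (UNIV \<times> {1}))" for a
  proof -
    have "(\<integral>z. ?H a z \<partial>\<nu>) = (\<integral>z. (a * lm) * indicator (UNIV \<times> {- 1}) z + (- (a * lp)) * indicator (UNIV \<times> {1}) z \<partial>\<nu>)"
      by (rule Bochner_Integration.integral_cong) (auto simp: s modes_def indicator_def)
    also have "\<dots> = (a * lm) * measure \<nu> (UNIV \<times> {- 1}) + (- (a * lp)) * measure \<nu> (UNIV \<times> {1})"
      using U[of 1] U[of "- 1"] by (subst Bochner_Integration.integral_add) (auto simp: s modes_def less_top[symmetric] Times_Int_Times)
    finally show ?thesis by (simp add: algebra_simps)
  qed
  have eq: "lm * measure \<nu> (UNIV \<times> {- 1}) = lp * measure \<nu> (UNIV \<times> {1})"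
    using nonneg[of 1] nonneg[of "- 1"] unfolding H by simp
  have "space \<nu> = UNIV \<times> {- 1} \<union> UNIV \<times> {1}" by (auto simp: s modes_def)
  then have "1 = measure \<nu> (UNIV \<times> {- 1} \<union> UNIV \<times> {1})" using prob_space by simp
  also have "\<dots> = measure \<nu> (UNIV \<times> {- 1}) + measure \<nu> (UNIV \<times> {1})"
    using U[of 1] U[of "- 1"] by (intro finite_measure_Union) (auto simp: s modes_def)
  finally have one: "measure \<nu> (UNIV \<times> {- 1}) = 1 - measure \<nu> (UNIV \<times> {1})" by simp
  have "measure \<nu> (UNIV \<times> {1}) * (lp + lm) = lm" using eq unfolding one by (simp add: algebra_simps)
  then have m1: "measure \<nu> (UNIV \<times> {1}) = lm / (lp + lm)" using lp_pos lm_pos by (simp add: eq_divide_eq)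
  then have "measure \<nu> (UNIV \<times> {- 1}) = lp / (lp + lm)" unfolding one using lp_pos lm_pos by (simp add: field_simps)
  with m1 show "emeasure \<nu> (UNIV \<times> {1}) = ennreal (lm / (lp + lm))"
    "emeasure \<nu> (UNIV \<times> {- 1}) = ennreal (lp / (lp + lm))"
    by (simp_all add: emeasure_eq_measure)
qed

lemma sets_delta_measure: "sets (delta_measure lm lp) = sets state_space"
  unfolding delta_measure_def state_space_def
  by (rule sets_pair_measure_cong) (simp_all add: sets_point_measure)

lemma nn_integral_delta_measure:
  assumes g: "g \<in> borel_measurable state_space"
  shows "(\<integral>\<^sup>+z. g z \<partial>delta_measure lm lp) =
    ennreal (lp / (lp + lm)) * g (0, - 1) + ennreal (lm / (lp + lm)) * g (0, 1)"
proof -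
  let ?f = "\<lambda>i. ennreal (if i = -1 then lp / (lp + lm) else lm / (lp + lm))"
  have fin: "finite_measure (point_measure modes ?f)"
    by (rule finite_measureI) (auto simp: modes_def space_point_measure emeasure_point_measure_finite)
  interpret finite_measure "point_measure modes ?f" by (rule fin)
  have g': "g \<in> borel_measurable (return borel 0 \<Otimes>\<^sub>M point_measure modes ?f)"
    using g sets_delta_measure unfolding delta_measure_def by (simp cong: measurable_cong_sets)
  have "(\<integral>\<^sup>+z. g z \<partial>delta_measure lm lp) = (\<integral>\<^sup>+x. \<integral>\<^sup>+i. g (x, i) \<partial>point_measure modes ?f \<partial>return borel 0)"
    unfolding delta_measure_def by (rule nn_integral_fst[OF g', symmetric])
  also have "\<dots> = (\<integral>\<^sup>+i. g (0, i) \<partial>point_measure modes ?f)"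
    using borel_measurable_nn_integral_fst[OF g'] by (subst nn_integral_return) auto
  also have "\<dots> = (\<Sum>i\<in>modes. ?f i * g (0, i))"
    by (subst nn_integral_point_measure_finite) (auto simp: modes_def mult.commute)
  finally show ?thesis by (simp add: modes_def)
qed

lemma invariant_at_zero_eq_delta:
  assumes inv: "invariant_prob P \<nu>" and zero: "AE z in \<nu>. fst z = 0"
  shows "\<nu> = delta_measure lm lp"
proof (rule measure_eqI)
  have s: "sets \<nu> = sets state_space" "space \<nu> = UNIV \<times> modes"
    using invariant_sets[OF inv] invariant_space[OF inv] by auto
  show "sets \<nu> = sets (delta_measure lm lp)" by (simp add: s sets_delta_measure)
  have U: "UNIV \<times> {i} \<in> sets \<nu>" if "i \<in> modes" for i
    using that unfolding s state_space_def by (intro pair_measureI) auto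
  fix A assume A: "A \<in> sets \<nu>"
  have "emeasure \<nu> A = (\<integral>\<^sup>+z. indicator A z \<partial>\<nu>)" using A by simp
  also have "\<dots> = (\<integral>\<^sup>+z. indicator A (0, - 1) * indicator (UNIV \<times> {- 1}) z +
      indicator A (0, 1) * indicator (UNIV \<times> {1}) z \<partial>\<nu>)"
    using zero AE_space
    by (intro nn_integral_cong_AE, eventually_elim) (auto simp: s modes_def indicator_def)
  also have "\<dots> = indicator A (0, - 1) * emeasure \<nu> (UNIV \<times> {- 1}) + indicator A (0, 1) * emeasure \<nu> (UNIV \<times> {1})"
    using U[of 1] U[of "- 1"] by (subst nn_integral_add) (auto simp: modes_def nn_integral_cmult)
  also have "\<dots> = (\<integral>\<^sup>+z. indicator A z \<partial>delta_measure lm lp)"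
    using A by (subst nn_integral_delta_measure) (auto simp: invariant_mode_weights[OF inv] s mult.commute)
  also have "\<dots> = emeasure (delta_measure lm lp) A" using A by (simp add: s sets_delta_measure)
  finally show "emeasure \<nu> A = emeasure (delta_measure lm lp) A" .
qed

end

section \<open>Nonpositive mean growth\<close>

context cubic_switching
begin

text \<open>Away from the origin \<open>1 / R x\<close> is \<open>1 / x\<^sup>2 + K\<close>, a shift
  of the coordinate in which the flow is affine. So \<open>R\<close> solves a logistic equation, and
  unlike the square it is bounded.\<close>

lemma saturated_square_flow_deriv:
  fixes K :: real
  assumes K: "0 < K" and s: "0 \<le> s"
  defines "R \<equiv> \<lambda>x. x\<^sup>2 / (1 + K * x\<^sup>2)"
  shows "((\<lambda>s. R (flow i s x)) has_real_derivative
    2 * growth i * R (flow i s x) - 2 * (1 + growth i * K) * (R (flow i s x))\<^sup>2) (at s)"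
proof -
  define y where "y = flow i s x"
  have pos: "0 < 1 + K * y\<^sup>2" using K by (simp add: add_pos_nonneg)
  have "((\<lambda>x. R x) has_real_derivative
      (2 * y * (1 + K * y\<^sup>2) - y\<^sup>2 * (K * (2 * y))) / ((1 + K * y\<^sup>2) * (1 + K * y\<^sup>2))) (at y)"
    unfolding R_def using pos by (auto intro!: derivative_eq_intros)
  from DERIV_chain2[OF this[unfolded y_def] flow_deriv[OF s, of i x]]
  have "((\<lambda>s. R (flow i s x)) has_real_derivative
      (2 * y * (1 + K * y\<^sup>2) - y\<^sup>2 * (K * (2 * y))) / ((1 + K * y\<^sup>2) * (1 + K * y\<^sup>2)) *
        (growth i * y - y ^ 3)) (at s)"
    by (simp add: y_def)
  also have "(2 * y * (1 + K * y\<^sup>2) - y\<^sup>2 * (K * (2 * y))) / ((1 + K * y\<^sup>2) * (1 + K * y\<^sup>2)) *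
        (growth i * y - y ^ 3) = 2 * growth i * R y - 2 * (1 + growth i * K) * (R y)\<^sup>2"
  proof -
    define D where "D = 1 + K * y\<^sup>2"
    have D: "D \<noteq> 0" using pos by (simp add: D_def)
    have "2 * growth i * R y - 2 * (1 + growth i * K) * (R y)\<^sup>2 =
        (2 * growth i * y\<^sup>2 * D - 2 * (1 + growth i * K) * y ^ 4) / (D * D)"
      using D unfolding R_def D_def[symmetric] by (simp add: field_simps power2_eq_square power4_eq_xxxx)
    also have "\<dots> = (2 * y * D - y\<^sup>2 * (K * (2 * y))) * (growth i * y - y ^ 3) / (D * D)"
      unfolding D_def by (rule arg_cong2[where f = "(/)"]) (simp_all add: algebra_simps power2_eq_square power3_eq_cube power4_eq_xxxx)
    finally show ?thesis unfolding D_def by simp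
  qed
  finally show ?thesis unfolding y_def .
qed

end

context cubic_semigroup
begin

text \<open>Both \<open>\<alpha>\<close> and \<open>\<beta>\<close> carry a factor
  \<open>\<theta>\<close>. The weights \<open>c\<close> remove the first-order part of the growth
  term \<open>\<alpha>\<close> in mode \<open>-1\<close> and make it nonpositive in mode
  \<open>1\<close>, the latter being \<open>case2\<close>. What remains of \<open>\<alpha>\<close>
  is at most of order \<open>\<theta>\<close> squared, against a damping \<open>\<beta>\<close>
  below \<open>- \<theta>\<close>; division by \<open>\<theta>\<close> gives the bound.\<close>

lemma invariant_saturated_square_bound:
  fixes \<theta> :: real
  assumes case2: "pp * lm \<le> - pm * lp" and inv: "invariant_prob P \<nu>" and th: "0 < \<theta>" "\<theta> \<le> 1"
  defines "K \<equiv> - 1 / (2 * pm)"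
  defines "R \<equiv> \<lambda>x. x\<^sup>2 / (1 + K * x\<^sup>2)"
  shows "(\<integral>z. min 1 (R (fst z)) * R (fst z) \<partial>\<nu>) \<le> \<theta> * (2 * pp * (- 2 * pm / lm) * max 1 (1 / K))"
proof -
  interpret prob_space \<nu> by (rule invariant_prob_space[OF inv])
  have s: "sets \<nu> = sets state_space" "space \<nu> = UNIV \<times> modes"
    using invariant_sets[OF inv] invariant_space[OF inv] by auto
  have K: "0 < K" using pm_neg by (simp add: K_def)
  \<comment> \<open>\<open>K\<close> is chosen for this: the damping coefficient
    \<open>1 + growth i * K\<close> is smaller in mode \<open>-1\<close>, and even there it is
    1/2.\<close>
  have mK: "1 + pm * K = 1 / 2" using pm_neg by (simp add: K_def)
  have pK: "1 / 2 \<le> 1 + pp * K" using K pp_pos by (simp add: add_increasing2)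
  \<comment> \<open>The solution of \<open>2 * pm + lm * \<gamma> = 0\<close>, which makes
    \<open>\<alpha>\<close> vanish in mode \<open>-1\<close>.\<close>
  define \<gamma> where "\<gamma> = - 2 * pm / lm"
  have chi: "0 \<le> \<gamma>" using pm_neg lm_pos by (simp add: \<gamma>_def divide_nonpos_pos)
  define c where "c i = (if i = 1 then 1 + \<theta> * \<gamma> else 1)" for i :: int
  define \<alpha> where "\<alpha> i = 2 * \<theta> * growth i * c i + rate i * (c (- i) - c i)" for i
  define \<beta> where "\<beta> i = - (2 * \<theta> * (1 + growth i * K) * c i)" for i
  define F where "F = (\<lambda>(x, i). c i * R x powr \<theta>)"
  define DF where "DF = (\<lambda>(x, i). c i * (\<theta> * R x powr \<theta> * (2 * growth i - 2 * (1 + growth i * K) * R x)))"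
  define H where "H = (\<lambda>(x, i). R x powr \<theta> * (\<alpha> i + \<beta> i * R x))"
  define DH where "DH = (\<lambda>(x, i). R x powr \<theta> *
    (\<theta> * (2 * growth i - 2 * (1 + growth i * K) * R x) * (\<alpha> i + \<beta> i * R x) +
      \<beta> i * (2 * growth i * R x - 2 * (1 + growth i * K) * (R x)\<^sup>2)))"
  have R0: "0 \<le> R x" for x using K by (simp add: R_def)
  have R1: "R x \<le> 1 / K" for x
  proof -
    have "0 < 1 + K * x\<^sup>2" using K by (simp add: add_pos_nonneg)
    then show ?thesis using K by (simp add: R_def field_simps)
  qed
  have Rpos: "R x = 0 \<longleftrightarrow> x = 0" for x
  proof -
    have "0 < 1 + K * x\<^sup>2" using K by (simp add: add_pos_nonneg)
    then show ?thesis by (simp add: R_def)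
  qed
  have dR: "((\<lambda>s. R (flow i s x)) has_real_derivative
      2 * growth i * R (flow i s x) - 2 * (1 + growth i * K) * (R (flow i s x))\<^sup>2) (at s)" if "0 \<le> s" for i s x
    unfolding R_def by (rule saturated_square_flow_deriv[OF K that])
  have dpow: "((\<lambda>s. R (flow i s x) powr \<theta>) has_real_derivative
      \<theta> * R (flow i s x) powr \<theta> * (2 * growth i - 2 * (1 + growth i * K) * R (flow i s x))) (at s)"
    if "0 \<le> s" for i s x
  proof (cases "x = 0")
    case True
    then show ?thesis by (simp add: R_def)
  next
    case False
    let ?r = "R (flow i s x)"
    have pos: "0 < ?r" using R0[of "flow i s x"] Rpos[of "flow i s x"] flow_eq_0_iff[OF that, of i x] False
      by linarith
    have "((\<lambda>s. R (flow i s x) powr \<theta>) has_real_derivative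
        \<theta> * ?r powr (\<theta> - 1) * (2 * growth i * ?r - 2 * (1 + growth i * K) * ?r\<^sup>2)) (at s)"
      by (rule DERIV_fun_powr[OF dR[OF that] pos, unfolded of_nat_1, THEN DERIV_cong]) simp
    moreover have "\<theta> * ?r powr (\<theta> - 1) * (2 * growth i * ?r - 2 * (1 + growth i * K) * ?r\<^sup>2) =
        \<theta> * ?r powr \<theta> * (2 * growth i - 2 * (1 + growth i * K) * ?r)"
      using pos by (simp add: powr_diff field_simps power2_eq_square)
    ultimately show ?thesis by (simp only:)
  qed
  have [measurable]: "R \<in> borel_measurable borel" unfolding R_def by measurable
  have [measurable]: "c \<in> borel_measurable (count_space modes)" "\<alpha> \<in> borel_measurable (count_space modes)"
    "\<beta> \<in> borel_measurable (count_space modes)" by simp_all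
  have Rm[measurable]: "(\<lambda>z. R (fst z)) \<in> borel_measurable \<nu>"
    by (simp cong: measurable_cong_sets add: s)
  \<comment> \<open>All functions handed to the generator inequality have this form, and
    \<open>R\<close> takes values in a compact interval on which the power is continuous up to 0
    because \<open>\<theta>\<close> is positive.\<close>
  have bdd: "\<exists>C. \<forall>x. \<forall>i\<in>modes. \<bar>R x powr \<theta> * g i (R x)\<bar> \<le> C"
    if "\<And>i. continuous_on {0..1 / K} (g i)" for g :: "int \<Rightarrow> real \<Rightarrow> real"
  proof -
    have "\<exists>B. \<forall>r\<in>{0..1 / K}. norm (r powr \<theta> * g i r) \<le> B" for i
    proof -
      have "continuous_on {0..1 / K} (\<lambda>r. r powr \<theta> * g i r)"
        using th by (intro continuous_intros that continuous_on_powr') auto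
      from compact_continuous_image[OF this] have "bounded ((\<lambda>r. r powr \<theta> * g i r) ` {0..1 / K})"
        by (simp add: compact_imp_bounded)
      then show ?thesis by (auto simp: bounded_iff)
    qed
    then obtain B where B: "\<And>i r. r \<in> {0..1 / K} \<Longrightarrow> norm (r powr \<theta> * g i r) \<le> B i" by metis
    have "\<bar>R x powr \<theta> * g i (R x)\<bar> \<le> max (B 1) (B (- 1))" if "i \<in> modes" for x i
      using B[of "R x" i] R0[of x] R1[of x] that by (auto simp: modes_def)
    then show ?thesis by blast
  qed
  obtain C1 where C1: "\<And>x i. i \<in> modes \<Longrightarrow> \<bar>F (x, i)\<bar> \<le> C1"
    using bdd[of "\<lambda>i r. c i"] by (auto simp: F_def mult.commute)
  have "continuous_on {0..1 / K} (\<lambda>r. \<alpha> i + \<beta> i * r)" for i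
    by (intro continuous_intros)
  from bdd[of "\<lambda>i r. \<alpha> i + \<beta> i * r", OF this] obtain C2 where C2: "\<And>x i. i \<in> modes \<Longrightarrow> \<bar>H (x, i)\<bar> \<le> C2"
    by (auto simp: H_def)
  have "continuous_on {0..1 / K} (\<lambda>r. \<theta> * (2 * growth i - 2 * (1 + growth i * K) * r) * (\<alpha> i + \<beta> i * r) +
      \<beta> i * (2 * growth i * r - 2 * (1 + growth i * K) * r\<^sup>2))" for i
    by (intro continuous_intros)
  from bdd[of "\<lambda>i r. \<theta> * (2 * growth i - 2 * (1 + growth i * K) * r) * (\<alpha> i + \<beta> i * r) +
      \<beta> i * (2 * growth i * r - 2 * (1 + growth i * K) * r\<^sup>2)", OF this] obtain C3 where C3: "\<And>x i. i \<in> modes \<Longrightarrow> \<bar>DH (x, i)\<bar> \<le> C3"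
    by (auto simp: DH_def)
  define C where "C = max C1 (max C2 C3)"
  have H_nonneg: "0 \<le> (\<integral>z. H z \<partial>\<nu>)"
  proof (rule invariant_generator_nonneg[OF inv, where F = F and DF = DF and DH = DH and C = C])
    show "F \<in> borel_measurable state_space" unfolding F_def case_prod_beta by measurable
    show "H \<in> borel_measurable state_space" unfolding H_def case_prod_beta by measurable
    show "\<bar>F (x, i)\<bar> \<le> C" if "i \<in> modes" for x i using C1[OF that, of x] by (simp add: C_def)
    show "\<bar>H (x, i)\<bar> \<le> C" if "i \<in> modes" for x i using C2[OF that, of x] by (simp add: C_def)
    show "\<bar>DH (x, i)\<bar> \<le> C" if "i \<in> modes" for x i using C3[OF that, of x] by (simp add: C_def)
    fix x :: real and i \<tau> assume i: "i \<in> modes" and tau: "0 \<le> (\<tau> :: real)"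
    show "((\<lambda>\<tau>. F (flow i \<tau> x, i)) has_real_derivative DF (flow i \<tau> x, i)) (at \<tau>)"
      unfolding F_def DF_def prod.case by (intro DERIV_cmult dpow tau)
    show "((\<lambda>\<tau>. H (flow i \<tau> x, i)) has_real_derivative DH (flow i \<tau> x, i)) (at \<tau>)"
      unfolding H_def DH_def prod.case
      by (rule derivative_eq_intros dpow[OF tau] dR[OF tau] refl)+ (simp add: algebra_simps)
  next
    fix x :: real and i assume "i \<in> modes"
    show "H (x, i) = DF (x, i) + rate i * (F (x, - i) - F (x, i))"
      unfolding H_def DF_def F_def prod.case \<alpha>_def \<beta>_def by (simp add: algebra_simps)
  qed
  have alpha: "\<alpha> i \<le> \<theta> * (\<theta> * (2 * pp * \<gamma>))" if "i \<in> modes" for i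
  proof -
    consider (minus) "i = - 1" | (plus) "i = 1" using \<open>i \<in> modes\<close> by (auto simp: modes_def)
    then show ?thesis
  proof cases
    case minus
    have "\<alpha> i = \<theta> * (2 * pm + lm * \<gamma>)"
      by (simp add: \<alpha>_def c_def growth_def switch_rate_def algebra_simps minus)
    then have "\<alpha> i = 0" using lm_pos by (simp add: \<gamma>_def)
    then show ?thesis using th pp_pos chi by simp
  next
    case plus
    have "2 * pp - lp * \<gamma> \<le> 0"
      using case2 lm_pos by (simp add: \<gamma>_def field_simps)
    then have "\<theta> * (2 * pp - lp * \<gamma>) \<le> 0" using th by (simp add: mult_nonneg_nonpos)
    moreover have "\<alpha> i = \<theta> * (2 * pp - lp * \<gamma>) + \<theta> * (\<theta> * (2 * pp * \<gamma>))"
      by (simp add: \<alpha>_def c_def growth_def switch_rate_def algebra_simps plus)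
    ultimately show ?thesis by simp
  qed
  qed
  have beta: "\<beta> i \<le> - \<theta>" if "i \<in> modes" for i
  proof -
    have 1: "1 \<le> 2 * (1 + growth i * K)" using mK pK by (simp add: growth_def)
    have 2: "1 \<le> c i" using th chi by (simp add: c_def)
    have "1 * 1 \<le> (2 * (1 + growth i * K)) * c i"
      by (intro mult_mono 1 2) (use 1 2 in linarith)+
    then have "\<theta> * 1 \<le> \<theta> * ((2 * (1 + growth i * K)) * c i)"
      using th by (intro mult_left_mono) auto
    then show ?thesis by (simp add: \<beta>_def algebra_simps)
  qed
  define B where "B = 2 * pp * \<gamma> * max 1 (1 / K)"
  \<comment> \<open>For every \<open>\<theta>\<close> in the unit interval the power lies between
    \<open>min 1 (R x)\<close> and \<open>max 1 (1 / K)\<close>. These bounds take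
    \<open>\<theta>\<close> out of the integrand before it tends to zero.\<close>
  have H_le: "H (x, i) \<le> \<theta> * (\<theta> * B) - \<theta> * (min 1 (R x) * R x)" if i: "i \<in> modes" for x i
  proof -
    let ?r = "R x"
    have up: "?r powr \<theta> \<le> max 1 (1 / K)"
    proof (cases "?r \<le> 1")
      case True
      then show ?thesis using R0[of x] th powr_le1[of \<theta> ?r] by auto
    next
      case False
      then have "?r powr \<theta> \<le> ?r powr 1" using th by (intro powr_mono) auto
      then show ?thesis using False R1[of x] by auto
    qed
    have lo: "min 1 ?r \<le> ?r powr \<theta>"
    proof (cases "?r \<le> 1")
      case True
      then have "?r powr 1 \<le> ?r powr \<theta>" using th R0[of x] by (intro powr_mono') auto
      then show ?thesis using True R0[of x] by auto
    next
      case False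
      then show ?thesis using th by (simp add: ge_one_powr_ge_zero)
    qed
    have "H (x, i) \<le> ?r powr \<theta> * (\<theta> * (\<theta> * (2 * pp * \<gamma>)) + (- \<theta>) * ?r)"
      unfolding H_def prod.case using alpha[OF i] beta[OF i] R0[of x]
      by (intro mult_left_mono add_mono mult_right_mono) auto
    also have "\<dots> = (\<theta> * \<theta> * (2 * pp * \<gamma>)) * ?r powr \<theta> - \<theta> * (?r powr \<theta> * ?r)"
      by (simp add: algebra_simps)
    also have "\<dots> \<le> (\<theta> * \<theta> * (2 * pp * \<gamma>)) * max 1 (1 / K) - \<theta> * (min 1 ?r * ?r)"
      using up lo R0[of x] th pp_pos chi
      by (intro diff_mono mult_left_mono mult_right_mono) auto
    finally show ?thesis by (simp add: B_def algebra_simps)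
  qed
  have int_min: "integrable \<nu> (\<lambda>z. min 1 (R (fst z)) * R (fst z))"
  proof (rule integrable_const_bound[where B = "1 / K"])
    show "AE z in \<nu>. norm (min 1 (R (fst z)) * R (fst z)) \<le> 1 / K"
    proof (rule AE_I2)
      fix z
      have "min 1 (R (fst z)) * R (fst z) \<le> 1 * R (fst z)" by (intro mult_right_mono) (auto simp: R0)
      then show "norm (min 1 (R (fst z)) * R (fst z)) \<le> 1 / K"
        using R0[of "fst z"] R1[of "fst z"] by (simp add: abs_mult)
    qed
  qed measurable
  have "(\<integral>z. H z \<partial>\<nu>) \<le> (\<integral>z. \<theta> * (\<theta> * B) - \<theta> * (min 1 (R (fst z)) * R (fst z)) \<partial>\<nu>)"
  proof (rule integral_mono_AE)
    have "H \<in> borel_measurable state_space" unfolding H_def case_prod_beta by measurable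
    then show "integrable \<nu> H"
      using C2 by (intro integrable_const_bound[where B = C2]) (auto simp: s cong: measurable_cong_sets)
    show "AE z in \<nu>. H z \<le> \<theta> * (\<theta> * B) - \<theta> * (min 1 (R (fst z)) * R (fst z))"
      using H_le by (intro AE_I2) (auto simp: s)
  qed (use int_min in auto)
  also have "\<dots> = \<theta> * (\<theta> * B - (\<integral>z. min 1 (R (fst z)) * R (fst z) \<partial>\<nu>))"
    using int_min by (simp add: prob_space algebra_simps)
  finally have "0 \<le> \<theta> * (\<theta> * B - (\<integral>z. min 1 (R (fst z)) * R (fst z) \<partial>\<nu>))"
    using H_nonneg by linarith
  then show ?thesis using th by (simp add: zero_le_mult_iff B_def \<gamma>_def)
qed

text \<open>The integral bounded above does not depend on \<open>\<theta>\<close>, so it is zero,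
  and its nonnegative integrand vanishes only at the origin.\<close>

lemma invariant_eq_delta:
  assumes case2: "pp * lm \<le> - pm * lp" and inv: "invariant_prob P \<nu>"
  shows "\<nu> = delta_measure lm lp"
proof (rule invariant_at_zero_eq_delta[OF inv])
  interpret prob_space \<nu> by (rule invariant_prob_space[OF inv])
  have s: "sets \<nu> = sets state_space" by (rule invariant_sets[OF inv])
  define K where "K = - 1 / (2 * pm)"
  define R where "R = (\<lambda>x :: real. x\<^sup>2 / (1 + K * x\<^sup>2))"
  have K: "0 < K" using pm_neg by (simp add: K_def)
  have den: "0 < 1 + K * x\<^sup>2" for x using K by (simp add: add_pos_nonneg)
  have R0: "0 \<le> R x" for x using K by (simp add: R_def)
  have R1: "R x \<le> 1 / K" for x
    using den[of x] K by (simp add: R_def field_simps)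
  have Rpos: "R x = 0 \<longleftrightarrow> x = 0" for x
    using den[of x] by (simp add: R_def)
  let ?f = "\<lambda>z :: real \<times> int. min 1 (R (fst z)) * R (fst z)"
  define B where "B = 2 * pp * (- 2 * pm / lm) * max 1 (1 / K)"
  have [measurable]: "?f \<in> borel_measurable \<nu>"
    unfolding R_def by (simp cong: measurable_cong_sets add: s)
  have f0: "0 \<le> ?f z" for z using R0[of "fst z"] by simp
  have le: "(\<integral>z. ?f z \<partial>\<nu>) \<le> \<theta> * B" if "0 < \<theta>" "\<theta> \<le> 1" for \<theta>
    using invariant_saturated_square_bound[OF case2 inv that] unfolding R_def K_def B_def .
  have B0: "0 \<le> B" unfolding B_def using pm_neg pp_pos lm_pos by (intro mult_nonneg_nonneg) (auto simp: divide_nonpos_pos)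
  have "(\<integral>z. ?f z \<partial>\<nu>) \<le> 0"
  proof (rule field_le_epsilon)
    fix e :: real assume e: "0 < e"
    define t where "t = min 1 (e / (B + 1))"
    have t: "0 < t" "t \<le> 1" using e B0 by (auto simp: t_def)
    have "t * B \<le> (e / (B + 1)) * (B + 1)"
      using B0 t e by (intro mult_mono) (auto simp: t_def)
    then have "t * B \<le> e" using B0 by simp
    then show "(\<integral>z. ?f z \<partial>\<nu>) \<le> 0 + e" using le[OF t] by linarith
  qed
  moreover have "0 \<le> (\<integral>z. ?f z \<partial>\<nu>)" using f0 by (intro integral_nonneg_AE AE_I2)
  ultimately have "(\<integral>z. ?f z \<partial>\<nu>) = 0" by simp
  moreover have "integrable \<nu> ?f"
  proof (rule integrable_const_bound[where B = "1 / K"])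
    show "AE z in \<nu>. norm (?f z) \<le> 1 / K"
    proof (rule AE_I2)
      fix z :: "real \<times> int"
      have "?f z \<le> 1 * R (fst z)" by (intro mult_right_mono) (auto simp: R0)
      then show "norm (?f z) \<le> 1 / K"
        using R0[of "fst z"] R1[of "fst z"] by (simp add: abs_mult)
    qed
  qed measurable
  ultimately have "AE z in \<nu>. ?f z = 0"
    using f0 by (subst (asm) integral_nonneg_eq_0_iff_AE) auto
  then show "AE z in \<nu>. fst z = 0"
    by eventually_elim (use Rpos in \<open>auto simp: min_def split: if_splits\<close>)
qed

end

section \<open>Stationary balance\<close>

context cubic_switching
begin

text \<open>The semigroup of the flow killed at the first jump. Together with \<open>switch\<close>,
  the gain part of the jump generator, it expresses stationarity in Duhamel form.\<close>

definition stay :: "real \<Rightarrow> (real \<times> int \<Rightarrow> ennreal) \<Rightarrow> real \<times> int \<Rightarrow> ennreal" where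
  "stay s g = (\<lambda>z. ennreal (exp (- rate (snd z) * s)) * g (flow (snd z) s (fst z), snd z))"

definition switch :: "(real \<times> int \<Rightarrow> ennreal) \<Rightarrow> real \<times> int \<Rightarrow> ennreal" where
  "switch g = (\<lambda>z. ennreal (rate (snd z)) * g (fst z, - snd z))"

lemma measurable_stay [measurable (raw)]:
  assumes [measurable]: "(\<lambda>w. g (fst w) (snd w)) \<in> borel_measurable (N \<Otimes>\<^sub>M state_space)"
    "s \<in> borel_measurable N" "x \<in> borel_measurable N" "i \<in> measurable N (count_space modes)"
  shows "(\<lambda>w. stay (s w) (g w) (x w, i w)) \<in> borel_measurable N"
proof -
  have "(\<lambda>w. (w, flow (i w) (s w) (x w), i w)) \<in> measurable N (N \<Otimes>\<^sub>M state_space)" by measurable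
  from measurable_compose[OF this assms(1)]
  have [measurable]: "(\<lambda>w. g w (flow (i w) (s w) (x w), i w)) \<in> borel_measurable N" by simp
  show ?thesis unfolding stay_def fst_conv snd_conv by measurable
qed

lemma no_jump_eq_stay: "s \<le> t \<Longrightarrow> no_jump t g (s, z) = stay (t - s) g z"
  by (simp add: no_jump_def stay_def split: prod.split)

lemma jump_op_eq_stay:
  "jump_op h (s, z) = (\<integral>\<^sup>+\<tau>. indicator {0..} \<tau> * stay \<tau> (switch (\<lambda>z. h (s + \<tau>, z))) z \<partial>lborel)"
  unfolding jump_op_def prod.case stay_def switch_def
  by (cases z) (auto intro!: nn_integral_cong
    simp: exponential_density_def indicator_def ennreal_mult mult_ac)

text \<open>The hypothesis looks only at the last jump: in equilibrium the state at time
  \<open>t\<close> either has not jumped since time 0 or made its last jump \<open>s\<close> units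
  ago. The conclusion counts all jumps, so the earlier ones have to be absorbed into
  \<open>\<mu>\<close>.\<close>

lemma transition_le_of_balance:
  assumes "prob_space \<mu>" and s: "sets \<mu> = sets state_space"
    and balance: "\<And>t g. 0 \<le> t \<Longrightarrow> g \<in> borel_measurable state_space \<Longrightarrow>
      (\<integral>\<^sup>+z. stay t g z \<partial>\<mu>) + (\<integral>\<^sup>+s. indicator {0..t} s * (\<integral>\<^sup>+z. switch (stay s g) z \<partial>\<mu>) \<partial>lborel)
        \<le> (\<integral>\<^sup>+z. g z \<partial>\<mu>)"
    and t: "0 \<le> t" and g: "g \<in> borel_measurable state_space"
  shows "(\<integral>\<^sup>+z. transition t g z \<partial>\<mu>) \<le> (\<integral>\<^sup>+z. g z \<partial>\<mu>)"
proof -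
  interpret mu: prob_space \<mu> by fact
  interpret pair_sigma_finite lborel \<mu> ..
  have sp: "space \<mu> = UNIV \<times> modes"
    using sets_eq_imp_space_eq[OF s] by (simp add: space_state_space)
  have [measurable]: "fst \<in> borel_measurable \<mu>" "snd \<in> measurable \<mu> (count_space modes)"
    unfolding measurable_cong_sets[OF s refl] by (rule measurable_state_projections)+
  have msw[measurable]: "(\<lambda>w. switch (\<lambda>z. h (u w, z)) (x w, i w)) \<in> borel_measurable N"
    if "h \<in> borel_measurable space_time" "u \<in> borel_measurable N" "x \<in> borel_measurable N"
      "i \<in> measurable N (count_space modes)" for h u x i and N :: "'c measure"
  proof -
    note [measurable] = that
    show ?thesis unfolding switch_def fst_conv snd_conv by measurable
  qed
  have mstay: "(\<lambda>w. stay (v w) (switch (\<lambda>z. h (u w, z))) (x w, i w)) \<in> borel_measurable N"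
    if "h \<in> borel_measurable space_time" "u \<in> borel_measurable N" "v \<in> borel_measurable N"
      "x \<in> borel_measurable N" "i \<in> measurable N (count_space modes)" for h u v x i and N :: "'c measure"
  proof -
    note [measurable] = that
    have "(\<lambda>w. switch (\<lambda>z. h (u (fst w), z)) (fst (snd w), snd (snd w))) \<in> borel_measurable (N \<Otimes>\<^sub>M state_space)"
      by (rule msw) measurable
    then have [measurable]: "(\<lambda>w. switch (\<lambda>z. h (u (fst w), z)) (snd w)) \<in> borel_measurable (N \<Otimes>\<^sub>M state_space)"
      by simp
    show ?thesis by measurable
  qed
  \<comment> \<open>\<open>R0\<close> evaluates \<open>h\<close> at the start in
    \<open>\<mu>\<close>; \<open>R1\<close> evaluates it just after each jump of the equilibrium
    stream, at all times \<open>u\<close> from 0 on.\<close>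
  define R0 where "R0 h = (\<integral>\<^sup>+z. h (0, z) \<partial>\<mu>)" for h :: "real \<times> real \<times> int \<Rightarrow> ennreal"
  define R1 where "R1 h = (\<integral>\<^sup>+u. indicator {0..} u * (\<integral>\<^sup>+z. switch (\<lambda>z. h (u, z)) z \<partial>\<mu>) \<partial>lborel)"
    for h :: "real \<times> real \<times> int \<Rightarrow> ennreal"
  define M2 where "M2 \<tau> h u = (\<integral>\<^sup>+z. switch (stay \<tau> (switch (\<lambda>z. h (u, z)))) z \<partial>\<mu>)"
    for \<tau> u and h :: "real \<times> real \<times> int \<Rightarrow> ennreal"
  have mh: "(\<lambda>z. h (0, z)) \<in> borel_measurable \<mu>" if [measurable]: "h \<in> borel_measurable space_time" for h
  proof -
    have "(\<lambda>z. h (0, fst z, snd z)) \<in> borel_measurable \<mu>" by measurable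
    then show ?thesis by simp
  qed
  \<comment> \<open>A jump that is the first after time 0, or the next after a jump of the stream,
    belongs to the stream again. With \<open>u = s + \<tau>\<close> for the time of the new jump and
    Fubini, this is \<open>balance\<close> at time \<open>u\<close> for the test function
    \<open>switch (\<lambda>z. h (u, z))\<close>.\<close>
  have main: "R0 (jump_op h) + R1 (jump_op h) \<le> R1 h"
    if h[measurable]: "h \<in> borel_measurable space_time" for h
  proof -
    have [measurable]: "(\<lambda>w. stay (fst w) (switch (\<lambda>z. h (fst w, z))) (snd w)) \<in> borel_measurable (lborel \<Otimes>\<^sub>M \<mu>)"
      using mstay[OF h, of fst "lborel \<Otimes>\<^sub>M \<mu>" fst "\<lambda>w. fst (snd w)" "\<lambda>w. snd (snd w)"] by simp
    have m3: "(\<lambda>w. switch (stay (v w) (switch (\<lambda>z. h (u w, z)))) (x w, i w)) \<in> borel_measurable N"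
      if [measurable]: "u \<in> borel_measurable N" "v \<in> borel_measurable N"
        "x \<in> borel_measurable N" "i \<in> measurable N (count_space modes)" for u v x i and N :: "'c measure"
    proof -
      have [measurable]: "(\<lambda>w. stay (v w) (switch (\<lambda>z. h (u w, z))) (x w, - i w)) \<in> borel_measurable N"
        by (rule mstay) measurable
      show ?thesis unfolding switch_def[of "stay _ _"] fst_conv snd_conv by measurable
    qed
    have mM2[measurable (raw)]: "(\<lambda>w. M2 (v w) h (u w)) \<in> borel_measurable N"
      if [measurable]: "u \<in> borel_measurable N" "v \<in> borel_measurable N" for u v and N :: "'c measure"
    proof -
      have "(\<lambda>w. switch (stay (v (fst w)) (switch (\<lambda>z. h (u (fst w), z)))) (fst (snd w), snd (snd w))) \<in> borel_measurable (N \<Otimes>\<^sub>M \<mu>)"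
        by (rule m3) measurable
      then have [measurable]: "(\<lambda>(w, z). switch (stay (v w) (switch (\<lambda>z. h (u w, z)))) z) \<in> borel_measurable (N \<Otimes>\<^sub>M \<mu>)"
        by (simp add: case_prod_beta)
      show ?thesis unfolding M2_def by measurable
    qed
    have "R0 (jump_op h) = (\<integral>\<^sup>+z. \<integral>\<^sup>+u. indicator {0..} u * stay u (switch (\<lambda>z. h (u, z))) z \<partial>lborel \<partial>\<mu>)"
      unfolding R0_def by (simp add: jump_op_eq_stay)
    also have "\<dots> = (\<integral>\<^sup>+u. \<integral>\<^sup>+z. indicator {0..} u * stay u (switch (\<lambda>z. h (u, z))) z \<partial>\<mu> \<partial>lborel)"
      by (subst Fubini'[symmetric]) (auto simp: case_prod_beta)
    also have "\<dots> = (\<integral>\<^sup>+u. indicator {0..} u * (\<integral>\<^sup>+z. stay u (switch (\<lambda>z. h (u, z))) z \<partial>\<mu>) \<partial>lborel)"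
    proof (intro nn_integral_cong nn_integral_cmult)
      fix u :: real
      have "(\<lambda>z. stay u (switch (\<lambda>z. h (u, z))) (fst z, snd z)) \<in> borel_measurable \<mu>"
        by (rule mstay) measurable
      then show "stay u (switch (\<lambda>z. h (u, z))) \<in> borel_measurable \<mu>" by simp
    qed
    finally have A: "R0 (jump_op h) = \<dots>" .
    have "R1 (jump_op h) = (\<integral>\<^sup>+s. indicator {0..} s * (\<integral>\<^sup>+\<tau>. indicator {0..} \<tau> * M2 \<tau> h (s + \<tau>) \<partial>lborel) \<partial>lborel)"
      unfolding R1_def
    proof (intro nn_integral_cong arg_cong2[where f = "(*)"] refl)
      fix s :: real
      have [measurable]: "(\<lambda>w. switch (stay (fst w) (switch (\<lambda>z. h (s + fst w, z)))) (snd w)) \<in> borel_measurable (lborel \<Otimes>\<^sub>M \<mu>)"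
        using m3[of "\<lambda>w. s + fst w" "lborel \<Otimes>\<^sub>M \<mu>" fst "\<lambda>w. fst (snd w)" "\<lambda>w. snd (snd w)"] by simp
      have "(\<integral>\<^sup>+z. switch (\<lambda>z. jump_op h (s, z)) z \<partial>\<mu>) =
          (\<integral>\<^sup>+z. \<integral>\<^sup>+\<tau>. indicator {0..} \<tau> * switch (stay \<tau> (switch (\<lambda>z. h (s + \<tau>, z)))) z \<partial>lborel \<partial>\<mu>)"
      proof (rule nn_integral_cong)
        fix z assume z: "z \<in> space \<mu>"
        have [measurable]: "(\<lambda>\<tau>. stay \<tau> (switch (\<lambda>z. h (s + \<tau>, z))) (fst z, - snd z)) \<in> borel_measurable lborel"
          using z by (intro mstay) (auto simp: sp)
        show "switch (\<lambda>z. jump_op h (s, z)) z =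
            (\<integral>\<^sup>+\<tau>. indicator {0..} \<tau> * switch (stay \<tau> (switch (\<lambda>z. h (s + \<tau>, z)))) z \<partial>lborel)"
          unfolding switch_def[of "\<lambda>z. jump_op h (s, z)"] switch_def[of "stay _ _"]
          unfolding jump_op_eq_stay
          by (subst nn_integral_cmult[symmetric]) (auto intro!: nn_integral_cong simp: mult_ac)
      qed
      also have "\<dots> = (\<integral>\<^sup>+\<tau>. \<integral>\<^sup>+z. indicator {0..} \<tau> * switch (stay \<tau> (switch (\<lambda>z. h (s + \<tau>, z)))) z \<partial>\<mu> \<partial>lborel)"
        by (subst Fubini'[symmetric]) (auto simp: case_prod_beta)
      also have "\<dots> = (\<integral>\<^sup>+\<tau>. indicator {0..} \<tau> * M2 \<tau> h (s + \<tau>) \<partial>lborel)"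
        unfolding M2_def
      proof (intro nn_integral_cong nn_integral_cmult)
        fix \<tau> :: real
        have "(\<lambda>z. switch (stay \<tau> (switch (\<lambda>z. h (s + \<tau>, z)))) (fst z, snd z)) \<in> borel_measurable \<mu>"
          by (rule m3) measurable
        then show "switch (stay \<tau> (switch (\<lambda>z. h (s + \<tau>, z)))) \<in> borel_measurable \<mu>" by simp
      qed
      finally show "(\<integral>\<^sup>+z. switch (\<lambda>z. jump_op h (s, z)) z \<partial>\<mu>) = (\<integral>\<^sup>+\<tau>. indicator {0..} \<tau> * M2 \<tau> h (s + \<tau>) \<partial>lborel)" .
    qed
    also have "\<dots> = (\<integral>\<^sup>+s. \<integral>\<^sup>+u. indicator {0..} s * (indicator {0..} (u - s) * M2 (u - s) h u) \<partial>lborel \<partial>lborel)"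
    proof (intro nn_integral_cong)
      fix s :: real
      have "(\<integral>\<^sup>+\<tau>. indicator {0..} \<tau> * M2 \<tau> h (s + \<tau>) \<partial>lborel) =
          (\<integral>\<^sup>+u. indicator {0..} (u - s) * M2 (u - s) h u \<partial>lborel)"
        by (subst nn_integral_real_affine[where c = 1 and t = "- s"]) (auto simp: add.commute)
      then show "indicator {0..} s * (\<integral>\<^sup>+\<tau>. indicator {0..} \<tau> * M2 \<tau> h (s + \<tau>) \<partial>lborel) =
          (\<integral>\<^sup>+u. indicator {0..} s * (indicator {0..} (u - s) * M2 (u - s) h u) \<partial>lborel)"
        by (simp add: nn_integral_cmult)
    qed
    also have "\<dots> = (\<integral>\<^sup>+u. \<integral>\<^sup>+s. indicator {0..} s * (indicator {0..} (u - s) * M2 (u - s) h u) \<partial>lborel \<partial>lborel)"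
      by (subst lborel_pair.Fubini') (auto simp: case_prod_beta)
    also have "\<dots> = (\<integral>\<^sup>+u. indicator {0..} u * (\<integral>\<^sup>+s. indicator {0..u} s * M2 s h u \<partial>lborel) \<partial>lborel)"
    proof (intro nn_integral_cong)
      fix u :: real
      have "(\<integral>\<^sup>+s. indicator {0..} s * (indicator {0..} (u - s) * M2 (u - s) h u) \<partial>lborel) =
          (\<integral>\<^sup>+s. indicator {0..} (u - s) * (indicator {0..} s * M2 s h u) \<partial>lborel)"
        by (subst nn_integral_real_affine[where c = "- 1" and t = u]) auto
      also have "\<dots> = (\<integral>\<^sup>+s. indicator {0..} u * (indicator {0..u} s * M2 s h u) \<partial>lborel)"
        by (intro nn_integral_cong) (auto simp: indicator_def)
      finally show "(\<integral>\<^sup>+s. indicator {0..} s * (indicator {0..} (u - s) * M2 (u - s) h u) \<partial>lborel) =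
          indicator {0..} u * (\<integral>\<^sup>+s. indicator {0..u} s * M2 s h u \<partial>lborel)"
        by (simp add: nn_integral_cmult)
    qed
    finally have B: "R1 (jump_op h) = \<dots>" .
    have [measurable]: "(\<lambda>u. \<integral>\<^sup>+z. stay u (switch (\<lambda>z. h (u, z))) z \<partial>\<mu>) \<in> borel_measurable lborel"
      by (rule mu.borel_measurable_nn_integral[where f = "\<lambda>u. stay u (switch (\<lambda>z. h (u, z)))"])
        (simp add: case_prod_beta)
    have [measurable]: "Measurable.pred (borel \<Otimes>\<^sub>M borel) (\<lambda>x :: real \<times> real. snd x \<in> {0..fst x})"
      unfolding atLeastAtMost_iff by measurable
    have [measurable]: "(\<lambda>x. M2 (snd x) h (fst x)) \<in> borel_measurable (lborel \<Otimes>\<^sub>M lborel)"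
      by (rule mM2) measurable
    have "R0 (jump_op h) + R1 (jump_op h) = (\<integral>\<^sup>+u. indicator {0..} u * ((\<integral>\<^sup>+z. stay u (switch (\<lambda>z. h (u, z))) z \<partial>\<mu>) +
        (\<integral>\<^sup>+s. indicator {0..u} s * M2 s h u \<partial>lborel)) \<partial>lborel)"
      unfolding A B distrib_left by (rule nn_integral_add[symmetric]) measurable
    also have "\<dots> \<le> (\<integral>\<^sup>+u. indicator {0..} u * (\<integral>\<^sup>+z. switch (\<lambda>z. h (u, z)) z \<partial>\<mu>) \<partial>lborel)"
    proof (rule nn_integral_mono)
      fix u :: real
      have "switch (\<lambda>z. h (u, z)) \<in> borel_measurable state_space"
        using msw[OF h, of "\<lambda>_. u" state_space fst snd] by simp
      then show "indicator {0..} u * ((\<integral>\<^sup>+z. stay u (switch (\<lambda>z. h (u, z))) z \<partial>\<mu>) +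
        (\<integral>\<^sup>+s. indicator {0..u} s * M2 s h u \<partial>lborel)) \<le> indicator {0..} u * (\<integral>\<^sup>+z. switch (\<lambda>z. h (u, z)) z \<partial>\<mu>)"
        unfolding M2_def using balance[of u] by (auto simp: indicator_def intro!: mult_left_mono)
    qed
    finally show ?thesis unfolding R1_def .
  qed
  \<comment> \<open>\<open>main\<close> makes the sum telescope: each further jump is paid for out
    of \<open>R1\<close>, so the bound is the same for all \<open>N\<close>.\<close>
  have partial: "R0 (\<lambda>w. \<Sum>n<N. (jump_op ^^ n) h w) \<le> R0 h + R1 h"
    if "h \<in> borel_measurable space_time" for h N
    using that
  proof (induction N arbitrary: h)
    case 0
    then show ?case by (simp add: R0_def)
  next
    case (Suc N)
    note [measurable] = Suc.prems
    have "R0 (\<lambda>w. \<Sum>n<Suc N. (jump_op ^^ n) h w) = R0 (\<lambda>w. h w + (\<Sum>n<N. (jump_op ^^ n) (jump_op h) w))"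
      by (simp only: sum.lessThan_Suc_shift funpow_Suc_right o_apply funpow_0)
    also have "\<dots> = R0 h + R0 (\<lambda>w. \<Sum>n<N. (jump_op ^^ n) (jump_op h) w)"
      unfolding R0_def by (rule nn_integral_add) (auto intro!: mh)
    also have "\<dots> \<le> R0 h + (R0 (jump_op h) + R1 (jump_op h))"
      by (intro add_left_mono Suc.IH) measurable
    also have "\<dots> \<le> R0 h + R1 h" by (intro add_left_mono main) measurable
    finally show ?case .
  qed
  have "(\<integral>\<^sup>+z. transition t g z \<partial>\<mu>) = (\<Sum>n. R0 ((jump_op ^^ n) (no_jump t g)))"
    unfolding transition_def R0_def using g by (intro nn_integral_suminf mh) measurable
  also have "\<dots> \<le> R0 (no_jump t g) + R1 (no_jump t g)"
    unfolding suminf_eq_SUP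
  proof (rule SUP_least)
    fix N
    have "(\<Sum>n<N. R0 ((jump_op ^^ n) (no_jump t g))) = R0 (\<lambda>w. \<Sum>n<N. (jump_op ^^ n) (no_jump t g) w)"
      unfolding R0_def using g by (intro nn_integral_sum[symmetric] mh) measurable
    also have "\<dots> \<le> R0 (no_jump t g) + R1 (no_jump t g)"
      using g by (intro partial) measurable
    finally show "(\<Sum>n<N. R0 ((jump_op ^^ n) (no_jump t g))) \<le> R0 (no_jump t g) + R1 (no_jump t g)" .
  qed
  also have "\<dots> = (\<integral>\<^sup>+z. stay t g z \<partial>\<mu>) + (\<integral>\<^sup>+s. indicator {0..t} s * (\<integral>\<^sup>+z. switch (stay s g) z \<partial>\<mu>) \<partial>lborel)"
  proof (rule arg_cong2[where f = "(+)"])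
    show "R0 (no_jump t g) = (\<integral>\<^sup>+z. stay t g z \<partial>\<mu>)"
      unfolding R0_def using t by (simp add: no_jump_eq_stay)
    have "R1 (no_jump t g) = (\<integral>\<^sup>+s. indicator {0..t} s * (\<integral>\<^sup>+z. switch (stay (t - s) g) z \<partial>\<mu>) \<partial>lborel)"
      unfolding R1_def
    proof (rule nn_integral_cong)
      fix u :: real
      show "indicator {0..} u * (\<integral>\<^sup>+z. switch (\<lambda>z. no_jump t g (u, z)) z \<partial>\<mu>) =
          indicator {0..t} u * (\<integral>\<^sup>+z. switch (stay (t - u) g) z \<partial>\<mu>)"
      proof (cases "u \<le> t")
        case True
        then show ?thesis by (simp add: no_jump_eq_stay indicator_def)
      next
        case False
        then have "switch (\<lambda>z. no_jump t g (u, z)) z = 0" for z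
          by (simp add: no_jump_def switch_def split: prod.split)
        then show ?thesis using False by simp
      qed
    qed
    \<comment> \<open>In \<open>R1\<close> the variable is the time of the last jump, in
      \<open>balance\<close> it is the time since that jump.\<close>
    also have "\<dots> = (\<integral>\<^sup>+s. indicator {0..t} (t - s) * (\<integral>\<^sup>+z. switch (stay s g) z \<partial>\<mu>) \<partial>lborel)"
    proof (subst nn_integral_real_affine[where c = "- 1" and t = t])
      have [measurable]: "(\<lambda>w. stay (t - fst w) g (fst (snd w), - snd (snd w))) \<in> borel_measurable (borel \<Otimes>\<^sub>M \<mu>)"
        using g by measurable
      have "(\<lambda>w. switch (stay (t - fst w) g) (snd w)) \<in> borel_measurable (borel \<Otimes>\<^sub>M \<mu>)"
        unfolding switch_def by measurable
      then have [measurable]: "(\<lambda>s. \<integral>\<^sup>+z. switch (stay (t - s) g) z \<partial>\<mu>) \<in> borel_measurable borel"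
        by (intro mu.borel_measurable_nn_integral[where f = "\<lambda>s. switch (stay (t - s) g)"])
          (simp add: case_prod_beta)
      show "(\<lambda>s. indicator {0..t} s * (\<integral>\<^sup>+z. switch (stay (t - s) g) z \<partial>\<mu>)) \<in> borel_measurable borel"
        by measurable
    qed auto
    also have "\<dots> = (\<integral>\<^sup>+s. indicator {0..t} s * (\<integral>\<^sup>+z. switch (stay s g) z \<partial>\<mu>) \<partial>lborel)"
      by (intro nn_integral_cong) (auto simp: indicator_def)
    finally show "R1 (no_jump t g) = \<dots>" .
  qed
  also have "\<dots> \<le> (\<integral>\<^sup>+z. g z \<partial>\<mu>)" by (rule balance[OF t g])
  finally show ?thesis .
qed

end

section \<open>Invariance of the measure at the origin\<close>

context cubic_semigroup
begin

lemma prob_space_delta_measure: "prob_space (delta_measure lm lp)"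
proof (rule prob_spaceI)
  have sp: "space (delta_measure lm lp) = space state_space"
    using sets_delta_measure by (rule sets_eq_imp_space_eq)
  have "emeasure (delta_measure lm lp) (space (delta_measure lm lp)) = (\<integral>\<^sup>+z. 1 \<partial>delta_measure lm lp)"
    by simp
  also have "\<dots> = ennreal (lp / (lp + lm)) + ennreal (lm / (lp + lm))"
    by (subst nn_integral_delta_measure) auto
  also have "\<dots> = ennreal (lp / (lp + lm) + lm / (lp + lm))"
    using lm_pos lp_pos by (subst ennreal_plus) auto
  also have "lp / (lp + lm) + lm / (lp + lm) = 1"
    using lm_pos lp_pos by (simp add: add_divide_distrib[symmetric])
  finally show "emeasure (delta_measure lm lp) (space (delta_measure lm lp)) = 1" by simp
qed

text \<open>At the origin the flows do nothing, and the balance is that of the two-state chain,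
  \<open>a * lm = b * lp\<close> with \<open>a\<close> and \<open>b\<close> the weights of the modes
  \<open>-1\<close> and \<open>1\<close>.\<close>

lemma invariant_delta_measure: "invariant_prob P (delta_measure lm lp)"
proof (rule invariant_probI[OF prob_space_delta_measure sets_delta_measure
      transition_le_of_balance[OF prob_space_delta_measure sets_delta_measure]])
  fix t :: real and g :: "real \<times> int \<Rightarrow> ennreal"
  assume t: "0 \<le> t" and g[measurable]: "g \<in> borel_measurable state_space"
  let ?D = "delta_measure lm lp"
  define a where "a = lp / (lp + lm)"
  define b where "b = lm / (lp + lm)"
  have ab: "0 \<le> a" "0 \<le> b" "a * lm / lp = b" "b * lp / lm = a"
    using lm_pos lp_pos by (auto simp: a_def b_def)
  have [simp]: "1 \<in> modes" "-1 \<in> modes" by (auto simp: modes_def)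
  have stay_m: "stay t g \<in> borel_measurable state_space"
  proof -
    have "(\<lambda>z. stay t g (fst z, snd z)) \<in> borel_measurable state_space" by measurable
    then show ?thesis by simp
  qed
  have sw_m: "switch (stay s g) \<in> borel_measurable state_space" for s
    unfolding switch_def by measurable
  have "(\<integral>\<^sup>+z. stay t g z \<partial>?D) = ennreal (a * exp (- lm * t)) * g (0, -1) + ennreal (b * exp (- lp * t)) * g (0, 1)"
    using ab by (subst nn_integral_delta_measure[OF stay_m])
      (simp add: stay_def switch_rate_def ennreal_mult mult.assoc flip: a_def b_def)
  moreover have "(\<integral>\<^sup>+z. switch (stay s g) z \<partial>?D) =
      ennreal (b * lp * exp (- lm * s)) * g (0, -1) + ennreal (a * lm * exp (- lp * s)) * g (0, 1)" for s
    unfolding nn_integral_delta_measure[OF sw_m, folded a_def b_def] using ab lm_pos lp_pos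
    by (simp add: switch_def stay_def switch_rate_def ennreal_mult mult.assoc add.commute)
  then have "(\<integral>\<^sup>+s. indicator {0..t} s * (\<integral>\<^sup>+z. switch (stay s g) z \<partial>?D) \<partial>lborel) =
      (\<integral>\<^sup>+s. (indicator {0..t} s * ennreal (b * lp * exp (- lm * s))) * g (0, -1) +
        (indicator {0..t} s * ennreal (a * lm * exp (- lp * s))) * g (0, 1) \<partial>lborel)"
    by (simp add: distrib_left mult.assoc)
  then have "(\<integral>\<^sup>+s. indicator {0..t} s * (\<integral>\<^sup>+z. switch (stay s g) z \<partial>?D) \<partial>lborel) =
      ennreal (a * (1 - exp (- lm * t))) * g (0, -1) + ennreal (b * (1 - exp (- lp * t))) * g (0, 1)"
    using t lm_pos lp_pos ab
    by (simp add: nn_integral_add nn_integral_multc nn_integral_exponential_Icc mult_nonneg_nonneg)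
  ultimately have "(\<integral>\<^sup>+z. stay t g z \<partial>?D) + (\<integral>\<^sup>+s. indicator {0..t} s * (\<integral>\<^sup>+z. switch (stay s g) z \<partial>?D) \<partial>lborel) =
      (ennreal (a * exp (- lm * t)) + ennreal (a * (1 - exp (- lm * t)))) * g (0, -1) +
      (ennreal (b * exp (- lp * t)) + ennreal (b * (1 - exp (- lp * t)))) * g (0, 1)"
    by (simp only: distrib_right add_ac)
  also have "ennreal (a * exp (- lm * t)) + ennreal (a * (1 - exp (- lm * t))) = ennreal a"
    using ab t lm_pos by (subst ennreal_plus[symmetric]) (auto simp: algebra_simps mult_left_le)
  also have "ennreal (b * exp (- lp * t)) + ennreal (b * (1 - exp (- lp * t))) = ennreal b"
    using ab t lp_pos by (subst ennreal_plus[symmetric]) (auto simp: algebra_simps mult_left_le)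
  also have "ennreal a * g (0, -1) + ennreal b * g (0, 1) = (\<integral>\<^sup>+z. g z \<partial>?D)"
    by (simp add: nn_integral_delta_measure[OF g] a_def b_def)
  finally show "(\<integral>\<^sup>+z. stay t g z \<partial>?D) + (\<integral>\<^sup>+s. indicator {0..t} s * (\<integral>\<^sup>+z. switch (stay s g) z \<partial>?D) \<partial>lborel)
      \<le> (\<integral>\<^sup>+z. g z \<partial>?D)" by simp
qed auto

end

text \<open>In the coordinate \<open>u = pp / x\<^sup>2 - 1\<close> both flows are affine with rate \<open>- 2 * growth i\<close> and fixed
  point \<open>- offset i\<close>. Stationarity means that the two probability fluxes cancel; both equal the
  \<open>profile\<close> up to sign, which then solves a first-order linear equation.\<close>

context cubic_switching
begin

definition offset :: "int \<Rightarrow> real" where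
  "offset i = 1 - pp / growth i"

definition profile :: "real \<Rightarrow> real" where
  "profile u = max 0 u powr (lp / (2 * pp)) * (u + offset (- 1)) powr (lm / (2 * pm))"

text \<open>Flux divided by speed: in mode \<open>i\<close> the coordinate moves with velocity
  \<open>- 2 * growth i * (u + offset i)\<close>.\<close>

definition stat_dens :: "int \<Rightarrow> real \<Rightarrow> real" where
  "stat_dens i u = profile u / (2 * \<bar>growth i\<bar> * (u + offset i))"

text \<open>\<open>u = 0\<close> is the equilibrium \<open>\<sigma> * sqrt pp\<close> of mode
  \<open>1\<close>, and the origin lies at infinity; the stationary density lives in
  between.\<close>

definition position :: "real \<Rightarrow> real \<Rightarrow> real" where
  "position \<sigma> u = \<sigma> * sqrt (pp / (1 + u))"

lemma offset_1: "offset 1 = 0"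
  using pp_pos by (simp add: offset_def growth_def)

lemma offset_minus_1: "1 < offset (- 1)"
  using pp_pos pm_neg by (simp add: offset_def growth_def divide_pos_neg)

lemma offset_nonneg: "i \<in> modes \<Longrightarrow> 0 \<le> offset i"
  using offset_1 offset_minus_1 by (auto simp: modes_def)

lemma profile_nonpos: "u \<le> 0 \<Longrightarrow> profile u = 0"
  by (simp add: profile_def)

lemma profile_pos: "0 < u \<Longrightarrow> 0 < profile u"
  using offset_minus_1 by (simp add: profile_def)

lemma profile_nonneg: "0 \<le> profile u"
  by (simp add: profile_def)

lemma stat_dens_nonpos: "u \<le> 0 \<Longrightarrow> stat_dens i u = 0"
  by (simp add: stat_dens_def profile_nonpos)

lemma stat_dens_nonneg: "i \<in> modes \<Longrightarrow> 0 \<le> stat_dens i u"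
  using profile_nonneg[of u] offset_nonneg[of i]
  by (cases "0 \<le> u") (auto simp: stat_dens_def profile_nonpos)

lemma measurable_profile [measurable]: "profile \<in> borel_measurable borel"
  unfolding profile_def by measurable

lemma measurable_stat_dens [measurable]: "stat_dens i \<in> borel_measurable borel"
  unfolding stat_dens_def by measurable

lemma measurable_position [measurable]: "position \<sigma> \<in> borel_measurable borel"
  unfolding position_def by measurable

text \<open>The first exponent is positive, so the profile is continuous across the edge
  \<open>u = 0\<close> of its support; only the second factor has to stay away from its
  singularity.\<close>

lemma continuous_on_profile:
  assumes "\<And>x. x \<in> S \<Longrightarrow> 0 < f x + offset (- 1)" "continuous_on S f"
  shows "continuous_on S (\<lambda>x. profile (f x))"
  unfolding profile_def using assms pp_pos lp_pos
  by (intro continuous_intros continuous_on_powr' assms(2)) (fastforce simp: less_imp_neq)+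

text \<open>The logarithmic derivative is the sum over both modes of
  \<open>rate i / (2 * growth i * (u + offset i))\<close>, that is, of minus rate over velocity:
  what one mode loses by switching, the other gains.\<close>

lemma profile_deriv:
  assumes "0 < u"
  shows "(profile has_real_derivative
    profile u * (lp / (2 * pp) / u + lm / (2 * pm) / (u + offset (- 1)))) (at u)"
proof -
  let ?a = "lp / (2 * pp)" and ?b = "lm / (2 * pm)" and ?c = "offset (- 1)"
  have c: "0 < u + ?c" using offset_minus_1 assms by linarith
  have "((\<lambda>u. u powr ?a * (u + ?c) powr ?b) has_real_derivative
      ?a * u powr (?a - 1) * (u + ?c) powr ?b + (?b * (u + ?c) powr (?b - 1)) * u powr ?a) (at u)"
    using assms c
    by (auto intro!: derivative_eq_intros)
  also have "?a * u powr (?a - 1) * (u + ?c) powr ?b + (?b * (u + ?c) powr (?b - 1)) * u powr ?a =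
      profile u * (?a / u + ?b / (u + ?c))"
    using assms c by (simp add: profile_def powr_diff field_simps)
  finally show ?thesis
    by (rule has_field_derivative_transform_within_open[of _ _ _ "{0<..}"])
      (use assms in \<open>auto simp: profile_def\<close>)
qed

lemma flow_position:
  assumes s: "0 \<le> s" and u: "0 < u" and sg: "\<sigma> \<in> {- 1, 1}" and i: "i \<in> modes"
  shows "flow i s (position \<sigma> u) = position \<sigma> (exp (- 2 * growth i * s) * (u + offset i) - offset i)"
proof -
  let ?x = "position \<sigma> u" and ?v = "exp (- 2 * growth i * s) * (u + offset i) - offset i"
  have pos: "0 < pp / (1 + u)" using u pp_pos by simp
  have sq: "(position \<sigma> u')\<^sup>2 = pp / (1 + u')" if "0 \<le> pp / (1 + u')" for u'
    using sg that by (auto simp: position_def power_mult_distrib)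
  have sgx: "sgn ?x = \<sigma>" using sg pos by (auto simp: position_def sgn_mult)
  then have x0: "?x \<noteq> 0" using sg by auto
  have "1 / (flow i s ?x)\<^sup>2 = 1 / growth i + exp (- 2 * growth i * s) * ((1 + u) / pp - 1 / growth i)"
    using inverse_square_flow[OF s x0, of i] sq[of u] pos by simp
  also have "\<dots> = (1 + ?v) / pp"
    using pp_pos growth_nz[of i] by (simp add: offset_def field_simps)
  finally have inv: "1 / (flow i s ?x)\<^sup>2 = (1 + ?v) / pp" .
  have "flow i s ?x \<noteq> 0" using flow_eq_0_iff[OF s] x0 by simp
  then have pos': "0 < (1 + ?v) / pp" unfolding inv[symmetric] by simp
  have sq': "(flow i s ?x)\<^sup>2 = pp / (1 + ?v)"
  proof -
    have "(flow i s ?x)\<^sup>2 = 1 / (1 / (flow i s ?x)\<^sup>2)" by simp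
    also have "\<dots> = pp / (1 + ?v)" unfolding inv by simp
    finally show ?thesis .
  qed
  have abs: "\<bar>flow i s ?x\<bar> = sqrt (pp / (1 + ?v))"
    unfolding sq'[symmetric] by simp
  have "flow i s ?x = sgn (flow i s ?x) * \<bar>flow i s ?x\<bar>" by (simp add: sgn_mult_abs)
  also have "\<dots> = position \<sigma> ?v" unfolding sgn_flow[OF s] sgx abs by (simp add: position_def)
  finally show ?thesis .
qed

text \<open>\<open>S\<close> is the affine flow run backwards from \<open>w\<close>. The density
  transported for time \<open>s\<close> without a jump, called \<open>k\<close> below, has as
  derivative minus the inflow from the other mode, because \<open>profile\<close> solves its linear
  equation. Integrating over the part of the backward orbit inside the support gives the
  claim.\<close>

lemma stat_dens_balance:
  fixes w t :: real
  assumes i: "i \<in> modes" and t: "0 \<le> t"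
  defines "S \<equiv> \<lambda>s. exp (2 * growth i * s) * (w + offset i) - offset i"
  shows "ennreal (exp (- rate i * t) * (exp (2 * growth i * t) * stat_dens i (S t))) +
      (\<integral>\<^sup>+s. indicator {0..t} s * ennreal (rate (- i) * exp (- rate i * s) *
        (exp (2 * growth i * s) * stat_dens (- i) (S s))) \<partial>lborel)
    \<le> ennreal (stat_dens i w)"
proof (cases "0 < w")
  case False
  \<comment> \<open>Both flows map the support into itself, so a backward orbit that starts outside
    stays outside.\<close>
  have "S s \<le> 0" if "0 \<le> s" for s
  proof -
    have "exp (2 * growth i * s) * w \<le> 0" using False by (simp add: mult_nonneg_nonpos)
    moreover have "(exp (2 * growth i * s) - 1) * offset i \<le> 0"
    proof -
      consider "i = 1" | "i = - 1" using i by (auto simp: modes_def)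
      then show ?thesis
      proof cases
        case 2
        then have "exp (2 * growth i * s) \<le> 1"
          using pm_neg that by (simp add: growth_def mult_nonpos_nonneg)
        then show ?thesis using offset_nonneg[OF i] by (simp add: mult_nonpos_nonneg)
      qed (simp add: offset_1)
    qed
    ultimately show ?thesis by (simp add: S_def algebra_simps)
  qed
  then have z: "stat_dens j (S s) = 0" if "0 \<le> s" for s j using that by (simp add: stat_dens_nonpos)
  have "(\<integral>\<^sup>+s. indicator {0..t} s * ennreal (rate (- i) * exp (- rate i * s) *
        (exp (2 * growth i * s) * stat_dens (- i) (S s))) \<partial>lborel) = (\<integral>\<^sup>+s. 0 \<partial>(lborel :: real measure))"
    by (intro nn_integral_cong) (auto simp: z indicator_def)
  then show ?thesis by (simp add: z t)
next
  case w: True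
  have wo: "0 < w + offset i" using w offset_nonneg[OF i] by linarith
  define D where "D = 2 * \<bar>growth i\<bar> * (w + offset i)"
  have D: "0 < D" using wo by (simp add: D_def)
  have So: "S s + offset i = exp (2 * growth i * s) * (w + offset i)" for s by (simp add: S_def)
  have Sc: "0 < S s + offset (- 1)" for s
  proof -
    have "0 < S s + offset i" unfolding So using wo by simp
    moreover have "offset i \<le> offset (- 1)"
      using i offset_1 offset_minus_1 by (auto simp: modes_def)
    ultimately show ?thesis by linarith
  qed
  \<comment> \<open>The Jacobian of the flow cancels against the change of speed along the orbit and
    leaves the constant \<open>D\<close>, the speed at \<open>w\<close>.\<close>
  have dens: "exp (2 * growth i * s) * stat_dens i (S s) = profile (S s) / D" for s
    unfolding stat_dens_def So D_def by simp
  define k where "k s = exp (- rate i * s) * (exp (2 * growth i * s) * stat_dens i (S s))" for s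
  define k' where "k' s = - (rate (- i) * exp (- rate i * s) * (exp (2 * growth i * s) * stat_dens (- i) (S s)))" for s
  have cont: "continuous_on A k" for A
    unfolding k_def dens using D Sc
    by (intro continuous_intros continuous_on_profile) (auto simp: S_def intro!: continuous_intros)
  have deriv: "(k has_real_derivative k' s) (at s)" if s: "0 < S s" for s
  proof -
    let ?b = "lp / (2 * pp) / S s + lm / (2 * pm) / (S s + offset (- 1))"
    have dS: "(S has_real_derivative 2 * growth i * (S s + offset i)) (at s)"
      unfolding So unfolding S_def by (auto intro!: derivative_eq_intros)
    have dp: "((\<lambda>s. profile (S s)) has_real_derivative profile (S s) * ?b * (2 * growth i * (S s + offset i))) (at s)"
      by (rule DERIV_chain2[OF profile_deriv[OF s] dS])
    have "((\<lambda>s. exp (- rate i * s) * (profile (S s) / D)) has_real_derivative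
        exp (- rate i * s) * profile (S s) / D * (?b * (2 * growth i * (S s + offset i)) - rate i)) (at s)"
    proof (rule DERIV_cong)
      have "((\<lambda>s. exp (- rate i * s)) has_real_derivative - rate i * exp (- rate i * s)) (at s)"
        by (auto intro!: derivative_eq_intros)
      from DERIV_mult[OF this DERIV_cdivide[OF dp, of D]]
      show "((\<lambda>s. exp (- rate i * s) * (profile (S s) / D)) has_real_derivative
          - rate i * exp (- rate i * s) * (profile (S s) / D) +
          profile (S s) * ?b * (2 * growth i * (S s + offset i)) / D * exp (- rate i * s)) (at s)" .
      show "- rate i * exp (- rate i * s) * (profile (S s) / D) +
          profile (S s) * ?b * (2 * growth i * (S s + offset i)) / D * exp (- rate i * s) =
          exp (- rate i * s) * profile (S s) / D * (?b * (2 * growth i * (S s + offset i)) - rate i)"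
        by (simp only: right_diff_distrib times_divide_eq_left times_divide_eq_right) (simp add: mult_ac)
    qed
    moreover have "exp (- rate i * s) * profile (S s) / D * (?b * (2 * growth i * (S s + offset i)) - rate i) = k' s"
    proof -
      \<comment> \<open>In the logarithmic derivative the summand of mode \<open>i\<close> gives
        exactly \<open>rate i\<close>, the killing; the summand of the other mode remains and is the
        inflow.\<close>
      have "?b * (2 * growth i * (S s + offset i)) - rate i =
          - (rate (- i) * (S s + offset i) * \<bar>growth i\<bar> / (\<bar>growth (- i)\<bar> * (S s + offset (- i))))"
      proof -
        consider "i = 1" | "i = - 1" using i by (auto simp: modes_def)
        then show ?thesis
        proof cases
          case 1
          then show ?thesis using s Sc[of s] pp_pos pm_neg
            by (simp add: growth_def switch_rate_def offset_1 distrib_right)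
        next
          case 2
          then show ?thesis using s Sc[of s] pp_pos pm_neg
            by (simp add: growth_def switch_rate_def offset_1 distrib_right) (simp add: field_simps)
        qed
      qed
      then have "exp (- rate i * s) * profile (S s) / D * (?b * (2 * growth i * (S s + offset i)) - rate i) =
          - (rate (- i) * exp (- rate i * s) * (profile (S s) * (\<bar>growth i\<bar> * (S s + offset i) / D) /
            (\<bar>growth (- i)\<bar> * (S s + offset (- i)))))"
        by simp
      also have "\<bar>growth i\<bar> * (S s + offset i) / D = exp (2 * growth i * s) / 2"
      proof -
        have "\<bar>y\<bar> * (e * W) / (2 * \<bar>y\<bar> * W) = e / 2" if "y \<noteq> 0" "0 < W" for y e W :: real
          using that by simp
        then show ?thesis unfolding So D_def using wo growth_nz by blast
      qed
      finally show ?thesis unfolding k'_def stat_dens_def by (simp add: mult_ac)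
    qed
    ultimately show ?thesis unfolding k_def dens by simp
  qed
  have k'_nonpos: "k' s \<le> 0" for s
    unfolding k'_def using stat_dens_nonneg[of "- i" "S s"] i by (simp add: mult_nonneg_nonneg)
  \<comment> \<open>The last time up to \<open>t\<close> at which the backward orbit is still in the
    support. In mode \<open>1\<close> it never leaves; in mode \<open>-1\<close> it leaves at
    \<open>r0\<close>, and from then on all terms vanish.\<close>
  obtain r where r: "0 \<le> r" "r \<le> t" "\<And>s. 0 < s \<Longrightarrow> s < r \<Longrightarrow> 0 < S s"
    "\<And>s. r < s \<Longrightarrow> s \<le> t \<Longrightarrow> S s \<le> 0"
  proof -
    consider "i = 1" | "i = - 1" using i by (auto simp: modes_def)
    then show ?thesis
    proof cases
      case 1
      then show ?thesis using w t by (intro that[of t]) (auto simp: S_def offset_1)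
    next
      case 2
      let ?c = "offset (- 1)"
      define r0 where "r0 = ln (?c / (w + ?c)) / (2 * pm)"
      have c: "0 < ?c" using offset_minus_1 by simp
      have iff: "0 < S s \<longleftrightarrow> s < r0" for s
      proof -
        have "0 < S s \<longleftrightarrow> ?c / (w + ?c) < exp (2 * pm * s)"
          using w c 2 by (simp add: S_def growth_def field_simps)
        also have "\<dots> \<longleftrightarrow> ln (?c / (w + ?c)) < 2 * pm * s"
          using w c by (subst ln_less_cancel_iff[symmetric]) auto
        also have "\<dots> \<longleftrightarrow> s < r0"
          using pm_neg by (simp add: r0_def field_simps)
        finally show ?thesis .
      qed
      have "0 < r0" using iff[of 0] w by (simp add: S_def)
      then show ?thesis using t iff by (intro that[of "min r0 t"]) (auto simp: not_less[symmetric])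
    qed
  qed
  have FTC: "(\<integral>\<^sup>+s. ennreal (- k' s) * indicator {0<..<r} s \<partial>lborel) = ennreal (k 0 - k r)" "k r \<le> k 0"
    using nn_integral_FTC_open[of 0 r k k'] r cont deriv k'_nonpos by auto
  have "(\<integral>\<^sup>+s. indicator {0..t} s * ennreal (rate (- i) * exp (- rate i * s) *
        (exp (2 * growth i * s) * stat_dens (- i) (S s))) \<partial>lborel) \<le> ennreal (k 0 - k r)"
    unfolding FTC(1)[symmetric]
  proof (rule nn_integral_mono_AE)
    have "AE s in lborel. s \<noteq> 0 \<and> s \<noteq> r"
      using AE_lborel_singleton[of "0::real"] AE_lborel_singleton[of r] by eventually_elim auto
    then show "AE s in lborel. indicator {0..t} s * ennreal (rate (- i) * exp (- rate i * s) *
        (exp (2 * growth i * s) * stat_dens (- i) (S s))) \<le> ennreal (- k' s) * indicator {0<..<r} s"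
    proof eventually_elim
      case (elim s)
      then consider "s < 0 \<or> t < s" | "0 < s" "s < r" | "r < s" "s \<le> t" using r by linarith
      then show ?case
      proof cases
        case 3
        then show ?thesis using r(4)[of s] by (simp add: stat_dens_nonpos)
      qed (auto simp: k'_def indicator_def)
    qed
  qed
  moreover have "exp (- rate i * t) * (exp (2 * growth i * t) * stat_dens i (S t)) \<le> k r"
  proof (cases "r = t")
    case False
    then have "S t \<le> 0" using r by auto
    moreover have "0 \<le> k r" unfolding k_def using stat_dens_nonneg[OF i] by simp
    ultimately show ?thesis by (simp add: stat_dens_nonpos)
  qed (simp add: k_def)
  ultimately have "ennreal (exp (- rate i * t) * (exp (2 * growth i * t) * stat_dens i (S t))) +
      (\<integral>\<^sup>+s. indicator {0..t} s * ennreal (rate (- i) * exp (- rate i * s) *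
        (exp (2 * growth i * s) * stat_dens (- i) (S s))) \<partial>lborel) \<le> ennreal (k r) + ennreal (k 0 - k r)"
    by (intro add_mono ennreal_leI)
  also have "\<dots> = ennreal (k 0)"
    using FTC(2) stat_dens_nonneg[OF i] by (subst ennreal_plus[symmetric]) (auto simp: k_def)
  also have "k 0 = stat_dens i w" by (simp add: k_def S_def)
  finally show ?thesis .
qed

text \<open>Change of variables along the affine flow, with Jacobian
  \<open>exp (2 * growth i * s)\<close>. The index \<open>j\<close> is kept apart from
  \<open>i\<close> because mass arriving by a switch still has the density of the other
  mode.\<close>

lemma nn_integral_stat_dens_flow:
  assumes s: "0 \<le> s" and sg: "\<sigma> \<in> {- 1, 1}" and i: "i \<in> modes"
    and g: "g \<in> borel_measurable state_space"
  shows "(\<integral>\<^sup>+u. ennreal (stat_dens j u) * g (flow i s (position \<sigma> u), i) \<partial>lborel) =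
    (\<integral>\<^sup>+w. ennreal (exp (2 * growth i * s) * stat_dens j (exp (2 * growth i * s) * (w + offset i) - offset i)) *
      g (position \<sigma> w, i) \<partial>lborel)"
proof -
  note [measurable] = g
  have [simp]: "i \<in> modes" by fact
  let ?T = "\<lambda>u. exp (- 2 * growth i * s) * (u + offset i) - offset i"
  let ?e = "exp (2 * growth i * s)"
  define f where "f u = ennreal (stat_dens j u) * g (position \<sigma> (?T u), i)" for u
  have f[measurable]: "f \<in> borel_measurable borel" unfolding f_def by measurable
  have "(\<integral>\<^sup>+u. ennreal (stat_dens j u) * g (flow i s (position \<sigma> u), i) \<partial>lborel) =
      (\<integral>\<^sup>+u. f u \<partial>lborel)"
  proof (rule nn_integral_cong)
    fix u show "ennreal (stat_dens j u) * g (flow i s (position \<sigma> u), i) = f u"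
      by (cases "0 < u") (simp_all add: f_def flow_position[OF s _ sg i] stat_dens_nonpos)
  qed
  also have "\<dots> = ennreal \<bar>?e\<bar> * (\<integral>\<^sup>+w. f ((?e * offset i - offset i) + ?e * w) \<partial>lborel)"
    by (rule nn_integral_real_affine[OF f]) simp
  also have "\<dots> = (\<integral>\<^sup>+w. ennreal \<bar>?e\<bar> * f ((?e * offset i - offset i) + ?e * w) \<partial>lborel)"
    by (rule nn_integral_cmult[symmetric]) measurable
  also have "\<dots> = (\<integral>\<^sup>+w. ennreal (?e * stat_dens j (?e * (w + offset i) - offset i)) * g (position \<sigma> w, i) \<partial>lborel)"
  proof (rule nn_integral_cong)
    fix w
    let ?u = "(?e * offset i - offset i) + ?e * w"
    have "exp (- 2 * growth i * s) * ?e = 1" by (simp flip: exp_add)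
    moreover have "?T ?u = (exp (- 2 * growth i * s) * ?e) * (w + offset i) - offset i"
      by (simp add: algebra_simps)
    ultimately have T: "?T ?u = w" by simp
    have u: "?u = ?e * (w + offset i) - offset i"
      by (simp add: algebra_simps)
    have "f ?u = ennreal (stat_dens j ?u) * g (position \<sigma> w, i)"
      unfolding f_def T ..
    then show "ennreal \<bar>?e\<bar> * f ?u =
      ennreal (?e * stat_dens j (?e * (w + offset i) - offset i)) * g (position \<sigma> w, i)"
      unfolding u by (simp add: ennreal_mult' mult.assoc)
  qed
  finally show ?thesis .
qed

text \<open>The pointwise balance integrated against \<open>g\<close>, after the flow has been moved
  from the test function to the density.\<close>

lemma stat_dens_mode_balance:
  assumes t: "0 \<le> t" and sg: "\<sigma> \<in> {- 1, 1}" and i: "i \<in> modes"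
    and g: "g \<in> borel_measurable state_space"
  shows "(\<integral>\<^sup>+u. ennreal (stat_dens i u) * stay t g (position \<sigma> u, i) \<partial>lborel) +
    (\<integral>\<^sup>+s. indicator {0..t} s * (\<integral>\<^sup>+u. ennreal (stat_dens (- i) u) * switch (stay s g) (position \<sigma> u, - i) \<partial>lborel) \<partial>lborel)
    \<le> (\<integral>\<^sup>+u. ennreal (stat_dens i u) * g (position \<sigma> u, i) \<partial>lborel)"
proof -
  note [measurable] = g
  have [simp]: "i \<in> modes" by fact
  let ?S = "\<lambda>s w. exp (2 * growth i * s) * (w + offset i) - offset i"
  let ?q = "\<lambda>s w. rate (- i) * exp (- rate i * s) * (exp (2 * growth i * s) * stat_dens (- i) (?S s w))"
  let ?p = "\<lambda>w. exp (- rate i * t) * (exp (2 * growth i * t) * stat_dens i (?S t w))"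
  let ?G = "\<lambda>w. g (position \<sigma> w, i)"
  have "(\<integral>\<^sup>+u. ennreal (stat_dens i u) * stay t g (position \<sigma> u, i) \<partial>lborel) =
      (\<integral>\<^sup>+u. ennreal (exp (- rate i * t)) * (ennreal (stat_dens i u) * g (flow i t (position \<sigma> u), i)) \<partial>lborel)"
    by (simp add: stay_def mult_ac)
  also have "\<dots> = ennreal (exp (- rate i * t)) * (\<integral>\<^sup>+u. ennreal (stat_dens i u) * g (flow i t (position \<sigma> u), i) \<partial>lborel)"
    by (rule nn_integral_cmult) measurable
  also have "\<dots> = (\<integral>\<^sup>+w. ennreal (?p w) * ?G w \<partial>lborel)"
    unfolding nn_integral_stat_dens_flow[OF t sg i g]
    by (subst nn_integral_cmult[symmetric]) (auto simp: ennreal_mult' mult_ac)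
  finally have A: "(\<integral>\<^sup>+u. ennreal (stat_dens i u) * stay t g (position \<sigma> u, i) \<partial>lborel) = \<dots>" .
  have "(\<integral>\<^sup>+s. indicator {0..t} s * (\<integral>\<^sup>+u. ennreal (stat_dens (- i) u) * switch (stay s g) (position \<sigma> u, - i) \<partial>lborel) \<partial>lborel) =
      (\<integral>\<^sup>+s. \<integral>\<^sup>+w. indicator {0..t} s * (ennreal (?q s w) * ?G w) \<partial>lborel \<partial>lborel)"
  proof (rule nn_integral_cong)
    fix s
    show "indicator {0..t} s * (\<integral>\<^sup>+u. ennreal (stat_dens (- i) u) * switch (stay s g) (position \<sigma> u, - i) \<partial>lborel) =
      (\<integral>\<^sup>+w. indicator {0..t} s * (ennreal (?q s w) * ?G w) \<partial>lborel)"
    proof (cases "s \<in> {0..t}")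
      case True
      then have s: "0 \<le> s" by simp
      have "(\<integral>\<^sup>+u. ennreal (stat_dens (- i) u) * switch (stay s g) (position \<sigma> u, - i) \<partial>lborel) =
        (\<integral>\<^sup>+u. ennreal (rate (- i) * exp (- rate i * s)) * (ennreal (stat_dens (- i) u) * g (flow i s (position \<sigma> u), i)) \<partial>lborel)"
        by (simp add: stay_def switch_def ennreal_mult mult_ac)
      also have "\<dots> = ennreal (rate (- i) * exp (- rate i * s)) * (\<integral>\<^sup>+u. ennreal (stat_dens (- i) u) * g (flow i s (position \<sigma> u), i) \<partial>lborel)"
        by (rule nn_integral_cmult) measurable
      also have "\<dots> = (\<integral>\<^sup>+w. ennreal (?q s w) * ?G w \<partial>lborel)"
        unfolding nn_integral_stat_dens_flow[OF s sg i g]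
        by (subst nn_integral_cmult[symmetric]) (auto simp: ennreal_mult' mult_ac)
      finally show ?thesis using True by simp
    qed simp
  qed
  also have "\<dots> = (\<integral>\<^sup>+w. \<integral>\<^sup>+s. indicator {0..t} s * (ennreal (?q s w) * ?G w) \<partial>lborel \<partial>lborel)"
    by (subst lborel_pair.Fubini') (auto simp: case_prod_beta)
  also have "\<dots> = (\<integral>\<^sup>+w. (\<integral>\<^sup>+s. indicator {0..t} s * ennreal (?q s w) \<partial>lborel) * ?G w \<partial>lborel)"
    by (intro nn_integral_cong) (subst nn_integral_multc[symmetric], auto simp: mult_ac)
  finally have B: "(\<integral>\<^sup>+s. indicator {0..t} s * (\<integral>\<^sup>+u. ennreal (stat_dens (- i) u) * switch (stay s g) (position \<sigma> u, - i) \<partial>lborel) \<partial>lborel) = \<dots>" .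
  have "(\<integral>\<^sup>+w. ennreal (?p w) * ?G w \<partial>lborel) +
      (\<integral>\<^sup>+w. (\<integral>\<^sup>+s. indicator {0..t} s * ennreal (?q s w) \<partial>lborel) * ?G w \<partial>lborel) =
      (\<integral>\<^sup>+w. (ennreal (?p w) + (\<integral>\<^sup>+s. indicator {0..t} s * ennreal (?q s w) \<partial>lborel)) * ?G w \<partial>lborel)"
    unfolding distrib_right by (rule nn_integral_add[symmetric]) measurable
  also have "\<dots> \<le> (\<integral>\<^sup>+w. ennreal (stat_dens i w) * ?G w \<partial>lborel)"
    by (intro nn_integral_mono mult_right_mono stat_dens_balance[OF i t]) simp
  finally show ?thesis unfolding A B .
qed

section \<open>Normalisation and invariance of the explicit density\<close>

definition stat_mass :: ennreal where
  "stat_mass = (\<Sum>i\<in>modes. \<integral>\<^sup>+u. ennreal (stat_dens i u) \<partial>lborel)"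

definition stat_measure :: "real \<Rightarrow> (real \<times> int) measure" where
  "stat_measure \<sigma> = distr (density (lborel \<Otimes>\<^sub>M count_space modes)
     (\<lambda>(u, i). ennreal (stat_dens i u) / stat_mass)) state_space (\<lambda>(u, i). (position \<sigma> u, i))"

lemma sets_stat_measure [simp]: "sets (stat_measure \<sigma>) = sets state_space"
  by (simp add: stat_measure_def)

lemma nn_integral_stat_measure:
  assumes [measurable]: "g \<in> borel_measurable state_space"
  shows "(\<integral>\<^sup>+z. g z \<partial>stat_measure \<sigma>) =
    (\<Sum>i\<in>modes. \<integral>\<^sup>+u. ennreal (stat_dens i u) * g (position \<sigma> u, i) \<partial>lborel) / stat_mass"
proof -
  have fin: "finite modes" by (simp add: modes_def)
  interpret C: sigma_finite_measure "count_space modes"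
    by (rule sigma_finite_measure_count_space_finite[OF fin])
  interpret pair_sigma_finite lborel "count_space modes" ..
  have [measurable]: "(\<lambda>w. stat_dens (snd w) (fst w)) \<in> borel_measurable (lborel \<Otimes>\<^sub>M count_space modes)"
    unfolding stat_dens_def offset_def by measurable
  have [measurable]: "(\<lambda>(u, i). (position \<sigma> u, i)) \<in> measurable (lborel \<Otimes>\<^sub>M count_space modes) state_space"
    unfolding case_prod_beta by measurable
  have "(\<integral>\<^sup>+z. g z \<partial>stat_measure \<sigma>) =
      (\<integral>\<^sup>+w. ennreal (stat_dens (snd w) (fst w)) / stat_mass * g (position \<sigma> (fst w), snd w)
        \<partial>(lborel \<Otimes>\<^sub>M count_space modes))"
    unfolding stat_measure_def
    by (subst nn_integral_distr, measurable, subst nn_integral_density) (auto simp: case_prod_beta)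
  also have "\<dots> = (\<integral>\<^sup>+i. \<integral>\<^sup>+u. ennreal (stat_dens i u) / stat_mass * g (position \<sigma> u, i) \<partial>lborel \<partial>count_space modes)"
    by (subst nn_integral_snd[symmetric]) (auto simp: case_prod_beta)
  also have "\<dots> = (\<Sum>i\<in>modes. \<integral>\<^sup>+u. ennreal (stat_dens i u) / stat_mass * g (position \<sigma> u, i) \<partial>lborel)"
    by (rule nn_integral_count_space_finite[OF fin])
  also have "\<dots> = (\<Sum>i\<in>modes. (\<integral>\<^sup>+u. ennreal (stat_dens i u) * g (position \<sigma> u, i) \<partial>lborel) / stat_mass)"
  proof (rule sum.cong)
    fix i assume [simp]: "i \<in> modes"
    show "(\<integral>\<^sup>+u. ennreal (stat_dens i u) / stat_mass * g (position \<sigma> u, i) \<partial>lborel) =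
        (\<integral>\<^sup>+u. ennreal (stat_dens i u) * g (position \<sigma> u, i) \<partial>lborel) / stat_mass"
      by (subst nn_integral_divide[symmetric]) (auto simp: divide_ennreal_def mult_ac)
  qed simp
  finally show ?thesis by (simp add: divide_ennreal_def sum_distrib_right)
qed

lemma stat_mass_pos: "stat_mass \<noteq> 0"
proof
  assume "stat_mass = 0"
  then have "(\<integral>\<^sup>+u. ennreal (stat_dens 1 u) \<partial>lborel) = 0" by (auto simp: stat_mass_def modes_def)
  then have "AE u in lborel. ennreal (stat_dens 1 u) = 0" by (subst (asm) nn_integral_0_iff_AE) auto
  moreover have pos: "0 < stat_dens 1 u" if "0 < u" for u
    using profile_pos[OF that] that pp_pos by (simp add: stat_dens_def offset_1 growth_def)
  ultimately have "AE u in lborel. \<not> (u \<in> {0<..<1 :: real})"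
  proof (elim eventually_mono)
    fix u assume "ennreal (stat_dens 1 u) = 0"
    then show "\<not> (u \<in> {0<..<1})" using pos[of u] by (auto simp: ennreal_eq_0_iff)
  qed
  then have "emeasure lborel {0<..<1 :: real} = 0"
    by (rule AE_iff_measurable[THEN iffD1, rotated 2]) auto
  then show False by simp
qed

text \<open>With exponents \<open>a\<close> and \<open>b\<close> of the profile, the density is
  bounded near 0 by a multiple of \<open>u powr (a - 1)\<close>, integrable as \<open>a\<close> is
  positive. At infinity, that is near the origin of the line, the bound is
  \<open>u powr (a + b - 1)\<close>, integrable because \<open>a + b\<close> is half of
  \<open>lp / pp + lm / pm\<close> and hence negative.\<close>

lemma stat_mass_finite:
  assumes case1: "lp / pp < - (lm / pm)"
  shows "stat_mass \<noteq> \<top>"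
proof -
  define a where "a = lp / (2 * pp)"
  define b where "b = lm / (2 * pm)"
  have a: "0 < a" using pp_pos lp_pos by (simp add: a_def)
  have b: "b < 0" using pm_neg lm_pos by (simp add: b_def divide_pos_neg)
  have ab: "a + b < 0"
    using case1 by (simp add: a_def b_def)
  define f where "f u = u powr (a - 1)" for u :: real
  define h where "h u = u powr (a + b - 1)" for u :: real
  have If: "(\<integral>\<^sup>+u. ennreal (indicator {0..1} u * f u) \<partial>lborel) = ennreal (1 powr (a - 1 + 1) / (a - 1 + 1))"
    using has_integral_powr_from_0[of "a - 1" 1] a
    by (intro nn_integral_has_integral_lebesgue) (auto simp: f_def)
  have Ih: "(\<integral>\<^sup>+u. ennreal (indicator {1..} u * h u) \<partial>lborel) = ennreal (- (1 powr (a + b - 1 + 1)) / (a + b - 1 + 1))"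
    using has_integral_powr_to_inf[of "a + b - 1" 1] ab
    by (intro nn_integral_has_integral_lebesgue) (auto simp: h_def)
  have "(\<integral>\<^sup>+u. ennreal (stat_dens i u) \<partial>lborel) < \<top>" if i: "i \<in> modes" for i
  proof -
    let ?K = "1 / (2 * \<bar>growth i\<bar>)"
    have K: "0 < ?K" by simp
    have "ennreal (stat_dens i u) \<le> ennreal ?K * (ennreal (indicator {0..1} u * f u) + ennreal (indicator {1..} u * h u))" for u
    proof (cases "0 < u")
      case True
      have c: "1 < u + offset (- 1)" using True offset_minus_1 by linarith
      have "stat_dens i u = ?K * (u powr a * (u + offset (- 1)) powr b / (u + offset i))"
        using True by (simp add: stat_dens_def profile_def a_def b_def)
      also have "\<dots> \<le> ?K * (u powr a * (u + offset (- 1)) powr b / u)"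
        using True K offset_nonneg[OF i] by (intro mult_left_mono divide_left_mono) auto
      also have "u powr a * (u + offset (- 1)) powr b / u = f u * (u + offset (- 1)) powr b"
        using True by (simp add: f_def powr_diff)
      finally have le: "stat_dens i u \<le> ?K * (f u * (u + offset (- 1)) powr b)" .
      have "f u * (u + offset (- 1)) powr b \<le> indicator {0..1} u * f u + indicator {1..} u * h u"
      proof (cases "u \<le> 1")
        case True
        have "(u + offset (- 1)) powr b \<le> 1" using powr_mono[of b 0 "u + offset (- 1)"] b c by simp
        then have "f u * (u + offset (- 1)) powr b \<le> f u" by (simp add: f_def mult_left_le)
        moreover have "0 \<le> indicator {1..} u * h u" by (simp add: h_def)
        ultimately show ?thesis using True \<open>0 < u\<close> by simp
      next
        case False
        have "(u + offset (- 1)) powr b \<le> u powr b"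
          using b False offset_minus_1 by (intro powr_mono2') auto
        then have "f u * (u + offset (- 1)) powr b \<le> f u * u powr b"
          by (intro mult_left_mono) (auto simp: f_def)
        also have "\<dots> = h u" by (simp add: f_def h_def powr_add[symmetric] algebra_simps)
        finally show ?thesis using False by simp
      qed
      then have "?K * (f u * (u + offset (- 1)) powr b) \<le> ?K * (indicator {0..1} u * f u + indicator {1..} u * h u)"
        using K by (intro mult_left_mono) auto
      with le have "stat_dens i u \<le> ?K * (indicator {0..1} u * f u + indicator {1..} u * h u)" by linarith
      then have "ennreal (stat_dens i u) \<le> ennreal (?K * (indicator {0..1} u * f u + indicator {1..} u * h u))"
        by (rule ennreal_leI)
      also have "\<dots> = ennreal ?K * (ennreal (indicator {0..1} u * f u) + ennreal (indicator {1..} u * h u))"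
        using K by (subst ennreal_mult') (auto simp: f_def h_def)
      finally show ?thesis .
    qed (simp add: stat_dens_nonpos)
    then have "(\<integral>\<^sup>+u. ennreal (stat_dens i u) \<partial>lborel) \<le>
        (\<integral>\<^sup>+u. ennreal ?K * (ennreal (indicator {0..1} u * f u) + ennreal (indicator {1..} u * h u)) \<partial>lborel)"
      by (intro nn_integral_mono)
    also have "\<dots> = ennreal ?K * ((\<integral>\<^sup>+u. ennreal (indicator {0..1} u * f u) \<partial>lborel) + (\<integral>\<^sup>+u. ennreal (indicator {1..} u * h u) \<partial>lborel))"
      by (simp add: nn_integral_cmult nn_integral_add f_def h_def)
    also have "\<dots> < \<top>" unfolding If Ih by (simp add: ennreal_mult_less_top)
    finally show ?thesis .
  qed
  from this[of 1] this[of "- 1"] show ?thesis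
    unfolding stat_mass_def by (auto simp: modes_def)
qed

end

context cubic_semigroup
begin

lemma prob_space_stat_measure:
  assumes case1: "lp / pp < - (lm / pm)"
  shows "prob_space (stat_measure \<sigma>)"
proof (rule prob_spaceI)
  have "emeasure (stat_measure \<sigma>) (space (stat_measure \<sigma>)) = (\<integral>\<^sup>+z. 1 \<partial>stat_measure \<sigma>)"
    by simp
  also have "\<dots> = stat_mass / stat_mass"
    by (subst nn_integral_stat_measure) (auto simp: stat_mass_def)
  also have "\<dots> = 1"
    using stat_mass_pos stat_mass_finite[OF case1] by (intro ennreal_divide_self) (auto simp: less_top)
  finally show "emeasure (stat_measure \<sigma>) (space (stat_measure \<sigma>)) = 1" .
qed

lemma emeasure_stat_measure_region:
  assumes case1: "lp / pp < - (lm / pm)" and sg: "\<sigma> \<in> {- 1, 1}"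
  shows "emeasure (stat_measure \<sigma>) (region \<sigma>) = 1"
proof -
  have "emeasure (stat_measure \<sigma>) (region \<sigma>) = (\<integral>\<^sup>+z. indicator (region \<sigma>) z \<partial>stat_measure \<sigma>)"
    by simp
  also have "\<dots> = (\<integral>\<^sup>+z. 1 \<partial>stat_measure \<sigma>)"
  proof -
    have "ennreal (stat_dens i u) * indicator (region \<sigma>) (position \<sigma> u, i) = ennreal (stat_dens i u)"
      if "i \<in> modes" for i u
      using sg that pp_pos by (cases "0 < u") (auto simp: region_def position_def sgn_mult stat_dens_nonpos)
    moreover have "(indicator (region \<sigma>) :: _ \<Rightarrow> ennreal) \<in> borel_measurable state_space" by simp
    ultimately show ?thesis
      by (simp only: nn_integral_stat_measure[of "indicator (region \<sigma>)"]
          nn_integral_stat_measure[of "\<lambda>_. 1", OF borel_measurable_const] mult_1_right cong: sum.cong)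
  qed
  also have "\<dots> = 1"
    using prob_space.emeasure_space_1[OF prob_space_stat_measure[OF case1]] by simp
  finally show ?thesis .
qed

lemma invariant_stat_measure:
  assumes case1: "lp / pp < - (lm / pm)" and sg: "\<sigma> \<in> {- 1, 1}"
  shows "invariant_prob P (stat_measure \<sigma>)"
proof (rule invariant_probI[OF prob_space_stat_measure[OF case1] sets_stat_measure
      transition_le_of_balance[OF prob_space_stat_measure[OF case1] sets_stat_measure]])
  fix t :: real and g :: "real \<times> int \<Rightarrow> ennreal"
  assume t: "0 \<le> t" and g[measurable]: "g \<in> borel_measurable state_space"
  have stay_m: "stay t g \<in> borel_measurable state_space"
  proof -
    have "(\<lambda>z. stay t g (fst z, snd z)) \<in> borel_measurable state_space" by measurable
    then show ?thesis by simp
  qed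
  have sw_m: "switch (stay s g) \<in> borel_measurable state_space" for s
    unfolding switch_def by measurable
  let ?A = "\<lambda>i. \<integral>\<^sup>+u. ennreal (stat_dens i u) * stay t g (position \<sigma> u, i) \<partial>lborel"
  let ?B = "\<lambda>s i. \<integral>\<^sup>+u. ennreal (stat_dens i u) * switch (stay s g) (position \<sigma> u, i) \<partial>lborel"
  have mB: "(\<lambda>s. ?B s i) \<in> borel_measurable borel" if "i \<in> modes" for i
  proof -
    have [simp]: "i \<in> modes" by fact
    have "(\<lambda>w. ennreal (stat_dens i (snd w)) * switch (stay (fst w) g) (position \<sigma> (snd w), i)) \<in> borel_measurable (borel \<Otimes>\<^sub>M lborel)"
      unfolding switch_def fst_conv snd_conv by measurable
    then show ?thesis
      by (intro lborel.borel_measurable_nn_integral[where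
            f = "\<lambda>s u. ennreal (stat_dens i u) * switch (stay s g) (position \<sigma> u, i)"])
        (simp add: case_prod_beta)
  qed
  have mI: "(\<lambda>s. indicator {0..t} s * ?B s i) \<in> borel_measurable lborel" if "i \<in> modes" for i
    using mB[OF that] by simp
  have "(\<integral>\<^sup>+s. indicator {0..t} s * (\<integral>\<^sup>+z. switch (stay s g) z \<partial>stat_measure \<sigma>) \<partial>lborel) =
      (\<integral>\<^sup>+s. (\<Sum>i\<in>modes. indicator {0..t} s * ?B s i) / stat_mass \<partial>lborel)"
    unfolding nn_integral_stat_measure[OF sw_m] divide_ennreal_def
    by (simp only: mult.assoc[symmetric] sum_distrib_left)
  also have "\<dots> = (\<integral>\<^sup>+s. (\<Sum>i\<in>modes. indicator {0..t} s * ?B s i) \<partial>lborel) / stat_mass"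
    by (intro nn_integral_divide borel_measurable_sum mI)
  also have "(\<integral>\<^sup>+s. (\<Sum>i\<in>modes. indicator {0..t} s * ?B s i) \<partial>lborel) = (\<Sum>i\<in>modes. \<integral>\<^sup>+s. indicator {0..t} s * ?B s i \<partial>lborel)"
    by (intro nn_integral_sum mI)
  \<comment> \<open>Mass that enters mode \<open>i\<close> sits in mode \<open>- i\<close> before
    the switch; the reindexing pairs it with the mass that stayed in \<open>i\<close>.\<close>
  also have "\<dots> = (\<Sum>i\<in>modes. \<integral>\<^sup>+s. indicator {0..t} s * ?B s (- i) \<partial>lborel)"
    by (rule sum.reindex_bij_witness[of _ uminus uminus]) auto
  finally have "(\<integral>\<^sup>+z. stay t g z \<partial>stat_measure \<sigma>) + (\<integral>\<^sup>+s. indicator {0..t} s * (\<integral>\<^sup>+z. switch (stay s g) z \<partial>stat_measure \<sigma>) \<partial>lborel) =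
      (\<Sum>i\<in>modes. ?A i + (\<integral>\<^sup>+s. indicator {0..t} s * ?B s (- i) \<partial>lborel)) / stat_mass"
    by (simp add: nn_integral_stat_measure[OF stay_m] sum.distrib divide_ennreal_def distrib_right)
  also have "\<dots> \<le> (\<Sum>i\<in>modes. \<integral>\<^sup>+u. ennreal (stat_dens i u) * g (position \<sigma> u, i) \<partial>lborel) / stat_mass"
    by (intro divide_right_mono_ennreal sum_mono stat_dens_mode_balance[OF t sg _ g])
  also have "\<dots> = (\<integral>\<^sup>+z. g z \<partial>stat_measure \<sigma>)" by (simp add: nn_integral_stat_measure[OF g])
  finally show "(\<integral>\<^sup>+z. stay t g z \<partial>stat_measure \<sigma>) + (\<integral>\<^sup>+s. indicator {0..t} s * (\<integral>\<^sup>+z. switch (stay s g) z \<partial>stat_measure \<sigma>) \<partial>lborel)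
      \<le> (\<integral>\<^sup>+z. g z \<partial>stat_measure \<sigma>)" .
qed auto

end

section \<open>Contraction and uniqueness\<close>

context cubic_switching
begin

text \<open>\<open>\<psi>\<close> is a positive supersolution for the generator of the mode chain
  with the potential \<open>- 2 * \<theta> * growth i\<close>, with decay rate
  \<open>\<kappa>\<close>; by Feynman-Kac this controls exponential moments of the integrated
  growth. To first order in \<open>\<theta>\<close> the principal eigenvalue is
  \<open>- 2 * \<theta>\<close> times the mean growth, which \<open>case1\<close> makes
  positive.\<close>

lemma contraction_weights:
  assumes case1: "lp / pp < - (lm / pm)"
  obtains \<theta> \<kappa> :: real and \<psi> :: "int \<Rightarrow> real"
  where "0 < \<theta>" "\<theta> \<le> 1" "0 < \<kappa>" "\<And>i. 1 \<le> \<psi> i"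
    "\<And>i. i \<in> modes \<Longrightarrow> rate i * \<psi> (- i) \<le> (rate i + 2 * \<theta> * growth i - \<kappa>) * \<psi> i"
proof -
  define q where "q = - pm"
  have q: "0 < q" using pm_neg by (simp add: q_def)
  have "lp / pp < lm / q" using case1 by (simp add: q_def)
  then have "lp * q < lm * pp" using pp_pos q by (simp add: field_simps)
  \<comment> \<open>The stationary mean growth rate multiplied by \<open>lm + lp\<close>.\<close>
  define \<delta> where "\<delta> = lm * pp - lp * q"
  have delta: "0 < \<delta>" "\<delta> \<le> lm * pp"
    using \<open>lp * q < lm * pp\<close> lp_pos q by (auto simp: \<delta>_def)
  \<comment> \<open>Small enough for the second-order term \<open>A * B\<close> to consume at most
    half of the first-order gain \<open>2 * \<theta> * \<delta>\<close>.\<close>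
  define \<theta> where "\<theta> = min 1 (\<delta> / (4 * pp * q))"
  have th: "0 < \<theta>" "\<theta> \<le> 1" using delta pp_pos q by (auto simp: \<theta>_def)
  have "\<theta> \<le> \<delta> / (4 * pp * q)" by (simp add: \<theta>_def)
  then have th2: "2 * \<theta> * pp * q \<le> \<delta> / 2" using pp_pos q by (simp add: field_simps)
  define A where "A = 2 * \<theta> * pp"
  define B where "B = 2 * \<theta> * q"
  have A: "0 < A" using th pp_pos by (simp add: A_def)
  \<comment> \<open>The remaining gain \<open>\<theta> * \<delta>\<close> is spent on the terms
    linear in \<open>\<kappa>\<close> that have a negative sign in \<open>main\<close>.\<close>
  define \<kappa> where "\<kappa> = \<theta> * \<delta> / (lm + lp + A)"
  have den: "0 < lm + lp + A" using lm_pos lp_pos A by simp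
  have kap: "0 < \<kappa>" using th delta den by (simp add: \<kappa>_def)
  have kap_eq: "\<kappa> * (lm + lp + A) = \<theta> * \<delta>" using den by (simp add: \<kappa>_def)
  have kapA: "\<kappa> \<le> A"
  proof -
    have "\<kappa> \<le> \<theta> * \<delta> / lm"
      unfolding \<kappa>_def using th delta lm_pos lp_pos A by (intro divide_left_mono) auto
    also have "\<dots> \<le> \<theta> * (lm * pp) / lm"
      using th delta lm_pos by (intro divide_right_mono mult_left_mono) auto
    also have "\<dots> \<le> A" using th lm_pos pp_pos by (simp add: A_def)
    finally show ?thesis .
  qed
  \<comment> \<open>The value in mode \<open>-1\<close> gives equality in the inequality for mode
    \<open>1\<close>; the inequality for mode \<open>-1\<close> then is \<open>main\<close>.\<close>
  define \<psi> where "\<psi> i = (if i = 1 then 1 else (lp + A - \<kappa>) / lp)" for i :: int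
  have psi: "1 \<le> \<psi> i" for i using kapA lp_pos by (simp add: \<psi>_def)
  have main: "lm * lp \<le> (lm - B - \<kappa>) * (lp + A - \<kappa>)"
  proof -
    have "lm * A - B * lp - A * B = 2 * \<theta> * (\<delta> - 2 * \<theta> * pp * q)"
      by (simp add: A_def B_def \<delta>_def algebra_simps)
    also have "2 * \<theta> * (\<delta> - 2 * \<theta> * pp * q) \<ge> 2 * \<theta> * (\<delta> / 2)"
      using th th2 by (intro mult_left_mono) auto
    finally have "\<theta> * \<delta> \<le> lm * A - B * lp - A * B" by simp
    moreover have "0 \<le> B * \<kappa>" using th q kap by (simp add: B_def)
    moreover have "(lm - B - \<kappa>) * (lp + A - \<kappa>) =
        lm * lp + (lm * A - B * lp - A * B) - \<kappa> * (lm + lp + A) + B * \<kappa> + \<kappa> * \<kappa>"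
      by (simp add: algebra_simps)
    moreover have "0 \<le> \<kappa> * \<kappa>" by simp
    ultimately show ?thesis unfolding kap_eq by linarith
  qed
  have "rate i * \<psi> (- i) \<le> (rate i + 2 * \<theta> * growth i - \<kappa>) * \<psi> i" if i: "i \<in> modes" for i
  proof -
    consider (minus) "i = - 1" | (plus) "i = 1" using i by (auto simp: modes_def)
    then show ?thesis
    proof cases
      case minus
      have "lm * lp / lp \<le> (lm - B - \<kappa>) * (lp + A - \<kappa>) / lp"
        using main lp_pos by (intro divide_right_mono) auto
      then show ?thesis using minus lp_pos by (simp add: \<psi>_def switch_rate_def growth_def B_def q_def)
    next
      case plus
      then show ?thesis using lp_pos by (simp add: \<psi>_def switch_rate_def growth_def A_def)
    qed
  qed
  then show ?thesis using that th kap psi by blast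
qed

text \<open>Synchronous coupling inside the expansion: both starting points see the same jump times,
  so the partial sums can be compared step by step. The distance in the coordinate
  \<open>1 / x\<^sup>2\<close> changes by the same factor for every pair of points, and the weighted
  error \<open>V\<close> is a supersolution by \<open>rates\<close>. An additive error avoids
  subtraction in \<open>ennreal\<close>.\<close>

lemma transition_holder:
  fixes \<theta> \<kappa> L :: real and \<psi> :: "int \<Rightarrow> real" and \<sigma> :: real
  assumes psi: "\<And>i. 1 \<le> \<psi> i" and L: "0 \<le> L"
    and rates: "\<And>i. i \<in> modes \<Longrightarrow> rate i * \<psi> (- i) \<le> (rate i + 2 * \<theta> * growth i - \<kappa>) * \<psi> i"
    and sg: "\<sigma> \<noteq> 0" and g[measurable]: "g \<in> borel_measurable state_space"
    and holder: "\<And>i x x'. i \<in> modes \<Longrightarrow> sgn x = \<sigma> \<Longrightarrow> sgn x' = \<sigma> \<Longrightarrow>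
      g (x, i) \<le> g (x', i) + ennreal (L * \<psi> i * \<bar>1 / x\<^sup>2 - 1 / x'\<^sup>2\<bar> powr \<theta>)"
    and t: "0 \<le> t" and i: "i \<in> modes" and x: "sgn x = \<sigma>" "sgn x' = \<sigma>"
  shows "transition t g (x, i) \<le> transition t g (x', i) +
    ennreal (L * \<psi> i * \<bar>1 / x\<^sup>2 - 1 / x'\<^sup>2\<bar> powr \<theta> * exp (- \<kappa> * t))"
proof -
  define V where "V s d i = ennreal (if s \<le> t then L * \<psi> i * d powr \<theta> * exp (- \<kappa> * (t - s)) else 0)" for s d i
  let ?d = "\<lambda>x x'. \<bar>1 / x\<^sup>2 - 1 / x'\<^sup>2\<bar>"
  have d_flow: "?d (flow j \<tau> y) (flow j \<tau> y') = exp (- 2 * growth j * \<tau>) * ?d y y'"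
    if "0 \<le> \<tau>" "sgn y = \<sigma>" "sgn y' = \<sigma>" for j \<tau> y y'
  proof -
    have "y \<noteq> 0" "y' \<noteq> 0" using that sg by auto
    then have "1 / (flow j \<tau> y)\<^sup>2 - 1 / (flow j \<tau> y')\<^sup>2 = exp (- 2 * growth j * \<tau>) * (1 / y\<^sup>2 - 1 / y'\<^sup>2)"
      using that by (simp add: inverse_square_flow algebra_simps)
    then show ?thesis by (simp add: abs_mult)
  qed
  let ?W = "\<lambda>N w. \<Sum>n<N. (jump_op ^^ n) (no_jump t g) w"
  have "?W N (s, y, j) \<le> ?W N (s, y', j) + V s (?d y y') j"
    if "j \<in> modes" "sgn y = \<sigma>" "sgn y' = \<sigma>" for N s y y' j
    using that
  proof (induction N arbitrary: s y y' j)
    case (Suc N)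
    note j = Suc.prems(1) and y = Suc.prems(2,3)
    let ?V = "\<lambda>\<tau>. V (s + \<tau>) (?d (flow j \<tau> y) (flow j \<tau> y')) (- j)"
    have [simp]: "j \<in> modes" by (rule j)
    have [measurable]: "(\<lambda>\<tau>. flow j \<tau> x) \<in> borel_measurable borel" for x by simp
    have [measurable]: "?V \<in> borel_measurable borel"
      unfolding V_def by measurable
    have mW[measurable]: "?W N \<in> borel_measurable space_time" by measurable
    have [measurable]: "(\<lambda>\<tau>. ?W N (s + \<tau>, flow j \<tau> y', - j)) \<in> borel_measurable borel"
      by (rule measurable_on_space_time[OF mW]) simp_all
    have jump: "jump_op (?W N) (s, y, j) \<le> jump_op (?W N) (s, y', j) +
        (\<integral>\<^sup>+\<tau>. ennreal (exponential_density (rate j) \<tau>) * ?V \<tau> \<partial>lborel)"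
    proof -
      have J: "jump_op h (s, x, i) =
          (\<integral>\<^sup>+\<tau>. ennreal (exponential_density (rate i) \<tau>) * h (s + \<tau>, flow i \<tau> x, - i) \<partial>lborel)" for h x i
        by (simp add: jump_op_def)
      have "jump_op (?W N) (s, y, j) \<le> (\<integral>\<^sup>+\<tau>. ennreal (exponential_density (rate j) \<tau>) * ?W N (s + \<tau>, flow j \<tau> y', - j) +
          ennreal (exponential_density (rate j) \<tau>) * ?V \<tau> \<partial>lborel)"
        unfolding J distrib_left[symmetric]
      proof (rule nn_integral_mono)
        fix \<tau> :: real
        show "ennreal (exponential_density (rate j) \<tau>) * ?W N (s + \<tau>, flow j \<tau> y, - j) \<le>
          ennreal (exponential_density (rate j) \<tau>) * (?W N (s + \<tau>, flow j \<tau> y', - j) + ?V \<tau>)"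
        proof (cases "\<tau> < 0")
          case False
          then show ?thesis using y j by (intro mult_left_mono Suc.IH) (auto simp: sgn_flow)
        qed (simp add: exponential_density_def)
      qed
      also have "\<dots> = jump_op (?W N) (s, y', j) + (\<integral>\<^sup>+\<tau>. ennreal (exponential_density (rate j) \<tau>) * ?V \<tau> \<partial>lborel)"
        unfolding J by (rule nn_integral_add) measurable
      finally show ?thesis .
    qed
    have "?W (Suc N) (s, y, j) \<le> ?W (Suc N) (s, y', j) + V s (?d y y') j"
    proof (cases "s \<le> t")
      case False
      have "(\<integral>\<^sup>+\<tau>. ennreal (exponential_density (rate j) \<tau>) * ?V \<tau> \<partial>lborel) = (\<integral>\<^sup>+\<tau>. 0 \<partial>(lborel :: real measure))"
        using False by (intro nn_integral_cong) (auto simp: V_def exponential_density_def)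
      then show ?thesis
        using jump False j
        by (subst (1 2) partial_sum_Suc) (auto simp: no_jump_def intro: order_trans)
    next
      case True
      define r where "r = t - s"
      have r: "0 \<le> r" using True by (simp add: r_def)
      define D where "D = ?d y y'"
      have D: "0 \<le> D" by (simp add: D_def)
      define c where "c = rate j + 2 * \<theta> * growth j - \<kappa>"
      \<comment> \<open>The error after flowing for time \<open>\<tau>\<close>, times the
        probability of no jump so far. By \<open>rates\<close> its decrease covers the error that is
        taken over into the other mode by a jump.\<close>
      define k where "k \<tau> = L * D powr \<theta> * exp (- \<kappa> * r) * \<psi> j * exp (- c * \<tau>)" for \<tau>
      have pw: "(exp (- 2 * growth j * \<tau>) * D) powr \<theta> = exp (- 2 * \<theta> * growth j * \<tau>) * D powr \<theta>" for \<tau>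
        using D by (simp add: powr_mult exp_powr_real mult_ac)
      have "ennreal (k r) + (\<integral>\<^sup>+\<tau>. ennreal (exponential_density (rate j) \<tau>) * ?V \<tau> \<partial>lborel) \<le> ennreal (k 0)"
      proof (rule exponential_integral_le_FTC[where k' = "\<lambda>\<tau>. - c * k \<tau>" and
            V = "\<lambda>\<tau>. L * D powr \<theta> * exp (- \<kappa> * r) * \<psi> (- j) * exp ((\<kappa> - 2 * \<theta> * growth j) * \<tau>)"])
        show "continuous_on {0..r} k" unfolding k_def by (intro continuous_intros)
        show "(k has_real_derivative - c * k \<tau>) (at \<tau>)" for \<tau>
          unfolding k_def by (auto intro!: derivative_eq_intros)
        show "rate j * exp (- rate j * \<tau>) *
            (L * D powr \<theta> * exp (- \<kappa> * r) * \<psi> (- j) * exp ((\<kappa> - 2 * \<theta> * growth j) * \<tau>)) \<le> - (- c * k \<tau>)" for \<tau>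
        proof -
          have "exp (- rate j * \<tau>) * exp ((\<kappa> - 2 * \<theta> * growth j) * \<tau>) = exp (- c * \<tau>)"
            by (simp add: c_def algebra_simps flip: exp_add)
          then have "rate j * exp (- rate j * \<tau>) *
            (L * D powr \<theta> * exp (- \<kappa> * r) * \<psi> (- j) * exp ((\<kappa> - 2 * \<theta> * growth j) * \<tau>)) =
            (L * D powr \<theta> * exp (- \<kappa> * r) * exp (- c * \<tau>)) * (rate j * \<psi> (- j))"
            by (simp add: mult_ac)
          also have "\<dots> \<le> (L * D powr \<theta> * exp (- \<kappa> * r) * exp (- c * \<tau>)) * (c * \<psi> j)"
            using rates[OF j] L by (intro mult_left_mono) (auto simp: c_def)
          finally show ?thesis by (simp add: k_def mult_ac)
        qed
        show "0 \<le> L * D powr \<theta> * exp (- \<kappa> * r) * \<psi> (- j) * exp ((\<kappa> - 2 * \<theta> * growth j) * \<tau>)" for \<tau>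
          using L psi[of "- j"] by (intro mult_nonneg_nonneg) auto
        show "0 \<le> k r" unfolding k_def using L psi[of j] by (intro mult_nonneg_nonneg) auto
        show "?V \<tau> = ennreal (L * D powr \<theta> * exp (- \<kappa> * r) * \<psi> (- j) * exp ((\<kappa> - 2 * \<theta> * growth j) * \<tau>))"
          if "0 \<le> \<tau>" "\<tau> \<le> r" for \<tau>
        proof -
          have e: "exp (- 2 * \<theta> * growth j * \<tau>) * exp (- \<kappa> * (t - (s + \<tau>))) =
              exp (- \<kappa> * r) * exp ((\<kappa> - 2 * \<theta> * growth j) * \<tau>)"
            by (simp add: r_def algebra_simps flip: exp_add)
          have "?V \<tau> = ennreal (L * \<psi> (- j) * D powr \<theta> * (exp (- 2 * \<theta> * growth j * \<tau>) * exp (- \<kappa> * (t - (s + \<tau>)))))"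
            unfolding V_def d_flow[OF that(1) y] D_def[symmetric] pw
            using that by (simp add: r_def mult_ac)
          then show ?thesis unfolding e by (simp add: mult_ac)
        qed
        show "?V \<tau> = 0" if "r < \<tau>" for \<tau> using that by (simp add: V_def r_def)
      qed (rule r)
      moreover have "no_jump t g (s, y, j) \<le> no_jump t g (s, y', j) + ennreal (k r)"
      proof -
        let ?e = "ennreal (exp (- rate j * r))"
        have "g (flow j r y, j) \<le> g (flow j r y', j) + ennreal (L * \<psi> j * (exp (- 2 * \<theta> * growth j * r) * D powr \<theta>))"
          using holder[OF j, of "flow j r y" "flow j r y'"] y r
          unfolding d_flow[OF r y] D_def[symmetric] pw by (simp only: sgn_flow)
        then have "?e * g (flow j r y, j) \<le> ?e * (g (flow j r y', j) + ennreal (L * \<psi> j * (exp (- 2 * \<theta> * growth j * r) * D powr \<theta>)))"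
          by (rule mult_left_mono) simp
        also have "\<dots> = ?e * g (flow j r y', j) + ennreal (exp (- rate j * r) * (L * \<psi> j * (exp (- 2 * \<theta> * growth j * r) * D powr \<theta>)))"
          by (simp add: distrib_left ennreal_mult')
        also have "exp (- rate j * r) * (L * \<psi> j * (exp (- 2 * \<theta> * growth j * r) * D powr \<theta>)) = k r"
        proof -
          have e: "exp (- rate j * r) * exp (- 2 * \<theta> * growth j * r) = exp (- \<kappa> * r) * exp (- c * r)"
            by (simp add: c_def algebra_simps flip: exp_add)
          have "exp (- rate j * r) * (L * \<psi> j * (exp (- 2 * \<theta> * growth j * r) * D powr \<theta>)) =
              L * \<psi> j * D powr \<theta> * (exp (- rate j * r) * exp (- 2 * \<theta> * growth j * r))"
            by (simp only: mult_ac)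
          then show ?thesis unfolding e k_def by (simp only: mult_ac)
        qed
        finally show ?thesis using True by (simp add: no_jump_def r_def)
      qed
      moreover have "k 0 = L * \<psi> j * D powr \<theta> * exp (- \<kappa> * (t - s))" by (simp add: k_def r_def)
      moreover have "?W (Suc N) (s, y, j) \<le> no_jump t g (s, y, j) + (jump_op (?W N) (s, y', j) +
        (\<integral>\<^sup>+\<tau>. ennreal (exponential_density (rate j) \<tau>) * ?V \<tau> \<partial>lborel))"
        using jump j by (subst partial_sum_Suc) (auto intro: add_left_mono)
      ultimately have "?W (Suc N) (s, y, j) \<le> (no_jump t g (s, y', j) + ennreal (k r)) + (jump_op (?W N) (s, y', j) +
        (\<integral>\<^sup>+\<tau>. ennreal (exponential_density (rate j) \<tau>) * ?V \<tau> \<partial>lborel))"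
        by (meson add_right_mono order_trans)
      also have "\<dots> = (no_jump t g (s, y', j) + jump_op (?W N) (s, y', j)) +
          (ennreal (k r) + (\<integral>\<^sup>+\<tau>. ennreal (exponential_density (rate j) \<tau>) * ?V \<tau> \<partial>lborel))"
        by (simp only: add_ac)
      also have "\<dots> \<le> (no_jump t g (s, y', j) + jump_op (?W N) (s, y', j)) + ennreal (k 0)"
        by (rule add_left_mono) fact
      also have "\<dots> = ?W (Suc N) (s, y', j) + V s D j"
        using j True by (subst partial_sum_Suc) (auto simp: V_def k_def r_def mult_ac)
      finally show ?thesis by (simp add: D_def)
    qed
    then show ?case .
  qed simp
  from this[OF i x] have le: "?W N (0, x, i) \<le> ?W N (0, x', i) + V 0 (?d x x') i" for N
    by blast
  have "?W N (0, x, i) \<le> transition t g (x', i) + V 0 (?d x x') i" for N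
    by (rule order_trans[OF le add_right_mono[OF partial_sum_le_transition]])
  then have "transition t g (x, i) \<le> transition t g (x', i) + V 0 (?d x x') i"
    by (rule transition_le_partial)
  then show ?thesis using t by (simp add: V_def)
qed

end

context cubic_semigroup
begin

lemma transition_le_1:
  assumes t: "0 \<le> t" and z: "z \<in> space state_space" and g: "g \<in> borel_measurable state_space"
    and le: "\<And>z. g z \<le> 1"
  shows "transition t g z \<le> 1"
proof -
  interpret prob_space "P t z" by (rule prob_space_P[OF t z])
  have "transition t g z = (\<integral>\<^sup>+w. g w \<partial>P t z)" by (rule nn_integral_P[OF t z g, symmetric])
  also have "\<dots> \<le> (\<integral>\<^sup>+w. 1 \<partial>P t z)" by (intro nn_integral_mono le)
  finally show ?thesis by (simp add: emeasure_space_1)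
qed

text \<open>Both measures give each mode the same weight, so they can be coupled conditionally on the
  mode; running the coupled starting points with the same switching path, their distance in the
  coordinate \<open>1 / x\<^sup>2\<close> contracts.\<close>

lemma invariant_nn_integral_le:
  fixes L \<theta> \<kappa> :: real and \<psi> :: "int \<Rightarrow> real"
  assumes psi: "\<And>i. 1 \<le> \<psi> i" and L: "0 \<le> L" and kap: "0 < \<kappa>"
    and rates: "\<And>i. i \<in> modes \<Longrightarrow> rate i * \<psi> (- i) \<le> (rate i + 2 * \<theta> * growth i - \<kappa>) * \<psi> i"
    and sg: "\<sigma> \<noteq> 0" and g[measurable]: "g \<in> borel_measurable state_space" and g1: "\<And>z. g z \<le> 1"
    and holder: "\<And>i x x'. i \<in> modes \<Longrightarrow> sgn x = \<sigma> \<Longrightarrow> sgn x' = \<sigma> \<Longrightarrow>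
      g (x, i) \<le> g (x', i) + ennreal (L * \<psi> i * \<bar>1 / x\<^sup>2 - 1 / x'\<^sup>2\<bar> powr \<theta>)"
    and inv: "invariant_prob P \<nu>" "invariant_prob P \<nu>'"
    and reg: "emeasure \<nu> (region \<sigma>) = 1" "emeasure \<nu>' (region \<sigma>) = 1"
  shows "(\<integral>\<^sup>+z. g z \<partial>\<nu>) \<le> (\<integral>\<^sup>+z. g z \<partial>\<nu>')"
proof -
  interpret N: prob_space \<nu> by (rule invariant_prob_space[OF inv(1)])
  interpret N': prob_space \<nu>' by (rule invariant_prob_space[OF inv(2)])
  interpret pair_sigma_finite \<nu> \<nu>' ..
  have s: "sets \<nu> = sets state_space" "sets \<nu>' = sets state_space"
    "space \<nu> = UNIV \<times> modes" "space \<nu>' = UNIV \<times> modes"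
    using invariant_sets inv invariant_space by auto
  have [measurable]: "fst \<in> borel_measurable \<nu>" "snd \<in> measurable \<nu> (count_space modes)"
    "fst \<in> borel_measurable \<nu>'" "snd \<in> measurable \<nu>' (count_space modes)"
    unfolding measurable_cong_sets[OF s(1) refl] measurable_cong_sets[OF s(2) refl]
    by (rule measurable_state_projections)+
  have AEr: "AE z in \<nu>. z \<in> region \<sigma>" "AE z in \<nu>'. z \<in> region \<sigma>"
    using reg s by (auto intro!: N.AE_prob_1 N'.AE_prob_1 simp: N.emeasure_eq_measure N'.emeasure_eq_measure)
  define w where "w i = (if i = - 1 then lp / (lp + lm) else lm / (lp + lm))" for i :: int
  have w: "0 < w i" for i using lm_pos lp_pos by (simp add: w_def)
  have ew: "emeasure \<nu> (UNIV \<times> {i}) = ennreal (w i)" "emeasure \<nu>' (UNIV \<times> {i}) = ennreal (w i)"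
    if "i \<in> modes" for i
    using that invariant_mode_weights[OF inv(1)] invariant_mode_weights[OF inv(2)]
    by (auto simp: modes_def w_def)
  \<comment> \<open>The density, with respect to the product measure, of the coupling that draws
    both points independently given a common mode; \<open>K1\<close> and \<open>K2\<close> say that
    it has the right marginals.\<close>
  define K where "K z z' = (if snd z = snd z' then ennreal (1 / w (snd z)) else 0)" for z z' :: "real \<times> int"
  have KM: "(\<lambda>p. K (fst p) (snd p)) \<in> borel_measurable (\<nu> \<Otimes>\<^sub>M \<nu>')"
  proof -
    have mw: "(\<lambda>i. ennreal (1 / w i)) \<in> borel_measurable (count_space modes)" by simp
    have ms: "(\<lambda>p. snd (fst p)) \<in> measurable (\<nu> \<Otimes>\<^sub>M \<nu>') (count_space modes)" by measurable
    have "Measurable.pred (\<nu> \<Otimes>\<^sub>M \<nu>') (\<lambda>p. snd (fst p) = snd (snd p))"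
    proof -
      have "Measurable.pred (\<nu> \<Otimes>\<^sub>M \<nu>') (\<lambda>p. \<exists>i\<in>modes. snd (fst p) = i \<and> snd (snd p) = i)"
        by (rule measurable_pred_countable) (auto simp: modes_def)
      also have "?this \<longleftrightarrow> ?thesis"
        by (rule measurable_cong) (auto simp: space_pair_measure s)
      finally show ?thesis .
    qed
    then have "{p \<in> space (\<nu> \<Otimes>\<^sub>M \<nu>'). snd (fst p) = snd (snd p)} \<in> sets (\<nu> \<Otimes>\<^sub>M \<nu>')"
      by (simp add: pred_def)
    then show ?thesis unfolding K_def
      by (intro measurable_If measurable_compose[OF ms mw] measurable_const) auto
  qed
  note [measurable] = KM
  have K1: "(\<integral>\<^sup>+z'. K z z' \<partial>\<nu>') = 1" if "z \<in> space \<nu>" for z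
  proof -
    have i: "snd z \<in> modes" using that by (auto simp: s)
    have "(\<integral>\<^sup>+z'. K z z' \<partial>\<nu>') = (\<integral>\<^sup>+z'. ennreal (1 / w (snd z)) * indicator (UNIV \<times> {snd z}) z' \<partial>\<nu>')"
      by (intro nn_integral_cong) (auto simp: K_def indicator_def)
    also have "\<dots> = ennreal (1 / w (snd z)) * emeasure \<nu>' (UNIV \<times> {snd z})"
      using i by (intro nn_integral_cmult_indicator) (auto simp: s state_space_def)
    also have "\<dots> = 1" using w[of "snd z"] by (simp add: ew[OF i] flip: ennreal_mult)
    finally show ?thesis .
  qed
  have K2: "(\<integral>\<^sup>+z. K z z' \<partial>\<nu>) = 1" if "z' \<in> space \<nu>'" for z'
  proof -
    have i: "snd z' \<in> modes" using that by (auto simp: s)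
    have "(\<integral>\<^sup>+z. K z z' \<partial>\<nu>) = (\<integral>\<^sup>+z. ennreal (1 / w (snd z')) * indicator (UNIV \<times> {snd z'}) z \<partial>\<nu>)"
      by (intro nn_integral_cong) (auto simp: K_def indicator_def)
    also have "\<dots> = ennreal (1 / w (snd z')) * emeasure \<nu> (UNIV \<times> {snd z'})"
      using i by (intro nn_integral_cmult_indicator) (auto simp: s state_space_def)
    also have "\<dots> = 1" using w[of "snd z'"] by (simp add: ew[OF i] flip: ennreal_mult)
    finally show ?thesis .
  qed
  define d where "d z z' = L * \<psi> (snd z) * \<bar>1 / (fst z)\<^sup>2 - 1 / (fst z')\<^sup>2\<bar> powr \<theta>" for z z' :: "real \<times> int"
  have d0: "0 \<le> d z z'" for z z' using L psi[of "snd z"] by (simp add: d_def)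
  \<comment> \<open>The cap at 1, legitimate because \<open>g\<close> is at most 1, permits
    dominated convergence even if \<open>d\<close> is not integrable.\<close>
  define e where "e n z z' = ennreal (min 1 (d z z' * exp (- \<kappa> * real n)))" for n z z'
  have [measurable]: "\<psi> \<in> borel_measurable (count_space modes)" by simp
  have [measurable]: "(\<lambda>p. e n (fst p) (snd p)) \<in> borel_measurable (\<nu> \<Otimes>\<^sub>M \<nu>')" for n
    unfolding e_def d_def by measurable
  have gM: "transition t g \<in> borel_measurable \<nu>" "transition t g \<in> borel_measurable \<nu>'" for t
    by (simp_all cong: measurable_cong_sets add: s)
  note [measurable] = gM
  have bound: "(\<integral>\<^sup>+z. g z \<partial>\<nu>) \<le> (\<integral>\<^sup>+z. g z \<partial>\<nu>') + (\<integral>\<^sup>+p. K (fst p) (snd p) * e n (fst p) (snd p) \<partial>(\<nu> \<Otimes>\<^sub>M \<nu>'))" for n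
  proof -
    let ?T = "transition (real n) g"
    have T1: "?T z \<le> 1" if "snd z \<in> modes" for z
      using that by (intro transition_le_1 g g1) (auto simp: space_state_space mem_Times_iff)
    have le: "?T z \<le> ?T z' + e n z z'" if zz: "z \<in> region \<sigma>" "z' \<in> region \<sigma>" "snd z = snd z'" for z z'
    proof -
      obtain x x' i where z: "z = (x, i)" "z' = (x', i)" using zz(3) by (cases z, cases z') auto
      have xi: "i \<in> modes" "sgn x = \<sigma>" "sgn x' = \<sigma>" using zz by (auto simp: z region_def)
      have "?T (x, i) \<le> ?T (x', i) + ennreal (L * \<psi> i * \<bar>1 / x\<^sup>2 - 1 / x'\<^sup>2\<bar> powr \<theta> * exp (- \<kappa> * real n))"
        by (rule transition_holder[OF psi L rates sg g holder of_nat_0_le_iff xi])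
      then have "?T z \<le> ?T z' + ennreal (d z z' * exp (- \<kappa> * real n))"
        by (simp only: z d_def fst_conv snd_conv)
      moreover have "?T z \<le> ?T z' + 1"
        using T1[of z] zz by (intro add_increasing) (auto simp: region_def)
      ultimately show ?thesis by (auto simp: e_def min_def)
    qed
    have "(\<integral>\<^sup>+z. g z \<partial>\<nu>) = (\<integral>\<^sup>+z. ?T z \<partial>\<nu>)"
      by (rule invariant_nn_integral[OF inv(1) _ g, symmetric]) simp
    also have "\<dots> = (\<integral>\<^sup>+z. (\<integral>\<^sup>+z'. K z z' \<partial>\<nu>') * ?T z \<partial>\<nu>)"
      by (intro nn_integral_cong) (simp add: K1)
    also have "\<dots> = (\<integral>\<^sup>+z. \<integral>\<^sup>+z'. K z z' * ?T z \<partial>\<nu>' \<partial>\<nu>)"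
    proof (intro nn_integral_cong nn_integral_multc[symmetric])
      fix z assume "z \<in> space \<nu>"
      from measurable_compose_Pair1[OF this KM] show "K z \<in> borel_measurable \<nu>'" by simp
    qed
    also have "\<dots> \<le> (\<integral>\<^sup>+z. \<integral>\<^sup>+z'. K z z' * ?T z' + K z z' * e n z z' \<partial>\<nu>' \<partial>\<nu>)"
    proof (intro nn_integral_mono_AE)
      show "AE z in \<nu>. (\<integral>\<^sup>+z'. K z z' * ?T z \<partial>\<nu>') \<le> (\<integral>\<^sup>+z'. K z z' * ?T z' + K z z' * e n z z' \<partial>\<nu>')"
        using AEr(1)
      proof eventually_elim
        case (elim z)
        show ?case
        proof (rule nn_integral_mono_AE)
          show "AE z' in \<nu>'. K z z' * ?T z \<le> K z z' * ?T z' + K z z' * e n z z'"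
            using AEr(2)
          proof eventually_elim
            case (elim z')
            show ?case
            proof (cases "snd z = snd z'")
              case True
              show ?thesis unfolding distrib_left[symmetric]
                by (intro mult_left_mono le elim \<open>z \<in> region \<sigma>\<close> True) simp
            qed (simp add: K_def)
          qed
        qed
      qed
    qed
    also have "\<dots> = (\<integral>\<^sup>+p. K (fst p) (snd p) * ?T (snd p) + K (fst p) (snd p) * e n (fst p) (snd p) \<partial>(\<nu> \<Otimes>\<^sub>M \<nu>'))"
      by (subst N'.nn_integral_fst[symmetric]) auto
    also have "\<dots> = (\<integral>\<^sup>+p. K (fst p) (snd p) * ?T (snd p) \<partial>(\<nu> \<Otimes>\<^sub>M \<nu>')) + (\<integral>\<^sup>+p. K (fst p) (snd p) * e n (fst p) (snd p) \<partial>(\<nu> \<Otimes>\<^sub>M \<nu>'))"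
      by (rule nn_integral_add) measurable
    also have "(\<integral>\<^sup>+p. K (fst p) (snd p) * ?T (snd p) \<partial>(\<nu> \<Otimes>\<^sub>M \<nu>')) = (\<integral>\<^sup>+z'. \<integral>\<^sup>+z. K z z' * ?T z' \<partial>\<nu> \<partial>\<nu>')"
      by (subst nn_integral_snd[symmetric]) (auto simp: case_prod_beta)
    also have "\<dots> = (\<integral>\<^sup>+z'. (\<integral>\<^sup>+z. K z z' \<partial>\<nu>) * ?T z' \<partial>\<nu>')"
    proof (intro nn_integral_cong nn_integral_multc)
      fix z' assume "z' \<in> space \<nu>'"
      from measurable_compose[OF measurable_Pair2'[OF this] KM] show "(\<lambda>z. K z z') \<in> borel_measurable \<nu>" by simp
    qed
    also have "\<dots> = (\<integral>\<^sup>+z'. ?T z' \<partial>\<nu>')" by (intro nn_integral_cong) (simp add: K2)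
    also have "\<dots> = (\<integral>\<^sup>+z. g z \<partial>\<nu>')"
      by (rule invariant_nn_integral[OF inv(2) _ g]) simp
    finally show ?thesis .
  qed
  have "(\<lambda>n. \<integral>\<^sup>+p. K (fst p) (snd p) * e n (fst p) (snd p) \<partial>(\<nu> \<Otimes>\<^sub>M \<nu>')) \<longlonglongrightarrow> (\<integral>\<^sup>+p. 0 \<partial>(\<nu> \<Otimes>\<^sub>M \<nu>'))"
  proof (rule nn_integral_dominated_convergence[where w = "\<lambda>p. K (fst p) (snd p)"])
    have "(\<integral>\<^sup>+p. K (fst p) (snd p) \<partial>(\<nu> \<Otimes>\<^sub>M \<nu>')) = (\<integral>\<^sup>+z. \<integral>\<^sup>+z'. K z z' \<partial>\<nu>' \<partial>\<nu>)"
      by (subst N'.nn_integral_fst[symmetric]) auto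
    also have "\<dots> = (\<integral>\<^sup>+z. 1 \<partial>\<nu>)" by (intro nn_integral_cong K1)
    finally show "(\<integral>\<^sup>+p. K (fst p) (snd p) \<partial>(\<nu> \<Otimes>\<^sub>M \<nu>')) < \<infinity>" by (simp add: N.emeasure_space_1)
    show "AE p in \<nu> \<Otimes>\<^sub>M \<nu>'. K (fst p) (snd p) * e n (fst p) (snd p) \<le> K (fst p) (snd p)" for n
    proof (rule AE_I2)
      fix p :: "(real \<times> int) \<times> (real \<times> int)"
      have "e n (fst p) (snd p) \<le> 1" unfolding e_def by (simp add: ennreal_le_1)
      then show "K (fst p) (snd p) * e n (fst p) (snd p) \<le> K (fst p) (snd p)"
        using mult_left_mono[of "e n (fst p) (snd p)" 1 "K (fst p) (snd p)"] by simp
    qed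
    show "AE p in \<nu> \<Otimes>\<^sub>M \<nu>'. (\<lambda>n. K (fst p) (snd p) * e n (fst p) (snd p)) \<longlonglongrightarrow> 0"
    proof (rule AE_I2)
      fix p :: "(real \<times> int) \<times> (real \<times> int)"
      let ?d = "d (fst p) (snd p)"
      have "(\<lambda>n. exp (- \<kappa>) ^ n) \<longlonglongrightarrow> 0" using kap by (intro LIMSEQ_power_zero) auto
      then have "(\<lambda>n. ?d * exp (- \<kappa> * real n)) \<longlonglongrightarrow> ?d * 0"
        by (intro tendsto_mult tendsto_const) (simp add: exp_of_nat_mult[symmetric] mult.commute)
      then have "(\<lambda>n. min 1 (?d * exp (- \<kappa> * real n))) \<longlonglongrightarrow> min 1 (?d * 0)"
        by (intro tendsto_min tendsto_const)
      then have "(\<lambda>n. e n (fst p) (snd p)) \<longlonglongrightarrow> ennreal (min 1 (?d * 0))"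
        unfolding e_def by (rule tendsto_ennrealI)
      then have "(\<lambda>n. e n (fst p) (snd p)) \<longlonglongrightarrow> 0" by simp
      then have "(\<lambda>n. K (fst p) (snd p) * e n (fst p) (snd p)) \<longlonglongrightarrow> K (fst p) (snd p) * 0"
        by (intro ennreal_tendsto_cmult) (auto simp: K_def)
      then show "(\<lambda>n. K (fst p) (snd p) * e n (fst p) (snd p)) \<longlonglongrightarrow> 0" by simp
    qed
  qed measurable
  then have "(\<lambda>n. (\<integral>\<^sup>+z. g z \<partial>\<nu>') + (\<integral>\<^sup>+p. K (fst p) (snd p) * e n (fst p) (snd p) \<partial>(\<nu> \<Otimes>\<^sub>M \<nu>'))) \<longlonglongrightarrow>
      (\<integral>\<^sup>+z. g z \<partial>\<nu>') + 0"
    by (intro tendsto_add tendsto_const) simp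
  then have "(\<integral>\<^sup>+z. g z \<partial>\<nu>) \<le> (\<integral>\<^sup>+z. g z \<partial>\<nu>') + 0"
    by (rule LIMSEQ_le_const) (use bound in auto)
  then show ?thesis by simp
qed

text \<open>The indicator of the level set is the limit of ramps of slope \<open>n\<close> with
  values in the unit interval. Their increments are bounded by 1 and by \<open>n\<close> times the
  distance, hence by the \<open>\<theta>\<close>-th power of the latter, which is the modulus that
  the contraction admits.\<close>

lemma invariant_upper_level_le:
  assumes case1: "lp / pp < - (lm / pm)" and sg: "\<sigma> \<noteq> 0"
    and inv: "invariant_prob P \<nu>" "invariant_prob P \<nu>'"
    and reg: "emeasure \<nu> (region \<sigma>) = 1" "emeasure \<nu>' (region \<sigma>) = 1"
  shows "emeasure \<nu> {z \<in> space state_space. c < 1 / (fst z)\<^sup>2 \<and> snd z = i} \<le>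
    emeasure \<nu>' {z \<in> space state_space. c < 1 / (fst z)\<^sup>2 \<and> snd z = i}"
proof -
  obtain \<theta> \<kappa> :: real and \<psi> :: "int \<Rightarrow> real" where th: "0 < \<theta>" "\<theta> \<le> 1" and kap: "0 < \<kappa>"
    and psi: "\<And>i. 1 \<le> \<psi> i"
    and rates: "\<And>i. i \<in> modes \<Longrightarrow> rate i * \<psi> (- i) \<le> (rate i + 2 * \<theta> * growth i - \<kappa>) * \<psi> i"
    using contraction_weights[OF case1] by metis
  define \<phi> where "\<phi> n y = min 1 (max 0 (real n * (y - c)))" for n and y :: real
  define g where "g n z = (if snd z = i then ennreal (\<phi> n (1 / (fst z)\<^sup>2)) else 0)" for n and z :: "real \<times> int"
  let ?A = "{z \<in> space state_space. c < 1 / (fst z)\<^sup>2 \<and> snd z = i}"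
  have [measurable]: "Measurable.pred state_space (\<lambda>z. snd z = i)"
    by (rule measurable_compose[OF measurable_state_projections(2)]) simp
  have g[measurable]: "g n \<in> borel_measurable state_space" for n
    unfolding g_def \<phi>_def by measurable
  have A[measurable]: "?A \<in> sets state_space" by measurable
  have g1: "g n z \<le> 1" for n z
    by (auto simp: g_def \<phi>_def ennreal_le_1)
  have holder: "g n (x, j) \<le> g n (x', j) + ennreal (real n powr \<theta> * \<psi> j * \<bar>1 / x\<^sup>2 - 1 / x'\<^sup>2\<bar> powr \<theta>)" for n x x' j
  proof (cases "j = i")
    case True
    let ?y = "1 / x\<^sup>2" and ?y' = "1 / x'\<^sup>2"
    let ?a = "real n * \<bar>?y - ?y'\<bar>"
    have "\<phi> n ?y - \<phi> n ?y' \<le> ?a"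
    proof -
      have "real n * (?y - c) - real n * (?y' - c) \<le> ?a"
        unfolding right_diff_distrib[symmetric] by (intro mult_left_mono) auto
      moreover have "0 \<le> ?a" by simp
      ultimately show ?thesis unfolding \<phi>_def by linarith
    qed
    moreover have "\<phi> n ?y - \<phi> n ?y' \<le> 1" by (simp add: \<phi>_def)
    ultimately have "\<phi> n ?y - \<phi> n ?y' \<le> min 1 ?a" by simp
    also have "min 1 ?a \<le> ?a powr \<theta>"
    proof (cases "?a \<le> 1")
      case True
      then have "?a powr 1 \<le> ?a powr \<theta>" using th by (intro powr_mono') auto
      then show ?thesis using True by simp
    next
      case False
      then show ?thesis using th by (simp add: ge_one_powr_ge_zero)
    qed
    also have "?a powr \<theta> = real n powr \<theta> * \<bar>?y - ?y'\<bar> powr \<theta>" by (simp add: powr_mult)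
    also have "\<dots> \<le> real n powr \<theta> * \<psi> j * \<bar>?y - ?y'\<bar> powr \<theta>"
      using psi[of j] by (intro mult_right_mono) (auto simp: mult_le_cancel_left1)
    finally have "\<phi> n ?y \<le> \<phi> n ?y' + real n powr \<theta> * \<psi> j * \<bar>?y - ?y'\<bar> powr \<theta>" by simp
    then have "ennreal (\<phi> n ?y) \<le> ennreal (\<phi> n ?y' + real n powr \<theta> * \<psi> j * \<bar>?y - ?y'\<bar> powr \<theta>)"
      by (rule ennreal_leI)
    also have "\<dots> = ennreal (\<phi> n ?y') + ennreal (real n powr \<theta> * \<psi> j * \<bar>?y - ?y'\<bar> powr \<theta>)"
      using psi[of j] by (intro ennreal_plus) (auto simp: \<phi>_def)
    finally show ?thesis using True by (simp add: g_def)
  qed (simp add: g_def)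
  have le: "(\<integral>\<^sup>+z. g n z \<partial>\<nu>) \<le> (\<integral>\<^sup>+z. g n z \<partial>\<nu>')" for n
    by (rule invariant_nn_integral_le[OF psi _ kap rates sg g g1 holder inv reg]) auto
  have lim: "(\<lambda>n. \<integral>\<^sup>+z. g n z \<partial>\<mu>) \<longlonglongrightarrow> emeasure \<mu> ?A" if inv: "invariant_prob P \<mu>" for \<mu>
  proof -
    interpret prob_space \<mu> by (rule invariant_prob_space[OF inv])
    have s: "sets \<mu> = sets state_space" "space \<mu> = space state_space"
      using invariant_sets[OF inv] by (auto dest: sets_eq_imp_space_eq)
    have "(\<lambda>n. \<integral>\<^sup>+z. g n z \<partial>\<mu>) \<longlonglongrightarrow> (\<integral>\<^sup>+z. indicator ?A z \<partial>\<mu>)"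
    proof (rule nn_integral_dominated_convergence[where w = "\<lambda>_. 1"])
      show "g n \<in> borel_measurable \<mu>" for n using g by (simp cong: measurable_cong_sets add: s)
      show "(\<integral>\<^sup>+z. 1 \<partial>\<mu>) < \<infinity>" by (simp add: emeasure_space_1)
      show "AE z in \<mu>. (\<lambda>n. g n z) \<longlonglongrightarrow> indicator ?A z"
      proof (rule AE_I2)
        fix z assume z: "z \<in> space \<mu>"
        show "(\<lambda>n. g n z) \<longlonglongrightarrow> indicator ?A z"
        proof (cases "z \<in> ?A")
          case True
          define a where "a = 1 / (fst z)\<^sup>2 - c"
          have a: "0 < a" using True by (simp add: a_def)
          obtain n0 where n0: "1 / a < real n0" using reals_Archimedean2 by blast
          have "g n z = indicator ?A z" if "n0 \<le> n" for n
          proof -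
            have "1 / a \<le> real n" using n0 that by linarith
            then have "1 \<le> real n * a" using a by (simp add: field_simps)
            then show ?thesis using True by (simp add: g_def \<phi>_def a_def)
          qed
          then show ?thesis by (intro tendsto_eventually) (auto simp: eventually_sequentially)
        next
          case False
          have "g n z = 0" for n
          proof (cases "snd z = i")
            case True
            with False z have "1 / (fst z)\<^sup>2 - c \<le> 0" by (auto simp: s)
            then have "real n * (1 / (fst z)\<^sup>2 - c) \<le> 0" by (simp add: mult_nonneg_nonpos)
            then show ?thesis by (simp add: g_def \<phi>_def max_absorb1)
          qed (simp add: g_def)
          then show ?thesis using False by simp
        qed
      qed
      show "indicator ?A \<in> borel_measurable \<mu>" using A by (intro borel_measurable_indicator) (simp add: s)
    qed (use g1 in auto)
    then show ?thesis using A by (simp add: s)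
  qed
  show ?thesis by (rule LIMSEQ_le[OF lim[OF inv(1)] lim[OF inv(2)]]) (use le in auto)
qed

text \<open>On a half line a state is recovered from its mode and from \<open>Y\<close>, so a
  measure there is determined by the laws of \<open>Y\<close> on the two modes, and these by their
  upper level sets. Exchanging the two measures turns the inequality for level sets into an
  equality.\<close>

lemma invariant_unique_on_region:
  assumes case1: "lp / pp < - (lm / pm)" and sg: "\<sigma> \<in> {- 1, 1}"
    and inv: "invariant_prob P \<nu>" "invariant_prob P \<nu>'"
    and reg: "emeasure \<nu> (region \<sigma>) = 1" "emeasure \<nu>' (region \<sigma>) = 1"
  shows "\<nu> = \<nu>'"
proof (rule measure_eqI)
  define Y where "Y z = 1 / (fst z)\<^sup>2" for z :: "real \<times> int"
  have Y[measurable]: "Y \<in> borel_measurable state_space" unfolding Y_def by measurable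
  have pi: "Measurable.pred state_space (\<lambda>z. snd z = i)" for i
    by (rule measurable_compose[OF measurable_state_projections(2)]) simp
  note [measurable] = pi
  define B where "B i = {z \<in> space state_space. snd z = i}" for i
  have B[measurable]: "B i \<in> sets state_space" for i unfolding B_def by measurable
  define m where "m \<mu> i = distr (density \<mu> (indicator (B i))) borel Y" for \<mu> :: "(real \<times> int) measure" and i
  have m_eq: "emeasure (m \<mu> i) D = emeasure \<mu> {z \<in> space state_space. Y z \<in> D \<and> snd z = i}"
    if inv: "invariant_prob P \<mu>" and D: "D \<in> sets borel" for \<mu> i D
  proof -
    have s: "sets \<mu> = sets state_space" "space \<mu> = space state_space"
      using invariant_sets[OF inv] by (auto dest: sets_eq_imp_space_eq)
    have Y': "Y \<in> borel_measurable (density \<mu> (indicator (B i)))"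
      using Y by (simp cong: measurable_cong_sets add: s)
    have "emeasure (m \<mu> i) D = emeasure (density \<mu> (indicator (B i))) (Y -` D \<inter> space state_space)"
      unfolding m_def using D by (subst emeasure_distr[OF Y']) (auto simp: s)
    also have "\<dots> = (\<integral>\<^sup>+z. indicator (B i) z * indicator (Y -` D \<inter> space state_space) z \<partial>\<mu>)"
      using measurable_sets[OF Y D] B[of i] by (intro emeasure_density borel_measurable_indicator) (auto simp: s)
    also have "\<dots> = (\<integral>\<^sup>+z. indicator {z \<in> space state_space. Y z \<in> D \<and> snd z = i} z \<partial>\<mu>)"
      by (intro nn_integral_cong) (auto simp: indicator_def B_def)
    also have "\<dots> = emeasure \<mu> {z \<in> space state_space. Y z \<in> D \<and> snd z = i}"
    proof -
      have "{z \<in> space state_space. Y z \<in> D \<and> snd z = i} \<in> sets state_space"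
        using D by measurable
      then show ?thesis by (simp add: s)
    qed
    finally show ?thesis .
  qed
  have m: "m \<nu> i = m \<nu>' i" for i
  proof (rule measure_eqI_lessThan)
    interpret N: prob_space \<nu> by (rule invariant_prob_space[OF inv(1)])
    show "sets (m \<nu> i) = sets borel" "sets (m \<nu>' i) = sets borel" by (simp_all add: m_def)
    show "emeasure (m \<nu> i) {c<..} < \<infinity>" for c
      by (subst m_eq[OF inv(1)]) (auto simp: less_top[symmetric])
    have sg0: "\<sigma> \<noteq> 0" using sg by auto
    show "emeasure (m \<nu> i) {c<..} = emeasure (m \<nu>' i) {c<..}" for c
      using invariant_upper_level_le[OF case1 sg0 inv reg, of c i]
        invariant_upper_level_le[OF case1 sg0 inv(2,1) reg(2,1), of c i]
      by (simp add: m_eq inv Y_def)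
  qed
  show "sets \<nu> = sets \<nu>'" using invariant_sets inv by simp
  fix A assume "A \<in> sets \<nu>"
  then have A[measurable]: "A \<in> sets state_space" using invariant_sets[OF inv(1)] by simp
  define D where "D i = {y. (\<sigma> / sqrt y, i) \<in> A}" for i
  have D: "D i \<in> sets borel" if "i \<in> modes" for i
  proof -
    have [measurable]: "(\<lambda>y :: real. \<sigma> / sqrt y) \<in> borel_measurable borel" by measurable
    have "(\<lambda>y. (\<sigma> / sqrt y, i)) \<in> measurable borel state_space"
      by (rule measurable_state) (use that in simp_all)
    from measurable_sets[OF this A]
    have "(\<lambda>y. (\<sigma> / sqrt y, i)) -` A \<inter> space borel \<in> sets borel" .
    moreover have "(\<lambda>y. (\<sigma> / sqrt y, i)) -` A \<inter> space borel = D i"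
      unfolding D_def by auto
    ultimately show ?thesis by (simp only:)
  qed
  have split: "emeasure \<mu> A = (\<Sum>i\<in>modes. emeasure (m \<mu> i) (D i))"
    if inv: "invariant_prob P \<mu>" and reg: "emeasure \<mu> (region \<sigma>) = 1" for \<mu>
  proof -
    interpret prob_space \<mu> by (rule invariant_prob_space[OF inv])
    have s: "sets \<mu> = sets state_space" "space \<mu> = UNIV \<times> modes"
      using invariant_sets[OF inv] invariant_space[OF inv] by auto
    have AE: "AE z in \<mu>. z \<in> region \<sigma>"
      using reg s by (intro AE_prob_1) (simp add: emeasure_eq_measure)
    have S: "{z \<in> space state_space. Y z \<in> D i \<and> snd z = i} \<in> sets state_space" if "i \<in> modes" for i
    proof -
      have "{z \<in> space state_space. Y z \<in> D i \<and> snd z = i} = (Y -` D i \<inter> space state_space) \<inter> B i"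
        by (auto simp: B_def)
      then show ?thesis using measurable_sets[OF Y D[OF that]] B[of i] by simp
    qed
    have "emeasure \<mu> A = emeasure \<mu> (\<Union>i\<in>modes. {z \<in> space state_space. Y z \<in> D i \<and> snd z = i})"
    proof (rule emeasure_eq_AE)
      show "AE z in \<mu>. (z \<in> A) = (z \<in> (\<Union>i\<in>modes. {z \<in> space state_space. Y z \<in> D i \<and> snd z = i}))"
        using AE
      proof eventually_elim
        case (elim z)
        obtain x i where z: "z = (x, i)" by (cases z)
        have x: "sgn x = \<sigma>" "i \<in> modes" using elim by (auto simp: region_def z)
        have "\<sigma> / sqrt (1 / x\<^sup>2) = sgn x * \<bar>x\<bar>" by (simp add: real_sqrt_divide x)
        then have "\<sigma> / sqrt (1 / x\<^sup>2) = x" by (simp add: sgn_mult_abs)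
        then show ?case using x by (auto simp: z D_def Y_def space_state_space)
      qed
      show "(\<Union>i\<in>modes. {z \<in> space state_space. Y z \<in> D i \<and> snd z = i}) \<in> sets \<mu>"
        using S by (auto simp: s modes_def)
    qed (use A s in auto)
    also have "\<dots> = (\<Sum>i\<in>modes. emeasure \<mu> {z \<in> space state_space. Y z \<in> D i \<and> snd z = i})"
      using S by (intro sum_emeasure[symmetric]) (auto simp: s disjoint_family_on_def modes_def)
    also have "\<dots> = (\<Sum>i\<in>modes. emeasure (m \<mu> i) (D i))"
      by (intro sum.cong refl) (simp add: m_eq[OF inv D])
    finally show ?thesis .
  qed
  show "emeasure \<nu> A = emeasure \<nu>' A"
    using split[OF inv(1) reg(1)] split[OF inv(2) reg(2)] by (simp add: m)
qed

section \<open>Classification\<close>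

text \<open>Each of the three regions carries exactly one invariant probability measure, and an
  ergodic one is carried by a single region. The three measures differ because the regions are
  disjoint.\<close>

lemma ergodic_classification:
  assumes case1: "lp / pp < - (lm / pm)"
  shows "{\<nu>. ergodic_prob P \<nu>} = {delta_measure lm lp, stat_measure 1, stat_measure (- 1)}"
    and "card {\<nu>. ergodic_prob P \<nu>} = 3"
proof -
  have delta0: "emeasure (delta_measure lm lp) (region 0) = 1"
  proof -
    have s: "space (delta_measure lm lp) = space state_space"
      using sets_delta_measure by (rule sets_eq_imp_space_eq)
    have "emeasure (delta_measure lm lp) (region 0) = (\<integral>\<^sup>+z. indicator (region 0) z \<partial>delta_measure lm lp)"
      by (simp add: sets_delta_measure)
    also have "\<dots> = (\<integral>\<^sup>+z. 1 \<partial>delta_measure lm lp)"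
      by (subst (1 2) nn_integral_delta_measure) (auto simp: region_def modes_def)
    also have "\<dots> = 1" using prob_space.emeasure_space_1[OF prob_space_delta_measure] by simp
    finally show ?thesis .
  qed
  have at_zero: "\<nu> = delta_measure lm lp"
    if inv: "invariant_prob P \<nu>" and reg: "emeasure \<nu> (region 0) = 1" for \<nu>
  proof (rule invariant_at_zero_eq_delta[OF inv])
    interpret prob_space \<nu> by (rule invariant_prob_space[OF inv])
    have "AE z in \<nu>. z \<in> region 0"
      using reg invariant_sets[OF inv] by (intro AE_prob_1) (simp add: emeasure_eq_measure)
    then show "AE z in \<nu>. fst z = 0" by eventually_elim (auto simp: region_def sgn_zero_iff)
  qed
  have stat: "\<nu> = stat_measure \<sigma>"
    if "\<sigma> \<in> {- 1, 1}" "invariant_prob P \<nu>" "emeasure \<nu> (region \<sigma>) = 1" for \<nu> \<sigma>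
    using that by (intro invariant_unique_on_region[OF case1, of \<sigma>] invariant_stat_measure[OF case1]
        emeasure_stat_measure_region[OF case1])
  show eq: "{\<nu>. ergodic_prob P \<nu>} = {delta_measure lm lp, stat_measure 1, stat_measure (- 1)}"
  proof (intro equalityI subsetI)
    fix \<nu> assume "\<nu> \<in> {\<nu>. ergodic_prob P \<nu>}"
    then have erg: "ergodic_prob P \<nu>" by simp
    then have inv: "invariant_prob P \<nu>" by (simp add: ergodic_prob_def)
    obtain \<sigma> where "\<sigma> \<in> {- 1, 0, 1}" "emeasure \<nu> (region \<sigma>) = 1"
      by (rule ergodic_region[OF erg])
    then show "\<nu> \<in> {delta_measure lm lp, stat_measure 1, stat_measure (- 1)}"
      using at_zero[OF inv] stat[OF _ inv, of \<sigma>] by auto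
  next
    fix \<nu> assume "\<nu> \<in> {delta_measure lm lp, stat_measure 1, stat_measure (- 1)}"
    moreover have "ergodic_prob P (delta_measure lm lp)"
      by (rule ergodic_of_unique_on_region[OF invariant_delta_measure _ delta0])
        (use at_zero in auto)
    moreover have "ergodic_prob P (stat_measure \<sigma>)" if "\<sigma> \<in> {- 1, 1}" for \<sigma>
      by (rule ergodic_of_unique_on_region[OF invariant_stat_measure[OF case1 that] _
            emeasure_stat_measure_region[OF case1 that]]) (use stat[OF that] in auto)
    ultimately show "\<nu> \<in> {\<nu>. ergodic_prob P \<nu>}" by auto
  qed
  have disj: "\<mu> \<noteq> \<mu>'"
    if inv: "invariant_prob P \<mu>" and "emeasure \<mu> (region \<sigma>) = 1" "emeasure \<mu>' (region \<sigma>') = 1" "\<sigma> \<noteq> \<sigma>'"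
    for \<mu> \<mu>' \<sigma> \<sigma>'
  proof
    assume "\<mu> = \<mu>'"
    interpret prob_space \<mu> by (rule invariant_prob_space[OF inv])
    have "prob (region \<sigma> \<union> region \<sigma>') = prob (region \<sigma>) + prob (region \<sigma>')"
      using \<open>\<sigma> \<noteq> \<sigma>'\<close> invariant_sets[OF inv] by (intro finite_measure_Union) (auto simp: region_def[of \<sigma>] region_def[of \<sigma>'] sets_region[unfolded region_def])
    moreover have "prob (region \<sigma>) = 1" "prob (region \<sigma>') = 1"
      using that \<open>\<mu> = \<mu>'\<close> by (simp_all add: measure_def)
    moreover have "prob (region \<sigma> \<union> region \<sigma>') \<le> 1" by (rule prob_le_1)
    ultimately show False by simp
  qed
  have one: "(1 :: real) \<in> {- 1, 1}" "(- 1 :: real) \<in> {- 1, 1}" by auto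
  note r1 = emeasure_stat_measure_region[OF case1 one(1)] and r2 = emeasure_stat_measure_region[OF case1 one(2)]
  have "delta_measure lm lp \<noteq> stat_measure 1"
    by (rule disj[OF invariant_delta_measure delta0 r1]) simp
  moreover have "delta_measure lm lp \<noteq> stat_measure (- 1)"
    by (rule disj[OF invariant_delta_measure delta0 r2]) simp
  moreover have "stat_measure 1 \<noteq> stat_measure (- 1)"
    by (rule disj[OF invariant_stat_measure[OF case1 one(1)] r1 r2]) simp
  ultimately show "card {\<nu>. ergodic_prob P \<nu>} = 3" unfolding eq by simp
qed

end

theorem theorem3p1:
  fixes pm pp lm lp :: real
    and M :: "real \<times> int \<Rightarrow> 'w measure"
    and X :: "real \<times> int \<Rightarrow> real \<Rightarrow> 'w \<Rightarrow> real"
    and E :: "real \<times> int \<Rightarrow> real \<Rightarrow> 'w \<Rightarrow> int"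
    and P :: "real \<Rightarrow> real \<times> int \<Rightarrow> (real \<times> int) measure"
  assumes "pm < 0" and "0 < pp" and "0 < lm" and "0 < lp"
    and "\<And>z. z \<in> space state_space \<Longrightarrow>
           pdmp_from (cubic_field pm pp) (switch_rate lm lp) z (M z) (X z) (E z)"
    and "P = pdmp_semigroup M X E"
  shows "(lp / pp < - (lm / pm) \<longrightarrow>
           (\<exists>\<mu> \<pi>. {\<nu>. ergodic_prob P \<nu>} = {delta_measure lm lp, \<mu>, \<pi>} \<and>
                  card {\<nu>. ergodic_prob P \<nu>} = 3 \<and>
                  emeasure \<mu> ({0<..} \<times> modes) = 1 \<and>
                  emeasure \<pi> ({..<0} \<times> modes) = 1)) \<and>
         (lp / pp \<ge> - (lm / pm) \<longrightarrow>
           {\<nu>. invariant_prob P \<nu>} = {delta_measure lm lp})"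
proof -
  interpret C: cubic_switching pm pp lm lp using assms by unfold_locales
  have "cubic_semigroup pm pp lm lp P"
  proof (intro cubic_semigroup.intro cubic_semigroup_axioms.intro C.cubic_switching_axioms)
    fix t :: real and z :: "real \<times> int"
    assume t: "0 \<le> t" and z: "z \<in> space state_space"
    note pdmp = assms(5)[OF z]
    have M: "prob_space (M z)" and X: "X z t \<in> borel_measurable (M z)"
      and E: "E z t \<in> measurable (M z) (count_space modes)"
      using pdmp t by (auto simp: pdmp_from_def switching_chain_def)
    have XE: "(\<lambda>\<omega>. (X z t \<omega>, E z t \<omega>)) \<in> measurable (M z) state_space"
      by (rule measurable_state[OF X E])
    show "prob_space (P t z)"
      unfolding assms(6) pdmp_semigroup_def by (rule prob_space.prob_space_distr[OF M XE])
    show "sets (P t z) = sets state_space" by (simp add: assms(6) pdmp_semigroup_def)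
    fix g :: "real \<times> int \<Rightarrow> ennreal" assume g: "g \<in> borel_measurable state_space"
    show "(\<integral>\<^sup>+w. g w \<partial>P t z) = C.transition t g z"
      unfolding assms(6) pdmp_semigroup_def using C.nn_integral_process[OF z pdmp t g] g
      by (subst nn_integral_distr[OF XE]) simp_all
  qed
  then interpret cubic_semigroup pm pp lm lp P .
  show ?thesis
  proof (intro conjI impI)
    assume case1: "lp / pp < - (lm / pm)"
    have "emeasure (C.stat_measure 1) ({0<..} \<times> modes) = 1" "emeasure (C.stat_measure (- 1)) ({..<0} \<times> modes) = 1"
      using emeasure_stat_measure_region[OF case1, of 1] emeasure_stat_measure_region[OF case1, of "- 1"]
      by (simp_all add: region_simps)
    then show "\<exists>\<mu> \<pi>. {\<nu>. ergodic_prob P \<nu>} = {delta_measure lm lp, \<mu>, \<pi>} \<and>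
                  card {\<nu>. ergodic_prob P \<nu>} = 3 \<and>
                  emeasure \<mu> ({0<..} \<times> modes) = 1 \<and>
                  emeasure \<pi> ({..<0} \<times> modes) = 1"
      using ergodic_classification[OF case1] by blast
  next
    assume "lp / pp \<ge> - (lm / pm)"
    then have "pp * lm \<le> - pm * lp"
      using assms(1-4) by (simp add: field_simps)
    then show "{\<nu>. invariant_prob P \<nu>} = {delta_measure lm lp}"
      using invariant_eq_delta invariant_delta_measure by blast
  qed
qed

end
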